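(* Let $\mathcal{X},\mathcal{Y}$ be closed convex sets and $f=\frac1n\sum_{i=1}^n f_i:\mathcal{X}\times\mathcal{Y}\to\mathbb{R}$, where each $f_i(\mathbf{x},\mathbf{y})$ is differentiable, convex in $\mathbf{x}$ and concave in $\mathbf{y}$, $\{f_i\}_{i=1}^n$ is $L$-average smooth, and $f$ is $(\mu_x,\mu_y)$-convex-concave with $0<\mu_x<\mu_y$. Put $\kappa_x=L/\mu_x$, $\kappa_y=L/\mu_y$, $\Delta_f=\max_{\mathbf{y}\in\mathcal{Y}}f(\mathbf{x}_0,\mathbf{y})-\min_{\mathbf{x}\in\mathcal{X}}f(\mathbf{x},\mathbf{y}_0)$, and let $\varepsilon>0$. Run the algorithm AL-SVRE (defined in the context) from $(\mathbf{x}_0,\mathbf{y}_0)\in\mathcal{X}\times\mathcal{Y}$ with $$\beta=\begin{cases}\mu_y-\mu_x,&\text{if }\kappa_y\ge\sqrt n,\\ L/\sqrt n-\mu_x,&\text{if }\kappa_x>\sqrt n>\kappa_y,\\ 0,&\text{otherwise,}\end{cases}$$ $q=\mu_x/(\mu_x+\beta)$, $\rho=0.5\sqrt q$, $p=1/(2n)$, $\tau_k=1/(4\sqrt n(L+\beta))$, $$T_k=\left\lceil 4\left(n+\frac{2\sqrt{n}(L+\beta)}{\min\{\mu_x+\beta,\mu_y\}}\right)\log\left(12\left(\frac{2}{1-\rho}+\frac{1728\,\beta(L+\beta)(7(L+\beta)+2\sqrt{n}\mu_y)}{\mu_x\mu_y\min\{\mu_x,\mu_y\}(1-\rho)^2(\sqrt{q}-\rho)^2}\right)\right)\right\rceil$$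 and $$K=\left\lceil\frac{2}{\sqrt q}\log\left(\frac{10992\sqrt n\,\Delta_f\,\kappa_y\kappa_x^3}{\varepsilon}\right)\right\rceil.$$ Then $$\mathbb{E}\left[\max_{\mathbf{y}\in\mathcal{Y}}f(\mathbf{x}_K,\mathbf{y})-\min_{\mathbf{x}\in\mathcal{X}}f(\mathbf{x},\mathbf{y}_K)\right]\le\varepsilon,$$ with the number of SFO calls at most $$\mathcal{O}\left(\sqrt{n(\sqrt n+\kappa_x)(\sqrt n+\kappa_y)}\,\log(n\kappa_x)\,\log\left(\frac{n\Delta_f\kappa_y\kappa_x}{\varepsilon}\right)\right).$$
   Context: Average smoothness: differentiable functions $\{f_i\}_{i=1}^n$ are $L$-average smooth if $\frac1n\sum_{i=1}^n\|\nabla f_i(\mathbf{z})-\nabla f_i(\mathbf{z}')\|_2^2\le L^2\|\mathbf{z}-\mathbf{z}'\|_2^2$ for all $\mathbf{z},\mathbf{z}'$ in the domain. $f$ is $(\mu_x,\mu_y)$-convex-concave if $f(\cdot,\mathbf{y})$ is $\mu_x$-strongly convex for every $\mathbf{y}$ and $f(\mathbf{x},\cdot)$ is $\mu_y$-strongly concave for every $\mathbf{x}$. $\mathcal{P}_{\mathcal{C}}$ denotes Euclidean projection onto $\mathcal{C}$. An SFO (stochastic first-order oracle) call is one evaluation of the gradient $\nabla f_i$ of a single component at a point; evaluating $\nabla f$ costs $n$ calls, and each iteration of L-SVRE with $p=1/(2n)$ costs $\mathcal{O}(1)$ calls in expectation (the full gradient at $\mathbf{w}_k$ is recomputed only when $\mathbf{w}_k$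 changes); the number of SFO calls is understood in expectation over the algorithm's randomness. Algorithm L-SVRE$(\{h_i\}_{i=1}^n,(\mathbf{x}_0,\mathbf{y}_0),\tau,p,T)$, for $h=\frac1n\sum_i h_i$ on $\mathcal{Z}=\mathcal{X}\times\mathcal{Y}$: let $\mathbf{g}=(\nabla_{\mathbf{x}}h,-\nabla_{\mathbf{y}}h)$, $\mathbf{g}_i=(\nabla_{\mathbf{x}}h_i,-\nabla_{\mathbf{y}}h_i)$, $\alpha=1-p$, $\mathbf{z}_0=\mathbf{w}_0=(\mathbf{x}_0,\mathbf{y}_0)$. For $k=0,\dots,T-1$: $\bar{\mathbf{z}}_k=\alpha\mathbf{z}_k+(1-\alpha)\mathbf{w}_k$; $\mathbf{z}_{k+1/2}=\mathcal{P}_{\mathcal{Z}}(\bar{\mathbf{z}}_k-\tau\mathbf{g}(\mathbf{w}_k))$; draw $i\in\{1,\dots,n\}$ uniformly at random; $\mathbf{z}_{k+1}=\mathcal{P}_{\mathcal{Z}}(\bar{\mathbf{z}}_k-\tau[\mathbf{g}(\mathbf{w}_k)+\mathbf{g}_i(\mathbf{z}_{k+1/2})-\mathbf{g}_i(\mathbf{w}_k)])$; $\mathbf{w}_{k+1}=\mathbf{z}_{k+1}$ with probability $p$ and $\mathbf{w}_{k+1}=\mathbf{w}_k$ with probability $1-p$. Output $\mathbf{z}_T$. All random choices are independent. Algorithm AL-SVRE$(\{f_i\}_{i=1}^n,(\mathbf{x}_0,\mathbf{y}_0),\beta,q,K,p,\{\tau_k\}_{k=1}^K,\{T_k\}_{k=1}^K)$: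 set $\gamma=\frac{1-\sqrt q}{1+\sqrt q}$ and $\mathbf{u}_0=\mathbf{x}_0$. For $k=1,\dots,K$, with $F_k(\mathbf{x},\mathbf{y})=f(\mathbf{x},\mathbf{y})+\frac{\beta}{2}\|\mathbf{x}-\mathbf{u}_{k-1}\|_2^2$: (1) $(\tilde{\mathbf{x}}_k,\tilde{\mathbf{y}}_k)=$ L-SVRE$\big(\{f_i(\mathbf{x},\mathbf{y})+\frac{\beta}{2}\|\mathbf{x}-\mathbf{u}_{k-1}\|_2^2\}_{i=1}^n,(\mathbf{x}_{k-1},\mathbf{y}_{k-1}),\tau_k,p,T_k\big)$; (2) $\mathbf{x}_k=\mathcal{P}_{\mathcal{X}}(\tilde{\mathbf{x}}_k-\tau_k\nabla_{\mathbf{x}}F_k(\tilde{\mathbf{x}}_k,\tilde{\mathbf{y}}_k))$; (3) $\mathbf{y}_k=\mathcal{P}_{\mathcal{Y}}(\tilde{\mathbf{y}}_k+\tau_k\nabla_{\mathbf{y}}F_k(\tilde{\mathbf{x}}_k,\tilde{\mathbf{y}}_k))$; (4) $\mathbf{u}_k=\mathbf{x}_k+\gamma(\mathbf{x}_k-\mathbf{x}_{k-1})$. Output $(\mathbf{x}_K,\mathbf{y}_K)$.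
   Formalization: Formalized with μ_y ≤ L assumed when Y is a single point, with each log in the O-bound read as max{1, log}, and with the SFO bound claimed only for ε ≤ Δ_f; without these the stated claims fail (e.g. n=1, ε=κ_xκ_yΔ_f makes the bound 0 while K ≥ 1). *)

theory Defs
  imports "HOL-Probability.Probability"
begin

definition strongly_convex_on :: "real \<Rightarrow> 'a::real_normed_vector set \<Rightarrow> ('a \<Rightarrow> real) \<Rightarrow> bool"
  where "strongly_convex_on \<mu> S f \<longleftrightarrow> convex S \<and>
    (\<forall>x\<in>S. \<forall>y\<in>S. \<forall>u\<ge>0. \<forall>v\<ge>0. u + v = 1 \<longrightarrow>
      f (u *\<^sub>R x + v *\<^sub>R y) \<le> u * f x + v * f y - \<mu> / 2 * u * v * (norm (x - y))\<^sup>2)"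

definition strongly_concave_on :: "real \<Rightarrow> 'a::real_normed_vector set \<Rightarrow> ('a \<Rightarrow> real) \<Rightarrow> bool"
  where "strongly_concave_on \<mu> S f \<longleftrightarrow> strongly_convex_on \<mu> S (\<lambda>x. - f x)"

definition convex_concave ::
    "real \<Rightarrow> real \<Rightarrow> 'a::real_normed_vector set \<Rightarrow> 'b::real_normed_vector set \<Rightarrow> ('a \<times> 'b \<Rightarrow> real) \<Rightarrow> bool"
  where "convex_concave \<mu>x \<mu>y X Y f \<longleftrightarrow>
    (\<forall>y\<in>Y. strongly_convex_on \<mu>x X (\<lambda>x. f (x, y))) \<and>
    (\<forall>x\<in>X. strongly_concave_on \<mu>y Y (\<lambda>y. f (x, y)))"

(* The gradient of f on Z is given as a vector field: if Z has empty interior, the derivative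
   within Z does not determine a unique gradient, and any choice is admitted. *)
definition gradient_on :: "'a::real_inner set \<Rightarrow> ('a \<Rightarrow> real) \<Rightarrow> ('a \<Rightarrow> 'a) \<Rightarrow> bool"
  where "gradient_on Z f f' \<longleftrightarrow>
    (\<forall>z\<in>Z. (f has_derivative (\<lambda>h. f' z \<bullet> h)) (at z within Z))"

definition avg :: "nat \<Rightarrow> (nat \<Rightarrow> 'a::real_vector) \<Rightarrow> 'a"
  where "avg n a = (1 / real n) *\<^sub>R (\<Sum>i=1..n. a i)"

definition average_smooth :: "nat \<Rightarrow> (nat \<Rightarrow> 'a::real_normed_vector \<Rightarrow> 'a) \<Rightarrow> 'a set \<Rightarrow> real \<Rightarrow> bool"
  where "average_smooth n f' Z L \<longleftrightarrow>
    (\<forall>z\<in>Z. \<forall>z'\<in>Z. avg n (\<lambda>i. (norm (f' i z - f' i z'))\<^sup>2) \<le> L\<^sup>2 * (norm (z - z'))\<^sup>2)"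

(* For strongly convex-concave f with closed X and Y, both extrema are attained. *)
definition duality_gap :: "('a \<times> 'b \<Rightarrow> real) \<Rightarrow> 'a set \<Rightarrow> 'b set \<Rightarrow> 'a \<Rightarrow> 'b \<Rightarrow> real"
  where "duality_gap f X Y x y =
    (GREATEST v. v \<in> (\<lambda>y'. f (x, y')) ` Y) - (LEAST v. v \<in> (\<lambda>x'. f (x', y)) ` X)"

definition saddle_field :: "('z \<Rightarrow> 'a \<times> 'b::uminus) \<Rightarrow> 'z \<Rightarrow> 'a \<times> 'b"
  where "saddle_field h' z = (fst (h' z), - snd (h' z))"

(* The state is (z_k, w_k, c), with c the number of component gradients evaluated so far.
   An iteration evaluates the i-th gradient at z_{k+1/2} and at w_k; the full gradient at the
   reference point is stored, and costs n further evaluations when that point is replaced. *)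
definition lsvre_step ::
    "nat \<Rightarrow> (nat \<Rightarrow> 'a::euclidean_space \<times> 'b::euclidean_space \<Rightarrow> 'a \<times> 'b) \<Rightarrow> ('a \<times> 'b) set \<Rightarrow>
     real \<Rightarrow> real \<Rightarrow> ('a \<times> 'b) \<times> ('a \<times> 'b) \<times> nat \<Rightarrow> (('a \<times> 'b) \<times> ('a \<times> 'b) \<times> nat) pmf"
  where "lsvre_step n h' Z \<tau> p = (\<lambda>(z, w, c).
    let \<alpha> = 1 - p;
        g = saddle_field (\<lambda>v. avg n (\<lambda>i. h' i v));
        gi = (\<lambda>i. saddle_field (h' i));
        z_bar = \<alpha> *\<^sub>R z + (1 - \<alpha>) *\<^sub>R w;
        z_half = closest_point Z (z_bar - \<tau> *\<^sub>R g w)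
    in do {
      i \<leftarrow> pmf_of_set {1..n};
      let z_new = closest_point Z (z_bar - \<tau> *\<^sub>R (g w + gi i z_half - gi i w));
      b \<leftarrow> bernoulli_pmf p;
      return_pmf (if b then (z_new, z_new, c + 2 + n) else (z_new, w, c + 2))
    })"

primrec lsvre_run ::
    "nat \<Rightarrow> (nat \<Rightarrow> 'a::euclidean_space \<times> 'b::euclidean_space \<Rightarrow> 'a \<times> 'b) \<Rightarrow> ('a \<times> 'b) set \<Rightarrow>
     'a \<times> 'b \<Rightarrow> real \<Rightarrow> real \<Rightarrow> nat \<Rightarrow> (('a \<times> 'b) \<times> ('a \<times> 'b) \<times> nat) pmf"
  where
    "lsvre_run n h' Z z0 \<tau> p 0 = return_pmf (z0, z0, n)"
  | "lsvre_run n h' Z z0 \<tau> p (Suc k) = lsvre_run n h' Z z0 \<tau> p k \<bind> lsvre_step n h' Z \<tau> p"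

definition lsvre ::
    "nat \<Rightarrow> (nat \<Rightarrow> 'a::euclidean_space \<times> 'b::euclidean_space \<Rightarrow> 'a \<times> 'b) \<Rightarrow> ('a \<times> 'b) set \<Rightarrow>
     'a \<times> 'b \<Rightarrow> real \<Rightarrow> real \<Rightarrow> nat \<Rightarrow> (('a \<times> 'b) \<times> nat) pmf"
  where "lsvre n h' Z z0 \<tau> p T = map_pmf (\<lambda>(z, w, c). (z, c)) (lsvre_run n h' Z z0 \<tau> p T)"

(* Gradient in (x, y) of h(x, y) + (\<beta>/2) ||x - u||^2, given the gradient field h' of h. *)
definition prox_grad ::
    "real \<Rightarrow> 'a::real_vector \<Rightarrow> ('a \<times> 'b::real_vector \<Rightarrow> 'a \<times> 'b) \<Rightarrow> 'a \<times> 'b \<Rightarrow> 'a \<times> 'b"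
  where "prox_grad \<beta> u h' z = h' z + (\<beta> *\<^sub>R (fst z - u), 0)"

(* The state is (x_k, y_k, u_k, c), with c as above.  After the call of the inner solver, one full
   gradient (n evaluations) at its output serves both projection steps. *)
definition al_svre_step ::
    "nat \<Rightarrow> (nat \<Rightarrow> 'a::euclidean_space \<times> 'b::euclidean_space \<Rightarrow> 'a \<times> 'b) \<Rightarrow> 'a set \<Rightarrow> 'b set \<Rightarrow>
     real \<Rightarrow> real \<Rightarrow> real \<Rightarrow> real \<Rightarrow> nat \<Rightarrow> 'a \<times> 'b \<times> 'a \<times> nat \<Rightarrow> ('a \<times> 'b \<times> 'a \<times> nat) pmf"
  where "al_svre_step n f' X Y \<beta> q p \<tau> T = (\<lambda>(x, y, u, c). do {
      let \<gamma> = (1 - sqrt q) / (1 + sqrt q);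
      let F' = (\<lambda>i. prox_grad \<beta> u (f' i));
      (z, c') \<leftarrow> lsvre n F' (X \<times> Y) (x, y) \<tau> p T;
      let G = avg n (\<lambda>i. F' i z);
      let x_new = closest_point X (fst z - \<tau> *\<^sub>R fst G);
      let y_new = closest_point Y (snd z + \<tau> *\<^sub>R snd G);
      let u_new = x_new + \<gamma> *\<^sub>R (x_new - x);
      return_pmf (x_new, y_new, u_new, c + c' + n)
    })"

primrec al_svre_run ::
    "nat \<Rightarrow> (nat \<Rightarrow> 'a::euclidean_space \<times> 'b::euclidean_space \<Rightarrow> 'a \<times> 'b) \<Rightarrow> 'a set \<Rightarrow> 'b set \<Rightarrow>
     'a \<times> 'b \<Rightarrow> real \<Rightarrow> real \<Rightarrow> real \<Rightarrow> (nat \<Rightarrow> real) \<Rightarrow> (nat \<Rightarrow> nat) \<Rightarrow> nat \<Rightarrow>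
     ('a \<times> 'b \<times> 'a \<times> nat) pmf"
  where
    "al_svre_run n f' X Y z0 \<beta> q p \<tau> T 0 = return_pmf (fst z0, snd z0, fst z0, 0)"
  | "al_svre_run n f' X Y z0 \<beta> q p \<tau> T (Suc k) =
      al_svre_run n f' X Y z0 \<beta> q p \<tau> T k \<bind>
      al_svre_step n f' X Y \<beta> q p (\<tau> (Suc k)) (T (Suc k))"

(* Joint distribution of the output (x_K, y_K) and of the number of component gradients evaluated. *)
definition al_svre ::
    "nat \<Rightarrow> (nat \<Rightarrow> 'a::euclidean_space \<times> 'b::euclidean_space \<Rightarrow> 'a \<times> 'b) \<Rightarrow> 'a set \<Rightarrow> 'b set \<Rightarrow>
     'a \<times> 'b \<Rightarrow> real \<Rightarrow> real \<Rightarrow> nat \<Rightarrow> real \<Rightarrow> (nat \<Rightarrow> real) \<Rightarrow> (nat \<Rightarrow> nat) \<Rightarrow>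
     (('a \<times> 'b) \<times> nat) pmf"
  where "al_svre n f' X Y z0 \<beta> q K p \<tau> T =
    map_pmf (\<lambda>(x, y, u, c). ((x, y), c)) (al_svre_run n f' X Y z0 \<beta> q p \<tau> T K)"

end

(* Write Phi(x) = max_y f(x, y), q = mux / (mux + beta) and s = sqrt q.  The outer loop is Nesterov's
   method on Phi with inexact proximal steps: with v = x + ((1 + s) / s) (u - x), the quantity
   V = Phi(x) - min Phi + mux/2 |v - x*|^2 contracts by (1 - s) / (1 - s/4) per stage up to an error
   proportional to the gap of the proximal subproblem.  That gap is at most a constant times
   d^2 = |z - z*(u)|^2, where z is the output of L-SVRE and z*(u) the saddle point of the subproblem
   with centre u.  L-SVRE contracts the squared distance linearly in expectation, so E d^2 is a small
   multiple of the squared distance P of its starting point to z*(u); and as z*(u) depends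
   Lipschitz-continuously on u, the next P is bounded by d^2 and the two values of V.  The
   expectations of V, P and d^2 thus obey a linear recursion, under which all three decay like
   (1 - s/2)^k.  The final gap of f is bounded by the gap of the last subproblem and |x_K - u_(K-1)|^2. *)
theory Submission
  imports Defs
begin

section \<open>Finitely supported expectations and averages\<close>

text \<open>The sets may be unbounded and Phi is never differentiated: saddle points and best
  responses come from strongly monotone variational inequalities, and the outer analysis works with
  values and strong convexity of Phi alone. The regimes of \<open>\<beta>\<close> balance two costs.
  Up to logarithms a stage takes n + sqrt(n) L / (mux + beta) inner iterations, and 1/s = sqrt((mux
  + beta) / mux) stages gain a constant factor. Raising beta pays until mux + beta reaches muy,
  which then limits the conditioning of the subproblem, or until the second summand falls to n.
  Inexact proximal steps are handled by Young's inequality with weight s/4. This causes the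
  denominator 1 - s/4 and multiplies the gap of the subproblem by 4/s, yet the rate 1 - s/2
  survives: (1 - s/4)(1 - s/2) exceeds 1 - s + (s/4)(1 - s/2) by s^2/4. All stages use the same
  number of inner iterations, since each needs only a fixed reduction factor R that outweighs the
  drift of the subproblem's saddle point between stages. The drift carries the factor 1 - q and
  vanishes for beta = 0.\<close>

lemma expectation_bind_finite:
  fixes f :: "'b \<Rightarrow> real"
  assumes "finite (set_pmf p)" "\<And>x. x \<in> set_pmf p \<Longrightarrow> finite (set_pmf (h x))"
  shows "measure_pmf.expectation (p \<bind> h) f =
    measure_pmf.expectation p (\<lambda>x. measure_pmf.expectation (h x) f)"
proof -
  have "measure_pmf.expectation (p \<bind> h) f =
      (\<Sum>a\<in>set_pmf p. pmf p a *\<^sub>R measure_pmf.expectation (h a) f)"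
    by (rule pmf_expectation_bind) (use assms in auto)
  also have "\<dots> = measure_pmf.expectation p (\<lambda>x. measure_pmf.expectation (h x) f)"
    by (rule integral_measure_pmf[symmetric]) (use assms in auto)
  finally show ?thesis .
qed

lemma expectation_mono_finite:
  fixes f g :: "'b \<Rightarrow> real"
  assumes "finite (set_pmf p)" "\<And>x. x \<in> set_pmf p \<Longrightarrow> f x \<le> g x"
  shows "measure_pmf.expectation p f \<le> measure_pmf.expectation p g"
  by (intro integral_mono_AE integrable_measure_pmf_finite assms)
     (use assms in \<open>simp add: AE_measure_pmf_iff\<close>)

lemma expectation_add_finite:
  fixes f g :: "'b \<Rightarrow> real"
  assumes "finite (set_pmf p)"
  shows "measure_pmf.expectation p (\<lambda>x. f x + g x) =
    measure_pmf.expectation p f + measure_pmf.expectation p g"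
  by (intro Bochner_Integration.integral_add integrable_measure_pmf_finite assms)

lemma avg_mono:
  fixes a b :: "nat \<Rightarrow> real"
  assumes "\<And>i. i \<in> {1..n} \<Longrightarrow> a i \<le> b i"
  shows "avg n a \<le> avg n b"
  unfolding avg_def by (auto intro!: mult_left_mono sum_mono assms divide_right_mono)

lemma avg_add: "avg n (\<lambda>i. a i + b i) = avg n a + avg n b"
  by (simp add: avg_def sum.distrib scaleR_right_distrib)

lemma avg_diff: "avg n (\<lambda>i. a i - b i) = avg n a - avg n b"
  by (simp add: avg_def sum_subtractf scaleR_right_diff_distrib)

lemma avg_scaleR: "avg n (\<lambda>i. c *\<^sub>R a i) = c *\<^sub>R avg n a"
  by (simp add: avg_def scaleR_sum_right[symmetric] mult.commute)

lemma avg_mult: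
  fixes a :: "nat \<Rightarrow> real" shows "avg n (\<lambda>i. c * a i) = c * avg n a"
  using avg_scaleR[of n c a] by simp

lemma avg_const: "n \<ge> 1 \<Longrightarrow> avg n (\<lambda>i. c) = c"
  by (simp add: avg_def sum_constant_scaleR)

lemma avg_inner: "avg n a \<bullet> c = avg n (\<lambda>i. a i \<bullet> c)"
  by (simp add: avg_def inner_sum_left)

text \<open>Nonnegativity of the variance of \<open>a\<close> around its mean.\<close>

lemma norm_avg_sq_le:
  fixes a :: "nat \<Rightarrow> 'a::real_inner"
  assumes "n \<ge> 1"
  shows "(norm (avg n a))\<^sup>2 \<le> avg n (\<lambda>i. (norm (a i))\<^sup>2)"
proof -
  let ?c = "avg n a"
  have "0 \<le> avg n (\<lambda>i. (norm (a i - ?c))\<^sup>2)"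
    using avg_mono[of n "\<lambda>i. 0" "\<lambda>i. (norm (a i - ?c))\<^sup>2"] avg_const[OF assms, of "0::real"] by simp
  also have "avg n (\<lambda>i. (norm (a i - ?c))\<^sup>2) =
      avg n (\<lambda>i. (norm (a i))\<^sup>2 - 2 * (a i \<bullet> ?c) + (norm ?c)\<^sup>2)"
    by (intro arg_cong[of _ _ "avg n"] ext)
       (simp add: power2_norm_eq_inner inner_diff inner_commute algebra_simps)
  also have "\<dots> = avg n (\<lambda>i. (norm (a i))\<^sup>2) - 2 * (?c \<bullet> ?c) + (norm ?c)\<^sup>2"
    by (simp add: avg_add avg_diff avg_mult avg_const[OF assms] avg_inner)
  finally show ?thesis by (simp add: power2_norm_eq_inner)
qed

text \<open>Minkowski's inequality for the root mean square. It yields the smoothness constant L +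
  beta once the proximal term is added to every component.\<close>

lemma sqrt_avg_sq_triangle:
  fixes a :: "nat \<Rightarrow> 'a::real_inner"
  assumes n: "n \<ge> 1" and A: "A \<ge> 0" "avg n (\<lambda>i. (norm (a i))\<^sup>2) \<le> A\<^sup>2"
    and B: "B \<ge> 0" "norm b \<le> B"
  shows "avg n (\<lambda>i. (norm (a i + b))\<^sup>2) \<le> (A + B)\<^sup>2"
proof -
  have nb: "norm (avg n a) \<le> A"
    by (rule power2_le_imp_le[OF order_trans[OF norm_avg_sq_le[OF n] A(2)] A(1)])
  have "avg n (\<lambda>i. (norm (a i + b))\<^sup>2) = avg n (\<lambda>i. (norm (a i))\<^sup>2 + 2 * (a i \<bullet> b) + (norm b)\<^sup>2)"
    by (intro arg_cong[of _ _ "avg n"] ext)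
       (simp add: power2_norm_eq_inner inner_add inner_commute algebra_simps)
  also have "\<dots> = avg n (\<lambda>i. (norm (a i))\<^sup>2) + 2 * (avg n a \<bullet> b) + (norm b)\<^sup>2"
    by (simp add: avg_add avg_mult avg_const[OF n] avg_inner)
  also have "\<dots> \<le> A\<^sup>2 + 2 * (A * B) + B\<^sup>2"
  proof -
    have "avg n a \<bullet> b \<le> norm (avg n a) * norm b" by (rule norm_cauchy_schwarz)
    also have "\<dots> \<le> A * B" by (intro mult_mono nb B A) auto
    finally show ?thesis using A B by (intro add_mono) (auto intro: power_mono)
  qed
  finally show ?thesis by (simp add: power2_sum)
qed

section \<open>Projections and variational inequalities\<close>

lemma closest_point_Times:
  fixes X :: "'a::euclidean_space set" and Y :: "'b::euclidean_space set"
  assumes "closed X" "convex X" "X \<noteq> {}" "closed Y" "convex Y" "Y \<noteq> {}"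
  shows "closest_point (X \<times> Y) (a, b) = (closest_point X a, closest_point Y b)"
proof (rule closest_point_unique[symmetric])
  show "(closest_point X a, closest_point Y b) \<in> X \<times> Y"
    using assms by (simp add: closest_point_in_set)
  show "\<forall>z\<in>X \<times> Y. dist (a, b) (closest_point X a, closest_point Y b) \<le> dist (a, b) z"
    using assms by (auto simp: dist_Pair_Pair intro!: add_mono power_mono closest_point_le)
qed (use assms in \<open>auto simp: convex_Times closed_Times\<close>)

text \<open>Presents a saddle point as a fixed point of the projected step, so that nonexpansiveness
  of the projection can be applied to it.\<close>

lemma VI_closest_point:
  fixes Z :: "'z::euclidean_space set"
  assumes "closed Z" "convex Z" "z \<in> Z" "\<And>z'. z' \<in> Z \<Longrightarrow> g \<bullet> (z' - z) \<ge> 0" "\<tau> \<ge> 0"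
  shows "closest_point Z (z - \<tau> *\<^sub>R g) = z"
proof (rule closest_point_unique[symmetric])
  show "\<forall>z'\<in>Z. dist (z - \<tau> *\<^sub>R g) z \<le> dist (z - \<tau> *\<^sub>R g) z'"
  proof
    fix z' assume "z' \<in> Z"
    have "(norm (z - \<tau> *\<^sub>R g - z'))\<^sup>2 =
        (norm (\<tau> *\<^sub>R g))\<^sup>2 + 2 * \<tau> * (g \<bullet> (z' - z)) + (norm (z' - z))\<^sup>2"
      unfolding power2_norm_eq_inner by (simp add: inner_diff inner_commute algebra_simps)
    also have "\<dots> \<ge> (norm (\<tau> *\<^sub>R g))\<^sup>2" using assms(4)[OF \<open>z' \<in> Z\<close>] assms(5) by simp
    finally have "norm (\<tau> *\<^sub>R g) \<le> norm (z - \<tau> *\<^sub>R g - z')"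
      by (rule power2_le_imp_le) simp
    then show "dist (z - \<tau> *\<^sub>R g) z \<le> dist (z - \<tau> *\<^sub>R g) z'"
      by (simp add: dist_norm)
  qed
qed (use assms in auto)

text \<open>For a short step the projected step \<open>P\<close> is a contraction, so Banach's
  theorem applies; completeness of the closed set takes the place of compactness.\<close>

lemma strongly_monotone_VI_exists:
  fixes Z :: "'z::euclidean_space set" and G :: "'z \<Rightarrow> 'z"
  assumes Z: "closed Z" "convex Z" "Z \<noteq> {}" and m: "m > 0" and l: "l > 0"
    and mono: "\<And>z z'. z \<in> Z \<Longrightarrow> z' \<in> Z \<Longrightarrow> (G z - G z') \<bullet> (z - z') \<ge> m * (norm (z - z'))\<^sup>2"
    and lip: "\<And>z z'. z \<in> Z \<Longrightarrow> z' \<in> Z \<Longrightarrow> norm (G z - G z') \<le> l * norm (z - z')"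
  obtains z where "z \<in> Z" "\<And>z'. z' \<in> Z \<Longrightarrow> G z \<bullet> (z' - z) \<ge> 0"
proof -
  \<comment> \<open>This gives \<open>t * l\<^sup>2 \<le> m\<close>, so in 1 - 2 t m + t^2 l^2 one
    of the two copies of t m pays for the last term and 1 - t m remains.\<close>
  define t where "t = m / (l\<^sup>2 + m\<^sup>2)"
  define c where "c = sqrt (max 0 (1 - t * m))"
  have den: "l\<^sup>2 + m\<^sup>2 > 0" using l by (simp add: add_pos_nonneg)
  have t: "t > 0" unfolding t_def using m den by simp
  have tm: "t * l\<^sup>2 \<le> m"
    using m den l by (simp add: t_def field_simps)
  have c: "0 \<le> c" "c < 1" using m t by (auto simp: c_def max_def)
  define P where "P z = closest_point Z (z - t *\<^sub>R G z)" for z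
  have contr: "dist (P z) (P z') \<le> c * dist z z'" if "z \<in> Z" "z' \<in> Z" for z z'
  proof -
    have "dist (P z) (P z') \<le> dist (z - t *\<^sub>R G z) (z' - t *\<^sub>R G z')"
      unfolding P_def by (rule closest_point_lipschitz[OF Z(2,1,3)])
    also have "\<dots> = norm ((z - z') - t *\<^sub>R (G z - G z'))"
      by (simp add: dist_norm algebra_simps)
    also have "\<dots> \<le> c * dist z z'"
    proof (rule power2_le_imp_le)
      have "(norm ((z - z') - t *\<^sub>R (G z - G z')))\<^sup>2 =
          (norm (z - z'))\<^sup>2 - 2 * t * ((G z - G z') \<bullet> (z - z')) + t\<^sup>2 * (norm (G z - G z'))\<^sup>2"
        unfolding power2_norm_eq_inner
        by (simp add: inner_diff inner_commute algebra_simps power2_eq_square)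
      also have "\<dots> \<le> (norm (z - z'))\<^sup>2 - 2 * t * (m * (norm (z - z'))\<^sup>2) + t\<^sup>2 * (l * norm (z - z'))\<^sup>2"
        using mono[OF that] lip[OF that] t
        by (intro add_mono diff_mono mult_left_mono power_mono order_refl) auto
      also have "\<dots> = (1 - 2 * t * m + t * (t * l\<^sup>2)) * (norm (z - z'))\<^sup>2"
        by (simp add: power2_eq_square algebra_simps)
      also have "\<dots> \<le> max 0 (1 - t * m) * (norm (z - z'))\<^sup>2"
      proof (rule mult_right_mono)
        have "t * (t * l\<^sup>2) \<le> t * m" using tm t by (intro mult_left_mono) auto
        then show "1 - 2 * t * m + t * (t * l\<^sup>2) \<le> max 0 (1 - t * m)" by (auto simp: max_def algebra_simps)
      qed simp
      also have "\<dots> = (c * dist z z')\<^sup>2" by (simp add: c_def power_mult_distrib dist_norm)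
      finally show "(norm ((z - z') - t *\<^sub>R (G z - G z')))\<^sup>2 \<le> (c * dist z z')\<^sup>2" .
    qed (use c in auto)
    finally show ?thesis .
  qed
  have "\<exists>!z\<in>Z. P z = z"
  proof (rule Banach_fix)
    show "P ` Z \<subseteq> Z" using Z closest_point_in_set by (auto simp: P_def)
  qed (use Z c contr in \<open>auto simp: complete_eq_closed\<close>)
  then obtain z where z: "z \<in> Z" "P z = z" by auto
  have "G z \<bullet> (z' - z) \<ge> 0" if "z' \<in> Z" for z'
  proof -
    have "(z - t *\<^sub>R G z - P z) \<bullet> (z' - P z) \<le> 0"
      unfolding P_def by (rule closest_point_dot[OF Z(2,1) that])
    then show ?thesis using t by (simp add: z zero_le_mult_iff)
  qed
  with z that show ?thesis by blast
qed

text \<open>Strong convexity along the segment, divided by \<open>t\<close>, bounds the difference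
  quotient, whose limit as \<open>t\<close> decreases to 0 is the directional derivative. The
  derivative within \<open>S\<close> suffices, so \<open>S\<close> may have empty interior.\<close>

lemma gradient_strongly_convex:
  fixes f :: "'a::real_inner \<Rightarrow> real"
  assumes "strongly_convex_on \<mu> S f" "x \<in> S" "y \<in> S"
    and der: "(f has_derivative (\<lambda>h. g \<bullet> h)) (at x within S)"
  shows "f y \<ge> f x + g \<bullet> (y - x) + \<mu> / 2 * (norm (y - x))\<^sup>2"
proof -
  let ?c = "\<lambda>t. x + t *\<^sub>R (y - x)"
  have cv: "convex S" using assms by (simp add: strongly_convex_on_def)
  have seg: "?c t \<in> S" if "t \<in> {0..1}" for t
    using convexD_alt[OF cv assms(2,3), of t] that by (simp add: algebra_simps)
  have "((\<lambda>t. f (?c t)) has_derivative (\<lambda>t. g \<bullet> (t *\<^sub>R (y - x)))) (at 0 within {0..1})"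
  proof (rule has_derivative_in_compose[of ?c])
    show "(?c has_derivative (\<lambda>t. t *\<^sub>R (y - x))) (at 0 within {0..1})"
      by (auto intro!: derivative_eq_intros)
    show "(f has_derivative (\<bullet>) g) (at (x + 0 *\<^sub>R (y - x)) within ?c ` {0..1})"
      using der seg by (auto intro: has_derivative_subset)
  qed
  then have "((\<lambda>t. f (?c t)) has_real_derivative g \<bullet> (y - x)) (at 0 within {0..1})"
    by (simp add: has_field_derivative_def mult_commute_abs)
  then have "((\<lambda>t. f (?c t)) has_real_derivative g \<bullet> (y - x)) (at 0 within {0<..<1})"
    by (rule DERIV_subset) auto
  then have lim: "((\<lambda>t. (f (?c t) - f x) / t) \<longlongrightarrow> g \<bullet> (y - x)) (at 0 within {0<..<1})"
    by (simp add: has_field_derivative_iff)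
  have lim2: "((\<lambda>t. f y - f x - \<mu> / 2 * (1 - t) * (norm (y - x))\<^sup>2) \<longlongrightarrow>
      f y - f x - \<mu> / 2 * (1 - 0) * (norm (y - x))\<^sup>2) (at 0 within {0<..<1})"
    by (intro tendsto_intros)
  have ev: "\<forall>\<^sub>F t in at 0 within {0<..<1}.
      (f (?c t) - f x) / t \<le> f y - f x - \<mu> / 2 * (1 - t) * (norm (y - x))\<^sup>2"
    unfolding eventually_at_filter
  proof (intro always_eventually allI impI)
    fix t :: real assume "t \<in> {0<..<1}"
    then have t: "0 < t" "t < 1" by auto
    have "f ((1 - t) *\<^sub>R x + t *\<^sub>R y) \<le>
        (1 - t) * f x + t * f y - \<mu> / 2 * (1 - t) * t * (norm (x - y))\<^sup>2"
      using assms(1-3) t unfolding strongly_convex_on_def by auto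
    moreover have "(1 - t) *\<^sub>R x + t *\<^sub>R y = ?c t" by (simp add: algebra_simps)
    ultimately have "f (?c t) - f x \<le> t * (f y - f x - \<mu> / 2 * (1 - t) * (norm (y - x))\<^sup>2)"
      by (simp add: algebra_simps norm_minus_commute)
    then show "(f (?c t) - f x) / t \<le> f y - f x - \<mu> / 2 * (1 - t) * (norm (y - x))\<^sup>2"
      using t by (simp add: field_simps)
  qed
  have "at (0::real) within {0<..<1} \<noteq> bot" by (simp add: at_within_eq_bot_iff)
  from tendsto_le[OF this lim2 lim ev] show ?thesis by simp
qed

lemma fst_avg: "fst (avg n a) = avg n (\<lambda>i. fst (a i))"
  by (simp add: avg_def fst_sum)

lemma snd_avg: "snd (avg n a) = avg n (\<lambda>i. snd (a i))"
  by (simp add: avg_def snd_sum)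

lemma avg_minus: "avg n (\<lambda>i. - a i) = - avg n a"
  by (simp add: avg_def sum_negf)

lemma saddle_field_avg:
  fixes h :: "nat \<Rightarrow> 'z \<Rightarrow> 'a::real_vector \<times> 'b::real_vector"
  shows "saddle_field (\<lambda>v. avg n (\<lambda>i. h i v)) v = avg n (\<lambda>i. saddle_field (h i) v)"
  by (rule prod_eqI) (simp_all add: saddle_field_def fst_avg snd_avg avg_minus)

text \<open>Flipping the sign of the second component is an isometry, so smoothness passes unchanged
  from gradients to saddle fields.\<close>

lemma norm_saddle_field_diff:
  fixes h :: "'z \<Rightarrow> 'a::real_normed_vector \<times> 'b::real_normed_vector"
  shows "norm (saddle_field h z - saddle_field h z') = norm (h z - h z')"
proof -
  have "norm (- snd (h z) + snd (h z')) = norm (snd (h z) - snd (h z'))"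
    by (metis minus_diff_eq norm_minus_cancel uminus_add_conv_diff)
  then show ?thesis by (simp add: saddle_field_def norm_prod_def)
qed

lemma norm_fst_snd_sq:
  fixes z :: "'a::real_normed_vector \<times> 'b::real_normed_vector"
  shows "(norm (fst z))\<^sup>2 + (norm (snd z))\<^sup>2 = (norm z)\<^sup>2"
  by (simp add: norm_prod_def)

lemma norm_fst_le': "norm (fst z) \<le> norm z"
  by (metis norm_fst_le prod.collapse)

lemma norm_snd_le': "norm (snd z) \<le> norm z"
  by (metis norm_snd_le prod.collapse)

text \<open>\<open>g0\<close> is the gradient used in the step from \<open>xt\<close> to
  \<open>xn\<close>, \<open>g1\<close> the one at the point where convexity is applied. Optimality
  of the projection controls the former; \<open>c\<close> pays for the discrepancy.\<close>

lemma projected_step_inner_le: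
  fixes xt xn xs g0 g1 :: "'a::real_inner"
  assumes "\<tau> > 0" "(xt - \<tau> *\<^sub>R g0 - xn) \<bullet> (xs - xn) \<le> 0" "norm (g1 - g0) \<le> c"
  shows "g1 \<bullet> (xn - xs) \<le> (1 / \<tau> * norm (xn - xt) + c) * norm (xn - xs)"
proof -
  have "\<tau> * (g0 \<bullet> (xn - xs)) \<le> (xn - xt) \<bullet> (xs - xn)"
    using assms(2) by (simp add: inner_diff algebra_simps)
  also have "\<dots> \<le> norm (xn - xt) * norm (xs - xn)" by (rule norm_cauchy_schwarz)
  finally have 1: "g0 \<bullet> (xn - xs) \<le> 1 / \<tau> * norm (xn - xt) * norm (xn - xs)"
    using assms(1) by (simp add: field_simps norm_minus_commute)
  have "(g1 - g0) \<bullet> (xn - xs) \<le> norm (g1 - g0) * norm (xn - xs)" by (rule norm_cauchy_schwarz)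
  also have "\<dots> \<le> c * norm (xn - xs)" using assms(3) by (intro mult_right_mono) auto
  finally show ?thesis using 1 by (simp add: inner_diff algebra_simps)
qed

lemma one_minus_power_le:
  fixes \<theta> R :: real
  assumes "0 \<le> \<theta>" "\<theta> \<le> 1" "R > 0" "\<theta> * T \<ge> ln R"
  shows "(1 - \<theta>) ^ T \<le> 1 / R"
proof -
  have "(1 - \<theta>) ^ T \<le> exp (- \<theta>) ^ T"
    using assms exp_ge_add_one_self[of "- \<theta>"] by (intro power_mono) auto
  also have "\<dots> = exp (- (\<theta> * T))" by (simp add: exp_of_nat_mult[symmetric] mult.commute)
  also have "\<dots> \<le> exp (- ln R)" using assms by simp
  also have "\<dots> = 1 / R" using assms by (simp add: exp_minus divide_inverse)
  finally show ?thesis .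
qed

lemma avg_prox_grad:
  "n \<ge> 1 \<Longrightarrow> avg n (\<lambda>i. prox_grad \<beta> u (h i) z) = avg n (\<lambda>i. h i z) + (\<beta> *\<^sub>R (fst z - u), 0)"
  by (simp add: prox_grad_def avg_add avg_const)

lemma norm_convex_le:
  fixes a b :: "'z::real_normed_vector"
  assumes "0 \<le> t" "t \<le> 1" "norm a \<le> r" "norm b \<le> r"
  shows "norm ((1 - t) *\<^sub>R a + t *\<^sub>R b) \<le> r"
proof -
  have "norm ((1 - t) *\<^sub>R a + t *\<^sub>R b) \<le> (1 - t) * norm a + t * norm b"
    using norm_triangle_ineq[of "(1 - t) *\<^sub>R a" "t *\<^sub>R b"] assms by simp
  also have "\<dots> \<le> (1 - t) * r + t * r" using assms by (intro add_mono mult_left_mono) auto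
  finally show ?thesis by (simp add: algebra_simps)
qed

lemma sum_power2_le: "((a::real) + b)\<^sup>2 \<le> 2 * (a\<^sup>2 + b\<^sup>2)"
  using sum_squares_bound[of a b] by (simp add: power2_sum)

text \<open>Young's inequality, read off from a completed square. It allows an inexact proximal
  point \<open>y\<close> to stand in for the exact one \<open>z\<close>.\<close>

lemma norm_diff_sq_weighted_ge:
  fixes x y z :: "'z::real_inner"
  assumes "0 < \<eta>"
  shows "(1 - \<eta>) * (norm (x - y))\<^sup>2 - (1 / \<eta> - 1) * (norm (y - z))\<^sup>2 \<le> (norm (x - z))\<^sup>2"
proof -
  have "0 \<le> (norm (\<eta> *\<^sub>R (x - y) + (y - z)))\<^sup>2 / \<eta>" using assms by simp
  also have "\<dots> = (norm (x - z))\<^sup>2 - (1 - \<eta>) * (norm (x - y))\<^sup>2 + (1 / \<eta> - 1) * (norm (y - z))\<^sup>2"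
    using assms unfolding power2_norm_eq_inner
    by (simp add: inner_diff inner_add inner_commute field_simps)
  finally show ?thesis by simp
qed

section \<open>The variance-reduced extragradient method\<close>

lemma svrg_extragradient_step:
  fixes Z :: "'z::euclidean_space set"
  assumes Z: "closed Z" "convex Z" and zs: "zs \<in> Z"
    and h: "h = closest_point Z ((1 - p) *\<^sub>R z + p *\<^sub>R w - \<tau> *\<^sub>R gw)"
    and zn: "zn = closest_point Z ((1 - p) *\<^sub>R z + p *\<^sub>R w - \<tau> *\<^sub>R (gw + a - b))"
  shows "(norm (zn - zs))\<^sup>2 \<le> (1 - p) * (norm (z - zs))\<^sup>2 + p * (norm (w - zs))\<^sup>2
    - (1 - p) * (norm (h - z))\<^sup>2 - p * (norm (h - w))\<^sup>2
    + 2 * \<tau> * ((gw + a - b) \<bullet> (zs - h)) + \<tau>\<^sup>2 * (norm (a - b))\<^sup>2"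
proof -
  let ?zb = "(1 - p) *\<^sub>R z + p *\<^sub>R w"
  have znZ: "zn \<in> Z" unfolding zn using Z zs by (intro closest_point_in_set) auto
  \<comment> \<open>The claim is the sum of the projection inequality at \<open>zn\<close> tested with \<open>zs\<close>, the one at \<open>h\<close> tested with \<open>zn\<close>, and Young's inequality.\<close>
  have 1: "(?zb - \<tau> *\<^sub>R (gw + a - b) - zn) \<bullet> (zs - zn) \<le> 0"
    unfolding zn by (rule closest_point_dot[OF Z(2,1) zs])
  have 2: "(?zb - \<tau> *\<^sub>R gw - h) \<bullet> (zn - h) \<le> 0"
    unfolding h by (rule closest_point_dot[OF Z(2,1) znZ])
  have 3: "0 \<le> (norm (h - zn - \<tau> *\<^sub>R (a - b)))\<^sup>2" by simp
  have "(1 - p) * (norm (z - zs))\<^sup>2 + p * (norm (w - zs))\<^sup>2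
    - (1 - p) * (norm (h - z))\<^sup>2 - p * (norm (h - w))\<^sup>2
    + 2 * \<tau> * ((gw + a - b) \<bullet> (zs - h)) + \<tau>\<^sup>2 * (norm (a - b))\<^sup>2 - (norm (zn - zs))\<^sup>2
    = - 2 * ((?zb - \<tau> *\<^sub>R (gw + a - b) - zn) \<bullet> (zs - zn))
      - 2 * ((?zb - \<tau> *\<^sub>R gw - h) \<bullet> (zn - h)) + (norm (h - zn - \<tau> *\<^sub>R (a - b)))\<^sup>2"
    unfolding power2_norm_eq_inner unfolding power2_eq_square
    by (simp add: inner_diff inner_add inner_commute algebra_simps)
  with 1 2 3 show ?thesis by linarith
qed

text \<open>1 / (1/a + 1/b) is the best constant when a squared distance is split at an intermediate
  point.\<close>

lemma norm_sum_sq_weighted: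
  fixes u v :: "'z::real_inner"
  assumes ab: "a > 0" "b > 0" and \<theta>: "\<theta> * (1 / a + 1 / b) \<le> 1"
  shows "\<theta> * (norm (u + v))\<^sup>2 \<le> a * (norm u)\<^sup>2 + b * (norm v)\<^sup>2"
proof -
  have "0 \<le> (norm (a *\<^sub>R u - b *\<^sub>R v))\<^sup>2 / (a * b)" using ab by simp
  also have "\<dots> = (1 / a + 1 / b) * (a * (norm u)\<^sup>2 + b * (norm v)\<^sup>2) - (norm (u + v))\<^sup>2"
    unfolding power2_norm_eq_inner using ab
    by (simp add: inner_diff inner_add inner_commute field_simps)
  finally have *: "(norm (u + v))\<^sup>2 \<le> (1 / a + 1 / b) * (a * (norm u)\<^sup>2 + b * (norm v)\<^sup>2)" by simp
  show ?thesis
  proof (cases "\<theta> \<le> 0")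
    case True
    then have "\<theta> * (norm (u + v))\<^sup>2 \<le> 0" by (simp add: mult_nonpos_nonneg)
    also have "\<dots> \<le> a * (norm u)\<^sup>2 + b * (norm v)\<^sup>2" using ab by simp
    finally show ?thesis .
  next
    case False
    then have "\<theta> * (norm (u + v))\<^sup>2 \<le> (\<theta> * (1 / a + 1 / b)) * (a * (norm u)\<^sup>2 + b * (norm v)\<^sup>2)"
      using mult_left_mono[OF *, of \<theta>] by (simp add: mult.assoc)
    also have "\<dots> \<le> 1 * (a * (norm u)\<^sup>2 + b * (norm v)\<^sup>2)"
      by (rule mult_right_mono[OF \<theta>]) (use ab in simp)
    finally show ?thesis by simp
  qed
qed

text \<open>Averaged over the index, the corrected direction is \<open>G h\<close>, so strong
  monotonicity applies at the half step; average smoothness bounds the mean square of the correction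
  by a multiple of |h - w|^2 that the term p |h - w|^2 absorbs. The left side is the expectation of
  (1 - p) |z - zs|^2 + |w - zs|^2 after the coin for \<open>w\<close> is tossed; with these weights
  the potential reproduces itself.\<close>

lemma svrg_extragradient_contraction:
  fixes Z :: "'z::euclidean_space set" and g :: "nat \<Rightarrow> 'z \<Rightarrow> 'z" and n :: nat
  defines "G \<equiv> \<lambda>v. avg n (\<lambda>i. g i v)"
  assumes Z: "closed Z" "convex Z" and zs: "zs \<in> Z" "\<And>v. v \<in> Z \<Longrightarrow> G zs \<bullet> (v - zs) \<ge> 0"
    and n: "n \<ge> 1" and wZ: "w \<in> Z"
    and mono: "\<And>v v'. v \<in> Z \<Longrightarrow> v' \<in> Z \<Longrightarrow> (G v - G v') \<bullet> (v - v') \<ge> m * (norm (v - v'))\<^sup>2"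
    and lip: "\<And>v v'. v \<in> Z \<Longrightarrow> v' \<in> Z \<Longrightarrow>
        avg n (\<lambda>i. (norm (g i v - g i v'))\<^sup>2) \<le> l\<^sup>2 * (norm (v - v'))\<^sup>2"
    and m: "m > 0" and \<tau>: "\<tau> > 0" and p: "0 < p" "p < 1"
    and lp: "\<tau>\<^sup>2 * l\<^sup>2 < p" and \<theta>: "0 \<le> \<theta>" "\<theta> * (1 / (\<tau> * m) + 1 / (p - \<tau>\<^sup>2 * l\<^sup>2)) \<le> 1"
      "\<theta> * (1 / (\<tau> * m) + 1 / (1 - p)) \<le> 1"
    and h: "h = closest_point Z ((1 - p) *\<^sub>R z + p *\<^sub>R w - \<tau> *\<^sub>R G w)"
    and zn: "\<And>i. zn i = closest_point Z ((1 - p) *\<^sub>R z + p *\<^sub>R w - \<tau> *\<^sub>R (G w + g i h - g i w))"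
  shows "avg n (\<lambda>i. (norm (zn i - zs))\<^sup>2) + (1 - p) * (norm (w - zs))\<^sup>2
    \<le> (1 - \<theta>) * ((1 - p) * (norm (z - zs))\<^sup>2 + (norm (w - zs))\<^sup>2)"
proof -
  have hZ: "h \<in> Z" unfolding h using Z wZ by (intro closest_point_in_set) auto
  have "avg n (\<lambda>i. (norm (zn i - zs))\<^sup>2) \<le> avg n (\<lambda>i. ((1 - p) * (norm (z - zs))\<^sup>2 + p * (norm (w - zs))\<^sup>2
    - (1 - p) * (norm (h - z))\<^sup>2 - p * (norm (h - w))\<^sup>2)
    + 2 * \<tau> * ((G w + g i h - g i w) \<bullet> (zs - h)) + \<tau>\<^sup>2 * (norm (g i h - g i w))\<^sup>2)"
    by (rule avg_mono, rule svrg_extragradient_step[OF Z zs(1) h zn])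
  also have "\<dots> = ((1 - p) * (norm (z - zs))\<^sup>2 + p * (norm (w - zs))\<^sup>2
    - (1 - p) * (norm (h - z))\<^sup>2 - p * (norm (h - w))\<^sup>2)
    + 2 * \<tau> * (G h \<bullet> (zs - h)) + \<tau>\<^sup>2 * avg n (\<lambda>i. (norm (g i h - g i w))\<^sup>2)"
    unfolding avg_add avg_mult avg_const[OF n] avg_inner[symmetric] avg_diff
    by (simp add: G_def)
  also have "\<dots> \<le> ((1 - p) * (norm (z - zs))\<^sup>2 + p * (norm (w - zs))\<^sup>2
    - (1 - p) * (norm (h - z))\<^sup>2 - p * (norm (h - w))\<^sup>2)
    + 2 * \<tau> * (- m * (norm (h - zs))\<^sup>2) + \<tau>\<^sup>2 * (l\<^sup>2 * (norm (h - w))\<^sup>2)"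
  proof (intro add_mono mult_left_mono order_refl lip hZ wZ)
    show "G h \<bullet> (zs - h) \<le> - m * (norm (h - zs))\<^sup>2"
      using mono[OF hZ zs(1)] zs(2)[OF hZ] by (simp add: inner_diff algebra_simps)
  qed (use \<tau> in auto)
  finally have A: "avg n (\<lambda>i. (norm (zn i - zs))\<^sup>2) \<le> (1 - p) * (norm (z - zs))\<^sup>2 + p * (norm (w - zs))\<^sup>2
    - (1 - p) * (norm (z - h))\<^sup>2 - (p - \<tau>\<^sup>2 * l\<^sup>2) * (norm (w - h))\<^sup>2 - 2 * (\<tau> * m * (norm (h - zs))\<^sup>2)"
    by (simp add: algebra_simps norm_minus_commute)
  \<comment> \<open>The gain 2 tau m |h - zs|^2 is spent in two halves: one joins the term in w - h
    to shrink |w - zs|^2, the other joins the term in z - h to shrink |z - zs|^2.\<close>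
  have B: "\<theta> * (norm ((h - zs) + (w - h)))\<^sup>2 \<le> \<tau> * m * (norm (h - zs))\<^sup>2 + (p - \<tau>\<^sup>2 * l\<^sup>2) * (norm (w - h))\<^sup>2"
    by (rule norm_sum_sq_weighted) (use \<tau> m lp \<theta> in auto)
  have "\<theta> * ((1 - p) * (norm ((h - zs) + (z - h)))\<^sup>2) \<le> \<theta> * (norm ((h - zs) + (z - h)))\<^sup>2"
    using p \<theta> by (intro mult_left_mono) (auto simp: mult_left_le_one_le)
  also have "\<dots> \<le> \<tau> * m * (norm (h - zs))\<^sup>2 + (1 - p) * (norm (z - h))\<^sup>2"
    by (rule norm_sum_sq_weighted) (use \<tau> m p \<theta> in auto)
  finally have C: "\<theta> * ((1 - p) * (norm (z - zs))\<^sup>2)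
      \<le> \<tau> * m * (norm (h - zs))\<^sup>2 + (1 - p) * (norm (z - h))\<^sup>2" by simp
  from B have B': "\<theta> * (norm (w - zs))\<^sup>2
      \<le> \<tau> * m * (norm (h - zs))\<^sup>2 + (p - \<tau>\<^sup>2 * l\<^sup>2) * (norm (w - h))\<^sup>2" by simp
  have "avg n (\<lambda>i. (norm (zn i - zs))\<^sup>2) + ((norm (w - zs))\<^sup>2 - p * (norm (w - zs))\<^sup>2)
    \<le> (1 - p) * (norm (z - zs))\<^sup>2 + (norm (w - zs))\<^sup>2
     - \<theta> * ((1 - p) * (norm (z - zs))\<^sup>2) - \<theta> * (norm (w - zs))\<^sup>2"
    using A B' C by linarith
  then show ?thesis by (simp add: algebra_simps)
qed

section \<open>Support, expectation and cost of a run of L-SVRE\<close>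

lemma finite_set_lsvre_step:
  assumes "n \<ge> 1" shows "finite (set_pmf (lsvre_step n h' Z \<tau> p s))"
  using assms by (cases s) (auto simp: lsvre_step_def Let_def)

lemma finite_set_lsvre_run:
  assumes "n \<ge> 1" shows "finite (set_pmf (lsvre_run n h' Z z0 \<tau> p k))"
  by (induction k) (simp_all add: finite_set_lsvre_step[OF assms])

text \<open>Resolves the two independent draws, index and coin, into an explicit average, which
  serves both the contraction and the cost.\<close>

lemma expectation_lsvre_step:
  fixes F :: "('a::euclidean_space \<times> 'b::euclidean_space) \<times> ('a \<times> 'b) \<times> nat \<Rightarrow> real"
    and h' :: "nat \<Rightarrow> 'a \<times> 'b \<Rightarrow> 'a \<times> 'b" and Z and \<tau> p :: real and n :: nat
  assumes n: "n \<ge> 1" and p: "0 \<le> p" "p \<le> 1"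
  defines "G \<equiv> saddle_field (\<lambda>v. avg n (\<lambda>i. h' i v))"
  defines "H z w \<equiv> closest_point Z ((1 - p) *\<^sub>R z + p *\<^sub>R w - \<tau> *\<^sub>R G w)"
  defines "N z w i \<equiv> closest_point Z ((1 - p) *\<^sub>R z + p *\<^sub>R w
      - \<tau> *\<^sub>R (G w + saddle_field (h' i) (H z w) - saddle_field (h' i) w))"
  shows "measure_pmf.expectation (lsvre_step n h' Z \<tau> p (z, w, c)) F =
    avg n (\<lambda>i. p * F (N z w i, N z w i, c + 2 + n) + (1 - p) * F (N z w i, w, c + 2))"
proof -
  have "measure_pmf.expectation (lsvre_step n h' Z \<tau> p (z, w, c)) F =
    (\<Sum>i\<in>{1..n}. (p * F (N z w i, N z w i, c + 2 + n) + (1 - p) * F (N z w i, w, c + 2)) /\<^sub>R real (card {1..n}))"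
    unfolding lsvre_step_def Let_def prod.case
    apply (subst pmf_expectation_bind_pmf_of_set)
    using n p
       apply (auto intro!: sum.cong simp: expectation_bind_finite N_def H_def G_def algebra_simps)
    done
  also have "\<dots> = avg n (\<lambda>i. p * F (N z w i, N z w i, c + 2 + n) + (1 - p) * F (N z w i, w, c + 2))"
    by (simp add: avg_def sum_distrib_left sum_divide_distrib divide_inverse mult.commute)
  finally show ?thesis .
qed

lemma lsvre_run_in:
  fixes z0 :: "'a::euclidean_space \<times> 'b::euclidean_space"
  assumes Z: "closed Z" "z0 \<in> Z" and s: "(z, w, c) \<in> set_pmf (lsvre_run n h' Z z0 \<tau> p k)"
  shows "z \<in> Z \<and> w \<in> Z"
  using s
proof (induction k arbitrary: z w c)
  case (Suc k)
  have "closest_point Z a \<in> Z" for a using Z by (intro closest_point_in_set) auto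
  note cp = this
  from Suc.prems obtain z1 w1 c1 where *: "(z1, w1, c1) \<in> set_pmf (lsvre_run n h' Z z0 \<tau> p k)"
    "(z, w, c) \<in> set_pmf (lsvre_step n h' Z \<tau> p (z1, w1, c1))"
    by auto
  from Suc.IH[OF *(1)] *(2) show ?case
    by (auto simp: lsvre_step_def Let_def cp split: if_splits)
qed (use Z in auto)

lemma lsvre_in:
  fixes z0 :: "'a::euclidean_space \<times> 'b::euclidean_space"
  assumes "closed Z" "z0 \<in> Z" "(z, c) \<in> set_pmf (lsvre n h' Z z0 \<tau> p k)"
  shows "z \<in> Z"
  using assms lsvre_run_in[OF assms(1,2)] by (auto simp: lsvre_def)

lemma finite_set_lsvre:
  assumes "n \<ge> 1" shows "finite (set_pmf (lsvre n h' Z z0 \<tau> p k))"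
  unfolding lsvre_def set_map_pmf by (intro finite_imageI finite_set_lsvre_run assms)

text \<open>An equality, since the cost of an iteration depends on the coin and not on the iterates.
  The leading \<open>n\<close> is the initial full gradient.\<close>

lemma expectation_lsvre_cost:
  fixes z0 :: "'a::euclidean_space \<times> 'b::euclidean_space"
  assumes n: "n \<ge> 1" and p: "0 \<le> p" "p \<le> 1"
  shows "measure_pmf.expectation (lsvre n h' Z z0 \<tau> p T) (\<lambda>(z, c). real c) = n + T * (2 + p * n)"
proof -
  have "measure_pmf.expectation (lsvre_run n h' Z z0 \<tau> p T) (\<lambda>(z, w, c). real c) = n + T * (2 + p * n)"
  proof (induction T)
    case (Suc T)
    have "measure_pmf.expectation (lsvre_run n h' Z z0 \<tau> p (Suc T)) (\<lambda>(z, w, c). real c) =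
       measure_pmf.expectation (lsvre_run n h' Z z0 \<tau> p T)
         (\<lambda>s. measure_pmf.expectation (lsvre_step n h' Z \<tau> p s) (\<lambda>(z, w, c). real c))"
      unfolding lsvre_run.simps
      by (rule expectation_bind_finite[OF finite_set_lsvre_run[OF n] finite_set_lsvre_step[OF n]])
    also have "(\<lambda>s. measure_pmf.expectation (lsvre_step n h' Z \<tau> p s) (\<lambda>(z, w, c). real c)) =
        (\<lambda>s. (case s of (z, w, c) \<Rightarrow> real c) + (2 + p * n))"
    proof (rule ext, safe)
      fix z w :: "'a \<times> 'b" and c
      show "measure_pmf.expectation (lsvre_step n h' Z \<tau> p (z, w, c)) (\<lambda>(z, w, c). real c) = real c + (2 + p * n)"
        by (subst expectation_lsvre_step[OF n p]) (simp add: avg_const[OF n] algebra_simps)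
    qed
    also have "measure_pmf.expectation (lsvre_run n h' Z z0 \<tau> p T) \<dots> =
        measure_pmf.expectation (lsvre_run n h' Z z0 \<tau> p T) (\<lambda>(z, w, c). real c) + (2 + p * n)"
      by (subst expectation_add_finite[OF finite_set_lsvre_run[OF n]]) simp
    finally show ?case by (simp add: Suc algebra_simps)
  qed simp
  then show ?thesis by (simp add: lsvre_def case_prod_unfold)
qed

section \<open>Strongly convex-concave saddle problems\<close>

text \<open>Convexity enters through first-order inequalities for the averaged gradient. They
  survive the addition of a proximal term, so the locale serves \<open>f\<close> and every
  subproblem alike.\<close>

locale saddle_problem =
  fixes X :: "'a::euclidean_space set" and Y :: "'b::euclidean_space set" and n :: nat
    and fi' :: "nat \<Rightarrow> 'a \<times> 'b \<Rightarrow> 'a \<times> 'b" and f :: "'a \<times> 'b \<Rightarrow> real" and \<mu>x \<mu>y L :: real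
  assumes X: "closed X" "convex X" "X \<noteq> {}" and Y: "closed Y" "convex Y" "Y \<noteq> {}"
    and n: "n \<ge> 1" and L: "L > 0" and \<mu>: "\<mu>x > 0" "\<mu>y > 0"
    and smooth: "average_smooth n fi' (X \<times> Y) L"
    and below_x: "\<And>x x' y. x \<in> X \<Longrightarrow> x' \<in> X \<Longrightarrow> y \<in> Y \<Longrightarrow>
      f (x', y) \<ge> f (x, y) + fst (avg n (\<lambda>i. fi' i (x, y))) \<bullet> (x' - x) + \<mu>x / 2 * (norm (x' - x))\<^sup>2"
    and above_y: "\<And>x y y'. x \<in> X \<Longrightarrow> y \<in> Y \<Longrightarrow> y' \<in> Y \<Longrightarrow>
      f (x, y') \<le> f (x, y) + snd (avg n (\<lambda>i. fi' i (x, y))) \<bullet> (y' - y) - \<mu>y / 2 * (norm (y' - y))\<^sup>2"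
begin

definition "grad z = avg n (\<lambda>i. fi' i z)"

definition "field = saddle_field grad"

lemma field_avg: "field z = avg n (\<lambda>i. saddle_field (fi' i) z)"
  unfolding field_def grad_def[abs_def] by (rule saddle_field_avg)

lemma Z: "closed (X \<times> Y)" "convex (X \<times> Y)" "X \<times> Y \<noteq> {}"
  using X Y by (auto simp: closed_Times convex_Times)

lemma smooth_le:
  assumes "z \<in> X \<times> Y" "z' \<in> X \<times> Y"
  shows "avg n (\<lambda>i. (norm (fi' i z - fi' i z'))\<^sup>2) \<le> L\<^sup>2 * (norm (z - z'))\<^sup>2"
  using smooth assms unfolding average_smooth_def by blast

lemma grad_lipschitz:
  assumes "z \<in> X \<times> Y" "z' \<in> X \<times> Y"
  shows "norm (grad z - grad z') \<le> L * norm (z - z')"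
proof (rule power2_le_imp_le)
  show "(norm (grad z - grad z'))\<^sup>2 \<le> (L * norm (z - z'))\<^sup>2"
    using order_trans[OF norm_avg_sq_le[OF n] smooth_le[OF assms]]
    by (simp add: grad_def avg_diff[symmetric] power_mult_distrib)
qed (use L in simp)

lemma grad_x_lipschitz:
  assumes "z \<in> X \<times> Y" "z' \<in> X \<times> Y"
  shows "norm (fst (grad z) - fst (grad z')) \<le> L * norm (z - z')"
  using norm_fst_le'[of "grad z - grad z'"] grad_lipschitz[OF assms] by simp

lemma grad_y_lipschitz:
  assumes "z \<in> X \<times> Y" "z' \<in> X \<times> Y"
  shows "norm (snd (grad z) - snd (grad z')) \<le> L * norm (z - z')"
  using norm_snd_le'[of "grad z - grad z'"] grad_lipschitz[OF assms] by simp

lemma field_lipschitz: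
  assumes "z \<in> X \<times> Y" "z' \<in> X \<times> Y"
  shows "norm (field z - field z') \<le> L * norm (z - z')"
  using grad_lipschitz[OF assms] by (simp add: field_def norm_saddle_field_diff)

lemma grad_x_mono:
  assumes "x \<in> X" "x' \<in> X" "y \<in> Y"
  shows "(fst (grad (x, y)) - fst (grad (x', y))) \<bullet> (x - x') \<ge> \<mu>x * (norm (x - x'))\<^sup>2"
  using below_x[of x x' y] below_x[of x' x y] assms
  by (simp add: grad_def inner_diff norm_minus_commute[of x'])

lemma grad_y_mono:
  assumes "x \<in> X" "y \<in> Y" "y' \<in> Y"
  shows "(snd (grad (x, y')) - snd (grad (x, y))) \<bullet> (y - y') \<ge> \<mu>y * (norm (y - y'))\<^sup>2"
  using above_y[of x y y'] above_y[of x y' y] assms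
  by (simp add: grad_def inner_diff norm_minus_commute[of y'])

text \<open>Four first-order inequalities, two in each variable, are added; the values of
  \<open>f\<close> at \<open>z\<close>, at \<open>z'\<close> and at the two mixed points all
  cancel.\<close>

lemma field_mono:
  assumes "z \<in> X \<times> Y" "z' \<in> X \<times> Y" "m \<le> \<mu>x" "m \<le> \<mu>y"
  shows "(field z - field z') \<bullet> (z - z') \<ge> m * (norm (z - z'))\<^sup>2"
proof -
  obtain x y x' y' where z: "z = (x, y)" "z' = (x', y')" by (cases z, cases z') auto
  then have xy: "x \<in> X" "y \<in> Y" "x' \<in> X" "y' \<in> Y" using assms by auto
  have "(field z - field z') \<bullet> (z - z') \<ge> \<mu>x * (norm (x - x'))\<^sup>2 + \<mu>y * (norm (y - y'))\<^sup>2"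
    using below_x[of x x' y] below_x[of x' x y'] above_y[of x y y'] above_y[of x' y' y] xy
    by (simp add: z field_def saddle_field_def grad_def inner_diff norm_minus_commute[of x']
        norm_minus_commute[of y'] algebra_simps)
  moreover have "m * (norm (z - z'))\<^sup>2 \<le> \<mu>x * (norm (x - x'))\<^sup>2 + \<mu>y * (norm (y - y'))\<^sup>2"
    unfolding norm_fst_snd_sq[of "z - z'", symmetric] using assms
    by (simp add: z distrib_left add_mono mult_right_mono)
  ultimately show ?thesis by linarith
qed

text \<open>Taken from the variational inequality, whose solvability follows from strong
  monotonicity; the minimax properties are derived afterwards.\<close>

definition "saddle = (SOME z. z \<in> X \<times> Y \<and> (\<forall>z'\<in>X \<times> Y. field z \<bullet> (z' - z) \<ge> 0))"

lemma saddle: "saddle \<in> X \<times> Y" "z \<in> X \<times> Y \<Longrightarrow> field saddle \<bullet> (z - saddle) \<ge> 0"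
proof -
  have "\<exists>z. z \<in> X \<times> Y \<and> (\<forall>z'\<in>X \<times> Y. field z \<bullet> (z' - z) \<ge> 0)"
  proof (rule strongly_monotone_VI_exists[of "X \<times> Y" "min \<mu>x \<mu>y" L field])
    show "min \<mu>x \<mu>y * (norm (z - z'))\<^sup>2 \<le> (field z - field z') \<bullet> (z - z')"
      if "z \<in> X \<times> Y" "z' \<in> X \<times> Y" for z z'
      using that by (intro field_mono) auto
    show "0 < min \<mu>x \<mu>y" using \<mu> by simp
  qed (use Z L field_lipschitz in blast)+
  from someI_ex[OF this]
  show "saddle \<in> X \<times> Y" "z \<in> X \<times> Y \<Longrightarrow> field saddle \<bullet> (z - saddle) \<ge> 0"
    unfolding saddle_def by blast+
qed

lemma saddle_components: "fst saddle \<in> X" "snd saddle \<in> Y"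
  using saddle(1) by auto

lemma saddle_x: "x \<in> X \<Longrightarrow> fst (grad saddle) \<bullet> (x - fst saddle) \<ge> 0"
  using saddle(2)[of "(x, snd saddle)"] saddle(1)
  by (cases saddle) (auto simp: field_def saddle_field_def)

lemma saddle_y: "y \<in> Y \<Longrightarrow> snd (grad saddle) \<bullet> (y - snd saddle) \<le> 0"
  using saddle(2)[of "(fst saddle, y)"] saddle(1)
  by (cases saddle) (auto simp: field_def saddle_field_def)

lemma saddle_min_x:
  assumes "x \<in> X"
  shows "f saddle + \<mu>x / 2 * (norm (x - fst saddle))\<^sup>2 \<le> f (x, snd saddle)"
  using below_x[of "fst saddle" x "snd saddle"] saddle_x[OF assms] assms saddle(1)
  by (auto simp: grad_def)

lemma saddle_max_y:
  assumes "y \<in> Y"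
  shows "f (fst saddle, y) + \<mu>y / 2 * (norm (y - snd saddle))\<^sup>2 \<le> f saddle"
  using above_y[of "fst saddle" "snd saddle" y] saddle_y[OF assms] assms saddle(1)
  by (auto simp: grad_def)

text \<open>Existence comes from the variational inequality of the negated partial gradient. The
  distance bound is Lipschitz continuity of the best response, as \<open>snd saddle\<close> responds
  to \<open>fst saddle\<close>: the two variational inequalities are tested with each other's
  solution.\<close>

lemma best_response_y:
  assumes x: "x \<in> X"
  obtains yh where "yh \<in> Y" "\<And>y. y \<in> Y \<Longrightarrow> f (x, y) \<le> f (x, yh)"
    "norm (yh - snd saddle) \<le> L / \<mu>y * norm (x - fst saddle)"
proof -
  have "\<exists>yh. yh \<in> Y \<and> (\<forall>y\<in>Y. (- snd (grad (x, yh))) \<bullet> (y - yh) \<ge> 0)"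
  proof (rule strongly_monotone_VI_exists[of Y \<mu>y L "\<lambda>y. - snd (grad (x, y))"])
    fix y y' assume y: "y \<in> Y" "y' \<in> Y"
    show "(- snd (grad (x, y)) - - snd (grad (x, y'))) \<bullet> (y - y') \<ge> \<mu>y * (norm (y - y'))\<^sup>2"
      using grad_y_mono[OF x y] by (simp add: algebra_simps)
    show "norm (- snd (grad (x, y)) - - snd (grad (x, y'))) \<le> L * norm (y - y')"
      using grad_y_lipschitz[of "(x, y')" "(x, y)"] x y by (simp add: norm_minus_commute)
  qed (use Y \<mu> L in auto)
  then obtain yh where yh: "yh \<in> Y" and vi: "\<And>y. y \<in> Y \<Longrightarrow> snd (grad (x, yh)) \<bullet> (y - yh) \<le> 0"
    by auto
  let ?ys = "snd saddle" and ?xs = "fst saddle"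
  have "f (x, y) \<le> f (x, yh)" if "y \<in> Y" for y
  proof -
    have "0 \<le> \<mu>y / 2 * (norm (y - yh))\<^sup>2" using \<mu> by simp
    then show ?thesis using above_y[OF x yh that] vi[OF that] unfolding grad_def by linarith
  qed
  moreover have "norm (yh - ?ys) \<le> L / \<mu>y * norm (x - ?xs)"
  proof -
    have "\<mu>y * (norm (yh - ?ys))\<^sup>2 \<le> (snd (grad (x, ?ys)) - snd (grad (x, yh))) \<bullet> (yh - ?ys)"
      using grad_y_mono[OF x yh saddle_components(2)] .
    also have "\<dots> \<le> (snd (grad (x, ?ys)) - snd (grad (?xs, ?ys))) \<bullet> (yh - ?ys)"
      using vi[OF saddle_components(2)] saddle_y[OF yh] by (simp add: inner_diff)
    also have "\<dots> \<le> norm (snd (grad (x, ?ys)) - snd (grad (?xs, ?ys))) * norm (yh - ?ys)"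
      by (rule norm_cauchy_schwarz)
    also have "\<dots> \<le> (L * norm (x - ?xs)) * norm (yh - ?ys)"
      using grad_y_lipschitz[of "(x, ?ys)" "(?xs, ?ys)"] x saddle_components
      by (intro mult_right_mono) (simp_all del: prod.collapse)
    finally have *: "(\<mu>y * norm (yh - ?ys)) * norm (yh - ?ys) \<le> (L * norm (x - ?xs)) * norm (yh - ?ys)"
      by (simp add: power2_eq_square mult.assoc)
    then show ?thesis
    proof (cases "yh = ?ys")
      case True
      then show ?thesis using \<mu> L by simp
    next
      case False
      with * have "\<mu>y * norm (yh - ?ys) \<le> L * norm (x - ?xs)"
        by (simp only: mult_le_cancel_right) simp
      then show ?thesis using \<mu> by (simp add: field_simps)
    qed
  qed
  ultimately show ?thesis using that yh by blast
qed

lemma best_response_x: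
  assumes y: "y \<in> Y"
  obtains xh where "xh \<in> X" "\<And>x. x \<in> X \<Longrightarrow> f (xh, y) \<le> f (x, y)"
    "norm (xh - fst saddle) \<le> L / \<mu>x * norm (y - snd saddle)"
proof -
  have "\<exists>xh. xh \<in> X \<and> (\<forall>x\<in>X. fst (grad (xh, y)) \<bullet> (x - xh) \<ge> 0)"
  proof (rule strongly_monotone_VI_exists[of X \<mu>x L "\<lambda>x. fst (grad (x, y))"])
    fix x x' assume x: "x \<in> X" "x' \<in> X"
    show "(fst (grad (x, y)) - fst (grad (x', y))) \<bullet> (x - x') \<ge> \<mu>x * (norm (x - x'))\<^sup>2"
      using grad_x_mono[OF x y] .
    show "norm (fst (grad (x, y)) - fst (grad (x', y))) \<le> L * norm (x - x')"
      using grad_x_lipschitz[of "(x, y)" "(x', y)"] x y by simp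
  qed (use X \<mu> L in auto)
  then obtain xh where xh: "xh \<in> X" and vi: "\<And>x. x \<in> X \<Longrightarrow> fst (grad (xh, y)) \<bullet> (x - xh) \<ge> 0"
    by auto
  let ?ys = "snd saddle" and ?xs = "fst saddle"
  have "f (xh, y) \<le> f (x, y)" if "x \<in> X" for x
  proof -
    have "0 \<le> \<mu>x / 2 * (norm (x - xh))\<^sup>2" using \<mu> by simp
    then show ?thesis using below_x[OF xh that y] vi[OF that] unfolding grad_def by linarith
  qed
  moreover have "norm (xh - ?xs) \<le> L / \<mu>x * norm (y - ?ys)"
  proof -
    have "\<mu>x * (norm (xh - ?xs))\<^sup>2 \<le> (fst (grad (xh, y)) - fst (grad (?xs, y))) \<bullet> (xh - ?xs)"
      using grad_x_mono[OF xh saddle_components(1) y] .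
    also have "\<dots> \<le> (fst (grad (?xs, ?ys)) - fst (grad (?xs, y))) \<bullet> (xh - ?xs)"
      using vi[OF saddle_components(1)] saddle_x[OF xh] by (simp add: inner_diff)
    also have "\<dots> \<le> norm (fst (grad (?xs, ?ys)) - fst (grad (?xs, y))) * norm (xh - ?xs)"
      by (rule norm_cauchy_schwarz)
    also have "\<dots> \<le> (L * norm (y - ?ys)) * norm (xh - ?xs)"
      using grad_x_lipschitz[of "(?xs, ?ys)" "(?xs, y)"] y saddle_components
      by (intro mult_right_mono) (simp_all add: norm_minus_commute del: prod.collapse)
    finally have *: "(\<mu>x * norm (xh - ?xs)) * norm (xh - ?xs) \<le> (L * norm (y - ?ys)) * norm (xh - ?xs)"
      by (simp add: power2_eq_square mult.assoc)
    then show ?thesis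
    proof (cases "xh = ?xs")
      case True
      then show ?thesis using \<mu> L by simp
    next
      case False
      with * have "\<mu>x * norm (xh - ?xs) \<le> L * norm (y - ?ys)"
        by (simp only: mult_le_cancel_right) simp
      then show ?thesis using \<mu> by (simp add: field_simps)
    qed
  qed
  ultimately show ?thesis using that xh by blast
qed

definition "primal x = (GREATEST v. v \<in> (\<lambda>y. f (x, y)) ` Y)"

definition "dual y = (LEAST v. v \<in> (\<lambda>x. f (x, y)) ` X)"

lemma duality_gap_eq: "duality_gap f X Y x y = primal x - dual y"
  by (simp add: duality_gap_def primal_def dual_def)

lemma primal_attained:
  assumes "x \<in> X" obtains y where "y \<in> Y" "primal x = f (x, y)"
    "norm (y - snd saddle) \<le> L / \<mu>y * norm (x - fst saddle)"
proof -
  obtain yh where yh: "yh \<in> Y" "\<And>y. y \<in> Y \<Longrightarrow> f (x, y) \<le> f (x, yh)"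
    "norm (yh - snd saddle) \<le> L / \<mu>y * norm (x - fst saddle)"
    using best_response_y[OF assms] by blast
  have "primal x = f (x, yh)" unfolding primal_def by (rule Greatest_equality) (use yh in auto)
  with yh that show ?thesis by blast
qed

lemma primal_upper:
  assumes "x \<in> X" "y \<in> Y" shows "f (x, y) \<le> primal x"
proof -
  obtain yh where yh: "yh \<in> Y" "\<And>y. y \<in> Y \<Longrightarrow> f (x, y) \<le> f (x, yh)"
    using best_response_y[OF assms(1)] by blast
  have "primal x = f (x, yh)" unfolding primal_def by (rule Greatest_equality) (use yh in auto)
  with yh assms show ?thesis by simp
qed

lemma dual_attained:
  assumes "y \<in> Y" obtains x where "x \<in> X" "dual y = f (x, y)"
    "norm (x - fst saddle) \<le> L / \<mu>x * norm (y - snd saddle)"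
proof -
  obtain xh where xh: "xh \<in> X" "\<And>x. x \<in> X \<Longrightarrow> f (xh, y) \<le> f (x, y)"
    "norm (xh - fst saddle) \<le> L / \<mu>x * norm (y - snd saddle)"
    using best_response_x[OF assms] by blast
  have "dual y = f (xh, y)" unfolding dual_def by (rule Least_equality) (use xh in auto)
  with xh that show ?thesis by blast
qed

lemma dual_lower:
  assumes "x \<in> X" "y \<in> Y" shows "dual y \<le> f (x, y)"
proof -
  obtain xh where xh: "xh \<in> X" "\<And>x. x \<in> X \<Longrightarrow> f (xh, y) \<le> f (x, y)"
    using best_response_x[OF assms(2)] by blast
  have "dual y = f (xh, y)" unfolding dual_def by (rule Least_equality) (use xh in auto)
  with xh assms show ?thesis by simp
qed

lemma primal_ge_saddle:
  assumes "x \<in> X" shows "f saddle + \<mu>x / 2 * (norm (x - fst saddle))\<^sup>2 \<le> primal x"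
  using saddle_min_x[OF assms] primal_upper[OF assms saddle_components(2)] by linarith

lemma dual_le_saddle:
  assumes "y \<in> Y" shows "dual y + \<mu>y / 2 * (norm (y - snd saddle))\<^sup>2 \<le> f saddle"
  using saddle_max_y[OF assms] dual_lower[OF saddle_components(1) assms] by linarith

lemma dist_saddle_le_gap:
  assumes "x \<in> X" "y \<in> Y" "m \<le> \<mu>x" "m \<le> \<mu>y"
  shows "m / 2 * (norm ((x, y) - saddle))\<^sup>2 \<le> primal x - dual y"
proof -
  have "m / 2 * (norm ((x, y) - saddle))\<^sup>2
      = m / 2 * (norm (x - fst saddle))\<^sup>2 + m / 2 * (norm (y - snd saddle))\<^sup>2"
    unfolding norm_fst_snd_sq[of "(x, y) - saddle", symmetric] by (simp add: distrib_left)
  also have "\<dots> \<le> \<mu>x / 2 * (norm (x - fst saddle))\<^sup>2 + \<mu>y / 2 * (norm (y - snd saddle))\<^sup>2"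
    using assms by (intro add_mono mult_right_mono) auto
  finally show ?thesis using primal_ge_saddle[OF assms(1)] dual_le_saddle[OF assms(2)] by linarith
qed

section \<open>The projected step and the convergence of L-SVRE\<close>

definition "proj_step \<tau> z = (closest_point X (fst z - \<tau> *\<^sub>R fst (grad z)),
  closest_point Y (snd z + \<tau> *\<^sub>R snd (grad z)))"

lemma proj_step_in: "proj_step \<tau> z \<in> X \<times> Y"
  using X Y by (auto simp: proj_step_def closest_point_in_set)

lemma proj_step_eq: "proj_step \<tau> z = closest_point (X \<times> Y) (z - \<tau> *\<^sub>R field z)"
proof -
  have "z - \<tau> *\<^sub>R field z = (fst z - \<tau> *\<^sub>R fst (grad z), snd z + \<tau> *\<^sub>R snd (grad z))"
    by (rule prod_eqI) (simp_all add: field_def saddle_field_def)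
  then show ?thesis by (simp add: proj_step_def closest_point_Times[OF X Y])
qed

text \<open>The saddle point is a fixed point of the step, and the projection is
  nonexpansive.\<close>

lemma proj_step_dist:
  assumes "z \<in> X \<times> Y" "\<tau> \<ge> 0"
  shows "norm (proj_step \<tau> z - saddle) \<le> (1 + \<tau> * L) * norm (z - saddle)"
proof -
  have "closest_point (X \<times> Y) (saddle - \<tau> *\<^sub>R field saddle) = saddle"
    by (rule VI_closest_point) (use Z saddle assms in auto)
  then have "norm (proj_step \<tau> z - saddle) \<le> norm ((z - \<tau> *\<^sub>R field z) - (saddle - \<tau> *\<^sub>R field saddle))"
    using closest_point_lipschitz[OF Z(2,1,3), of "z - \<tau> *\<^sub>R field z" "saddle - \<tau> *\<^sub>R field saddle"]
    by (simp add: proj_step_eq dist_norm)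
  also have "\<dots> = norm ((z - saddle) - \<tau> *\<^sub>R (field z - field saddle))" by (simp add: algebra_simps)
  also have "\<dots> \<le> norm (z - saddle) + \<tau> * norm (field z - field saddle)"
    using norm_triangle_ineq4[of "z - saddle" "\<tau> *\<^sub>R (field z - field saddle)"] assms by simp
  also have "\<dots> \<le> norm (z - saddle) + \<tau> * (L * norm (z - saddle))"
    using assms saddle field_lipschitz by (intro add_mono mult_left_mono) auto
  finally show ?thesis by (simp add: algebra_simps)
qed

text \<open>Strong monotonicity and Lipschitz continuity are compared on a pair of distinct points;
  a one-point \<open>Y\<close> offers no such pair.\<close>

lemma mu_y_le_L:
  assumes "y \<in> Y" "y' \<in> Y" "y \<noteq> y'"
  shows "\<mu>y \<le> L"
proof -
  obtain x where x: "x \<in> X" using X by blast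
  have "\<mu>y * (norm (y - y'))\<^sup>2 \<le> (snd (grad (x, y')) - snd (grad (x, y))) \<bullet> (y - y')"
    by (rule grad_y_mono[OF x assms(1,2)])
  also have "\<dots> \<le> norm (snd (grad (x, y')) - snd (grad (x, y))) * norm (y - y')"
    by (rule norm_cauchy_schwarz)
  also have "\<dots> \<le> (L * norm (y - y')) * norm (y - y')"
    using grad_y_lipschitz[of "(x, y')" "(x, y)"] x assms
    by (intro mult_right_mono) (simp_all add: norm_minus_commute)
  finally have "\<mu>y * (norm (y - y'))\<^sup>2 \<le> L * (norm (y - y'))\<^sup>2"
    by (simp add: power2_eq_square mult.assoc)
  then show ?thesis by (rule mult_right_le_imp_le) (use assms in simp)
qed

text \<open>The maximizer \<open>yh\<close> of \<open>f (xn, _)\<close> stays close to the saddle point by \<open>best_response_y\<close>, so convexity in \<open>x\<close>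
  at \<open>(xn, yh)\<close> bounds the primal gap without differentiating the maximum over \<open>y\<close>.  This replaces
  \<open>n L\<^sup>2 / m\<close>, which a direct estimate of the two-sided gap would give, by \<open>sqrt n L + L\<^sup>2 / m\<close>.\<close>

lemma proj_step_gap:
  assumes z: "z \<in> X \<times> Y" and m: "m > 0" "m \<le> \<mu>x" "m \<le> \<mu>y"
    and \<tau>: "\<tau> = 1 / (4 * sqrt n * L)"
  shows "primal (fst (proj_step \<tau> z)) - dual (snd (proj_step \<tau> z))
    \<le> (32 * sqrt n * L + 4 * L\<^sup>2 / m) * (norm (z - saddle))\<^sup>2"
    and "norm (proj_step \<tau> z - saddle) \<le> 5 / 4 * norm (z - saddle)"
proof -
  obtain xt yt where zt: "z = (xt, yt)" by (cases z)
  obtain xn yn where zn: "proj_step \<tau> z = (xn, yn)" by (cases "proj_step \<tau> z")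
  obtain xs ys where zs: "saddle = (xs, ys)" by (cases saddle)
  define d where "d = norm (z - saddle)"
  have sn: "sqrt n \<ge> 1" using n by simp
  have \<tau>0: "\<tau> > 0" using sn L n by (simp add: \<tau>)
  have "\<tau> * L = 1 / (4 * sqrt n)" using L by (simp add: \<tau>)
  also have "\<dots> \<le> 1 / 4" using sn by (simp add: field_simps)
  finally have "\<tau> * L \<le> 1 / 4" .
  then have D: "norm (proj_step \<tau> z - saddle) \<le> 5 / 4 * d"
    using proj_step_dist[OF z, of \<tau>] \<tau>0 mult_right_mono[of "1 + \<tau> * L" "5 / 4" d]
    by (simp add: d_def)
  then show "norm (proj_step \<tau> z - saddle) \<le> 5 / 4 * norm (z - saddle)" by (simp add: d_def)
  have D2: "norm (proj_step \<tau> z - z) \<le> 9 / 4 * d"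
    using norm_triangle_ineq4[of "proj_step \<tau> z - saddle" "z - saddle"] D by (simp add: d_def)
  have in_XY: "xt \<in> X" "yt \<in> Y" "xn \<in> X" "yn \<in> Y" "xs \<in> X" "ys \<in> Y"
    using z zt proj_step_in[of \<tau> z] zn saddle(1) zs by auto
  have "norm ((xn, yn) - (xs, ys)) \<le> 5 / 4 * d" "norm ((xn, yn) - (xt, yt)) \<le> 9 / 4 * d"
      "norm ((xs, ys) - (xt, yt)) = d"
    using D D2 zn zs by (simp_all add: zt[symmetric] d_def norm_minus_commute)
  note this norm_fst_le'[of "(xn, yn) - (xs, ys)"] norm_fst_le'[of "(xn, yn) - (xt, yt)"]
    norm_fst_le'[of "(xs, ys) - (xt, yt)"] norm_snd_le'[of "(xn, yn) - (xs, ys)"]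
    norm_snd_le'[of "(xn, yn) - (xt, yt)"] norm_snd_le'[of "(xs, ys) - (xt, yt)"]
  then have xb: "norm (xn - xs) \<le> 5 / 4 * d" "norm (xn - xt) \<le> 9 / 4 * d" "norm (xs - xt) \<le> d"
    and yb: "norm (yn - ys) \<le> 5 / 4 * d" "norm (yn - yt) \<le> 9 / 4 * d" "norm (ys - yt) \<le> d"
    by simp_all
  have d0: "d \<ge> 0" by (simp add: d_def)
  \<comment> \<open>Bounds the change of the gradient from the old point to (xn, yh): 9/4 d for the
    step in x, plus d + (L/m) (5/4 d) for the way from \<open>yt\<close> to \<open>yh\<close>
    through the saddle point. The dual half uses the same bound.\<close>
  define c where "c = L * (13 / 4 * d + L / m * (5 / 4 * d))"
  have xn_eq: "xn = closest_point X (xt - \<tau> *\<^sub>R fst (grad (xt, yt)))"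
    and yn_eq: "yn = closest_point Y (yt - \<tau> *\<^sub>R - snd (grad (xt, yt)))"
    using zn zt by (auto simp: proj_step_def)
  have projx: "(xt - \<tau> *\<^sub>R fst (grad (xt, yt)) - xn) \<bullet> (xs - xn) \<le> 0"
    unfolding xn_eq by (rule closest_point_dot[OF X(2,1) in_XY(5)])
  have projy: "(yt - \<tau> *\<^sub>R - snd (grad (xt, yt)) - yn) \<bullet> (ys - yn) \<le> 0"
    unfolding yn_eq by (rule closest_point_dot[OF Y(2,1) in_XY(6)])
  have ratio: "L / \<mu>x \<le> L / m" "L / \<mu>y \<le> L / m" using m L by (auto intro!: divide_left_mono)
  have step: "(1 / \<tau> * a + c) * b \<le> (16 * sqrt n * L + 2 * L\<^sup>2 / m) * d\<^sup>2"
    if "0 \<le> a" "a \<le> 9 / 4 * d" "0 \<le> b" "b \<le> 5 / 4 * d" for a b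
  proof -
    have "(1 / \<tau> * a + c) * b \<le> (1 / \<tau> * (9 / 4 * d) + c) * (5 / 4 * d)"
      using that \<tau>0 d0 L m by (intro mult_mono add_mono mult_left_mono) (auto simp: c_def)
    \<comment> \<open>With 1/tau = 4 sqrt(n) L the coefficients are 4 * 9/4 * 5/4, then 13/4 * 5/4,
      then 5/4 * 5/4; the first two sum to less than 16.\<close>
    also have "\<dots> = (45 / 4 * (sqrt n * L) + 65 / 16 * L + 25 / 16 * (L\<^sup>2 / m)) * d\<^sup>2"
      by (simp add: c_def \<tau> power2_eq_square field_simps)
    also have "\<dots> \<le> (16 * sqrt n * L + 2 * L\<^sup>2 / m) * d\<^sup>2"
    proof (rule mult_right_mono)
      have "L \<le> sqrt n * L" using sn L by simp
      moreover have "0 \<le> L\<^sup>2 / m" using m by simp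
      ultimately have "45 / 4 * (sqrt n * L) + 65 / 16 * L + 25 / 16 * (L\<^sup>2 / m)
          \<le> 16 * (sqrt n * L) + 2 * (L\<^sup>2 / m)" using L by linarith
      then show "45 / 4 * (sqrt n * L) + 65 / 16 * L + 25 / 16 * (L\<^sup>2 / m)
          \<le> 16 * sqrt n * L + 2 * L\<^sup>2 / m" by simp
    qed simp
    finally show ?thesis .
  qed
  obtain yh where yh: "yh \<in> Y" "primal xn = f (xn, yh)" "norm (yh - ys) \<le> L / \<mu>y * norm (xn - xs)"
    using primal_attained[OF in_XY(3)] by (auto simp: zs)
  have "primal xn - f saddle \<le> fst (grad (xn, yh)) \<bullet> (xn - xs)"
  proof -
    have "0 \<le> \<mu>x / 2 * (norm (xs - xn))\<^sup>2" "0 \<le> \<mu>y / 2 * (norm (yh - ys))\<^sup>2" using \<mu> by auto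
    then show ?thesis
      using below_x[OF in_XY(3,5) yh(1)] saddle_max_y[OF yh(1)] unfolding yh(2)
      by (simp add: zs grad_def inner_diff)
  qed
  also have "\<dots> \<le> (1 / \<tau> * norm (xn - xt) + c) * norm (xn - xs)"
  proof (rule projected_step_inner_le[OF \<tau>0 projx])
    have "L / \<mu>y * norm (xn - xs) \<le> L / m * (5 / 4 * d)"
      using ratio xb m L by (intro mult_mono) auto
    with yh(3) yb(3) norm_triangle_ineq[of "yh - ys" "ys - yt"]
    have "norm (yh - yt) \<le> L / m * (5 / 4 * d) + d" by simp
    with xb(2) norm_Pair_le[of "xn - xt" "yh - yt"]
    have "norm ((xn, yh) - (xt, yt)) \<le> 13 / 4 * d + L / m * (5 / 4 * d)" by simp
    then have "L * norm ((xn, yh) - (xt, yt)) \<le> c" unfolding c_def using L by (intro mult_left_mono) auto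
    with grad_x_lipschitz[of "(xn, yh)" "(xt, yt)"] in_XY yh(1)
    show "norm (fst (grad (xn, yh)) - fst (grad (xt, yt))) \<le> c" by simp
  qed
  also have "\<dots> \<le> (16 * sqrt n * L + 2 * L\<^sup>2 / m) * d\<^sup>2" by (rule step) (use xb in auto)
  finally have P: "primal xn - f saddle \<le> (16 * sqrt n * L + 2 * L\<^sup>2 / m) * d\<^sup>2" .
  obtain xh where xh: "xh \<in> X" "dual yn = f (xh, yn)" "norm (xh - xs) \<le> L / \<mu>x * norm (yn - ys)"
    using dual_attained[OF in_XY(4)] by (auto simp: zs)
  have "f saddle - dual yn \<le> (- snd (grad (xh, yn))) \<bullet> (yn - ys)"
  proof -
    have "0 \<le> \<mu>x / 2 * (norm (xh - xs))\<^sup>2" "0 \<le> \<mu>y / 2 * (norm (ys - yn))\<^sup>2" using \<mu> by auto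
    then show ?thesis
      using above_y[OF xh(1) in_XY(4,6)] saddle_min_x[OF xh(1)] unfolding xh(2)
      by (simp add: zs grad_def inner_diff)
  qed
  also have "\<dots> \<le> (1 / \<tau> * norm (yn - yt) + c) * norm (yn - ys)"
  proof (rule projected_step_inner_le[OF \<tau>0 projy])
    have "L / \<mu>x * norm (yn - ys) \<le> L / m * (5 / 4 * d)"
      using ratio yb m L by (intro mult_mono) auto
    with xh(3) xb(3) norm_triangle_ineq[of "xh - xs" "xs - xt"]
    have "norm (xh - xt) \<le> L / m * (5 / 4 * d) + d" by simp
    with yb(2) norm_Pair_le[of "xh - xt" "yn - yt"]
    have "norm ((xh, yn) - (xt, yt)) \<le> 13 / 4 * d + L / m * (5 / 4 * d)" by simp
    then have "L * norm ((xh, yn) - (xt, yt)) \<le> c" unfolding c_def using L by (intro mult_left_mono) auto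
    with grad_y_lipschitz[of "(xh, yn)" "(xt, yt)"] in_XY xh(1)
    show "norm (- snd (grad (xh, yn)) - - snd (grad (xt, yt))) \<le> c"
      by (simp add: norm_minus_commute)
  qed
  also have "\<dots> \<le> (16 * sqrt n * L + 2 * L\<^sup>2 / m) * d\<^sup>2" by (rule step) (use yb in auto)
  finally have Q: "f saddle - dual yn \<le> (16 * sqrt n * L + 2 * L\<^sup>2 / m) * d\<^sup>2" .
  from P Q show "primal (fst (proj_step \<tau> z)) - dual (snd (proj_step \<tau> z))
    \<le> (32 * sqrt n * L + 4 * L\<^sup>2 / m) * (norm (z - saddle))\<^sup>2"
    by (simp add: zn d_def[symmetric] algebra_simps)
qed

text \<open>The factor 3 bounds (2 - p) / (1 - p) for p at most 1/2: the potential starts at 2 - p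
  times the squared distance, and only its part in z, of weight 1 - p, is read off at the
  end.\<close>

lemma lsvre_convergence:
  assumes z0: "z0 \<in> X \<times> Y" and m: "m > 0" "m \<le> \<mu>x" "m \<le> \<mu>y"
    and \<tau>: "\<tau> = 1 / (4 * sqrt n * L)" and p: "p = 1 / (2 * n)"
    and T: "real T \<ge> 4 * (n + 2 * sqrt n * L / m) * ln R" and R: "R > 0"
  shows "measure_pmf.expectation (lsvre n fi' (X \<times> Y) z0 \<tau> p T) (\<lambda>(z, c). (norm (z - saddle))\<^sup>2)
    \<le> 3 / R * (norm (z0 - saddle))\<^sup>2"
proof -
  \<comment> \<open>1 / (tau m) is twice the summand 2 sqrt(n) L / m, while 1 / (p - tau^2 L^2) = 16
    n / 7 and 1 / (1 - p) are at most 4 n; so both conditions on the contraction rate hold.\<close>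
  define \<theta> where "\<theta> = 1 / (4 * (n + 2 * sqrt n * L / m))"
  define V where "V = (\<lambda>(z, w, c :: nat). (1 - p) * (norm (z - saddle))\<^sup>2 + (norm (w - saddle))\<^sup>2)"
  have n0: "real n \<ge> 1" using n by simp
  have sn: "sqrt n \<ge> 1" using n by simp
  have \<tau>0: "\<tau> > 0" using sn L n by (simp add: \<tau>)
  have p01: "0 < p" "p \<le> 1 / 2" "p < 1" using n0 by (auto simp: p field_simps)
  have q0: "2 * sqrt n * L / m \<ge> 0" using L m by simp
  have \<theta>0: "\<theta> > 0" using n0 q0 unfolding \<theta>_def by (intro divide_pos_pos mult_pos_pos) auto
  have tl: "\<tau>\<^sup>2 * L\<^sup>2 = 1 / (16 * n)" using L n0 by (simp add: \<tau> power2_eq_square)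
  have tm: "1 / (\<tau> * m) = 2 * (2 * sqrt n * L / m)" by (simp add: \<tau>)
  have small: "\<theta> * t \<le> 1" if "t \<le> 4 * (n + 2 * sqrt n * L / m)" for t
  proof -
    have "\<theta> * t \<le> \<theta> * (4 * (n + 2 * sqrt n * L / m))" using that \<theta>0 by (intro mult_left_mono) auto
    also have "\<dots> = 1" unfolding \<theta>_def using n0 q0 by simp
    finally show ?thesis .
  qed
  have comb: "2 * r + t \<le> 4 * (n + r)" if "r \<ge> 0" "t \<le> 4 * n" for r t :: real
    using that by simp
  have pt: "1 / (p - \<tau>\<^sup>2 * L\<^sup>2) = 16 / 7 * real n" unfolding tl p using n0 by (simp add: field_simps)
  have p1: "1 / (1 - p) \<le> 2" using p01 by (simp add: field_simps)
  have \<theta>1: "\<theta> \<le> 1" using small[of 1] n0 q0 by simp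
  have "measure_pmf.expectation (lsvre_run n fi' (X \<times> Y) z0 \<tau> p T) V \<le> (1 - \<theta>) ^ T * V (z0, z0, n)"
  proof (induction T)
    case (Suc T)
    let ?M = "lsvre_run n fi' (X \<times> Y) z0 \<tau> p T"
    have step: "measure_pmf.expectation (lsvre_step n fi' (X \<times> Y) \<tau> p s) V \<le> (1 - \<theta>) * V s"
      if s: "s \<in> set_pmf ?M" for s
    proof -
      obtain z w c where sz: "s = (z, w, c)" by (cases s)
      have w: "w \<in> X \<times> Y" using lsvre_run_in[OF Z(1) z0] s sz by blast
      define h where "h = closest_point (X \<times> Y) ((1 - p) *\<^sub>R z + p *\<^sub>R w - \<tau> *\<^sub>R field w)"
      define N where "N i = closest_point (X \<times> Y) ((1 - p) *\<^sub>R z + p *\<^sub>R w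
        - \<tau> *\<^sub>R (field w + saddle_field (fi' i) h - saddle_field (fi' i) w))" for i
      have fd: "field = saddle_field (\<lambda>v. avg n (\<lambda>i. fi' i v))"
        by (simp add: field_def grad_def[abs_def])
      have "measure_pmf.expectation (lsvre_step n fi' (X \<times> Y) \<tau> p s) V =
        avg n (\<lambda>i. p * V (N i, N i, c + 2 + n) + (1 - p) * V (N i, w, c + 2))"
        unfolding sz N_def h_def fd by (rule expectation_lsvre_step[OF n]) (use p01 in auto)
      also have "\<dots> = avg n (\<lambda>i. (norm (N i - saddle))\<^sup>2 + (1 - p) * (norm (w - saddle))\<^sup>2)"
        by (simp add: V_def algebra_simps)
      also have "\<dots> = avg n (\<lambda>i. (norm (N i - saddle))\<^sup>2) + (1 - p) * (norm (w - saddle))\<^sup>2"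
        by (simp only: avg_add avg_const[OF n])
      also have "\<dots> \<le> (1 - \<theta>) * ((1 - p) * (norm (z - saddle))\<^sup>2 + (norm (w - saddle))\<^sup>2)"
      proof (rule svrg_extragradient_contraction[OF Z(1,2) saddle(1) _ n w, of "\<lambda>i. saddle_field (fi' i)" m L \<tau> p \<theta> h])
        show "avg n (\<lambda>i. (norm (saddle_field (fi' i) v - saddle_field (fi' i) v'))\<^sup>2)
            \<le> L\<^sup>2 * (norm (v - v'))\<^sup>2" if "v \<in> X \<times> Y" "v' \<in> X \<times> Y" for v v'
          using smooth_le[OF that] by (simp add: norm_saddle_field_diff)
        show "\<tau>\<^sup>2 * L\<^sup>2 < p" unfolding tl p using n0 by (simp add: field_simps)
        show "\<theta> * (1 / (\<tau> * m) + 1 / (p - \<tau>\<^sup>2 * L\<^sup>2)) \<le> 1"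
          by (rule small, unfold tm pt, rule comb) (use q0 n0 in auto)
        show "\<theta> * (1 / (\<tau> * m) + 1 / (1 - p)) \<le> 1"
          by (rule small, unfold tm, rule comb) (use q0 n0 p1 in auto)
      qed (use p01 \<tau>0 m \<theta>0 saddle(2) field_mono in \<open>auto simp: field_avg[symmetric] h_def N_def\<close>)
      finally show ?thesis by (simp add: V_def sz)
    qed
    have "measure_pmf.expectation (lsvre_run n fi' (X \<times> Y) z0 \<tau> p (Suc T)) V =
      measure_pmf.expectation ?M (\<lambda>s. measure_pmf.expectation (lsvre_step n fi' (X \<times> Y) \<tau> p s) V)"
      unfolding lsvre_run.simps
      by (rule expectation_bind_finite[OF finite_set_lsvre_run[OF n] finite_set_lsvre_step[OF n]])
    also have "\<dots> \<le> measure_pmf.expectation ?M (\<lambda>s. (1 - \<theta>) * V s)"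
      by (rule expectation_mono_finite[OF finite_set_lsvre_run[OF n] step])
    also have "\<dots> = (1 - \<theta>) * measure_pmf.expectation ?M V" by simp
    also have "\<dots> \<le> (1 - \<theta>) * ((1 - \<theta>) ^ T * V (z0, z0, n))"
      using \<theta>1 Suc by (intro mult_left_mono) auto
    finally show ?case by simp
  qed simp
  also have "\<dots> \<le> 1 / R * V (z0, z0, n)"
  proof (rule mult_right_mono)
    have "ln R = \<theta> * (4 * (n + 2 * sqrt n * L / m) * ln R)"
      unfolding \<theta>_def using n0 q0 by simp
    also have "\<dots> \<le> \<theta> * T" using T \<theta>0 by (intro mult_left_mono) auto
    finally show "(1 - \<theta>) ^ T \<le> 1 / R" using \<theta>0 \<theta>1 R by (intro one_minus_power_le) auto
    show "0 \<le> V (z0, z0, n)" using p01 by (simp add: V_def)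
  qed
  also have "\<dots> \<le> 1 / R * ((1 - p) * (3 * (norm (z0 - saddle))\<^sup>2))"
  proof -
    have "(2 - p) * (norm (z0 - saddle))\<^sup>2 \<le> ((1 - p) * 3) * (norm (z0 - saddle))\<^sup>2"
      using p01 by (intro mult_right_mono) auto
    then show ?thesis using R by (intro mult_left_mono) (auto simp: V_def algebra_simps)
  qed
  finally have A: "measure_pmf.expectation (lsvre_run n fi' (X \<times> Y) z0 \<tau> p T) V
    \<le> (1 - p) * (3 / R * (norm (z0 - saddle))\<^sup>2)" by simp
  have "(1 - p) * measure_pmf.expectation (lsvre n fi' (X \<times> Y) z0 \<tau> p T) (\<lambda>(z, c). (norm (z - saddle))\<^sup>2)
    = measure_pmf.expectation (lsvre_run n fi' (X \<times> Y) z0 \<tau> p T) (\<lambda>(z, w, c). (1 - p) * (norm (z - saddle))\<^sup>2)"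
    by (simp add: lsvre_def case_prod_unfold)
  also have "\<dots> \<le> measure_pmf.expectation (lsvre_run n fi' (X \<times> Y) z0 \<tau> p T) V"
    by (rule expectation_mono_finite[OF finite_set_lsvre_run[OF n]]) (auto simp: V_def)
  also note A
  finally show ?thesis by (rule mult_left_le_imp_le) (use p01 in simp)
qed

text \<open>Expanding the square adds beta to the modulus in x exactly; Minkowski's inequality adds
  beta to the smoothness constant.\<close>

lemma prox_saddle_problem:
  assumes \<beta>: "\<beta> \<ge> 0"
  shows "saddle_problem X Y n (\<lambda>i. prox_grad \<beta> u (fi' i))
    (\<lambda>z. f z + \<beta> / 2 * (norm (fst z - u))\<^sup>2) (\<mu>x + \<beta>) \<mu>y (L + \<beta>)"
proof
  show "average_smooth n (\<lambda>i. prox_grad \<beta> u (fi' i)) (X \<times> Y) (L + \<beta>)"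
    unfolding average_smooth_def
  proof (intro ballI)
    fix z z' assume z: "z \<in> X \<times> Y" "z' \<in> X \<times> Y"
    have "avg n (\<lambda>i. (norm (prox_grad \<beta> u (fi' i) z - prox_grad \<beta> u (fi' i) z'))\<^sup>2) =
        avg n (\<lambda>i. (norm ((fi' i z - fi' i z') + (\<beta> *\<^sub>R fst (z - z'), 0)))\<^sup>2)"
      by (intro arg_cong[of _ _ "avg n"] ext arg_cong[of _ _ "\<lambda>v. (norm v)\<^sup>2"])
         (simp add: prox_grad_def prod_eq_iff algebra_simps)
    also have "\<dots> \<le> (L * norm (z - z') + \<beta> * norm (z - z'))\<^sup>2"
    proof (rule sqrt_avg_sq_triangle[OF n])
      show "norm (\<beta> *\<^sub>R fst (z - z'), 0) \<le> \<beta> * norm (z - z')"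
        using \<beta> norm_fst_le'[of "z - z'"] by (simp add: norm_Pair mult_left_mono)
    qed (use smooth_le[OF z] L \<beta> in \<open>auto simp: power_mult_distrib\<close>)
    finally show "avg n (\<lambda>i. (norm (prox_grad \<beta> u (fi' i) z - prox_grad \<beta> u (fi' i) z'))\<^sup>2)
        \<le> (L + \<beta>)\<^sup>2 * (norm (z - z'))\<^sup>2"
      by (simp add: power_mult_distrib[symmetric] distrib_right)
  qed
  fix x x' y assume x: "x \<in> X" "x' \<in> X" and y: "y \<in> Y"
  have "\<beta> / 2 * (norm (x' - u))\<^sup>2 = \<beta> / 2 * (norm (x - u))\<^sup>2 + \<beta> * ((x - u) \<bullet> (x' - x)) + \<beta> / 2 * (norm (x' - x))\<^sup>2"
    unfolding power2_norm_eq_inner by (simp add: inner_diff inner_commute algebra_simps)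
  with below_x[OF x y]
  show "f (x, y) + \<beta> / 2 * (norm (fst (x, y) - u))\<^sup>2 + fst (avg n (\<lambda>i. prox_grad \<beta> u (fi' i) (x, y))) \<bullet> (x' - x)
      + (\<mu>x + \<beta>) / 2 * (norm (x' - x))\<^sup>2 \<le> f (x', y) + \<beta> / 2 * (norm (fst (x', y) - u))\<^sup>2"
    by (simp add: avg_prox_grad[OF n] inner_add algebra_simps add_divide_distrib)
next
  fix x y y' assume "x \<in> X" "y \<in> Y" "y' \<in> Y"
  from above_y[OF this]
  show "f (x, y') + \<beta> / 2 * (norm (fst (x, y') - u))\<^sup>2 \<le> f (x, y) + \<beta> / 2 * (norm (fst (x, y) - u))\<^sup>2
      + snd (avg n (\<lambda>i. prox_grad \<beta> u (fi' i) (x, y))) \<bullet> (y' - y) - \<mu>y / 2 * (norm (y' - y))\<^sup>2"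
    by (simp add: avg_prox_grad[OF n])
qed (use X Y n L \<mu> \<beta> in auto)

lemma convex_x:
  assumes "x \<in> X" "x' \<in> X" "y \<in> Y" "0 \<le> t" "t \<le> 1"
  shows "(1 - t) *\<^sub>R x + t *\<^sub>R x' \<in> X"
    and "f ((1 - t) *\<^sub>R x + t *\<^sub>R x', y)
      \<le> (1 - t) * f (x, y) + t * f (x', y) - \<mu>x / 2 * t * (1 - t) * (norm (x - x'))\<^sup>2"
proof -
  let ?w = "(1 - t) *\<^sub>R x + t *\<^sub>R x'"
  show w: "?w \<in> X" using convexD_alt[OF X(2) assms(1,2,4,5)] .
  let ?g = "fst (avg n (\<lambda>i. fi' i (?w, y)))"
  have e: "x - ?w = t *\<^sub>R (x - x')" "x' - ?w = (t - 1) *\<^sub>R (x - x')" by (simp_all add: algebra_simps)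
  have "f (x, y) \<ge> f (?w, y) + t * (?g \<bullet> (x - x')) + \<mu>x / 2 * (t\<^sup>2 * (norm (x - x'))\<^sup>2)"
    using below_x[OF w assms(1,3)] unfolding e by (simp add: power_mult_distrib)
  moreover have "f (x', y) \<ge> f (?w, y) + (t - 1) * (?g \<bullet> (x - x')) + \<mu>x / 2 * ((1 - t)\<^sup>2 * (norm (x - x'))\<^sup>2)"
    using below_x[OF w assms(2,3)] unfolding e by (simp add: power_mult_distrib power2_commute)
  ultimately have "(1 - t) * (f (?w, y) + t * (?g \<bullet> (x - x')) + \<mu>x / 2 * (t\<^sup>2 * (norm (x - x'))\<^sup>2))
     + t * (f (?w, y) + (t - 1) * (?g \<bullet> (x - x')) + \<mu>x / 2 * ((1 - t)\<^sup>2 * (norm (x - x'))\<^sup>2))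
     \<le> (1 - t) * f (x, y) + t * f (x', y)"
    using assms by (intro add_mono mult_left_mono) auto
  also have "(1 - t) * (f (?w, y) + t * (?g \<bullet> (x - x')) + \<mu>x / 2 * (t\<^sup>2 * (norm (x - x'))\<^sup>2))
     + t * (f (?w, y) + (t - 1) * (?g \<bullet> (x - x')) + \<mu>x / 2 * ((1 - t)\<^sup>2 * (norm (x - x'))\<^sup>2))
     = f (?w, y) + \<mu>x / 2 * t * (1 - t) * (norm (x - x'))\<^sup>2"
    by (simp add: power2_eq_square field_simps)
  finally show "f (?w, y) \<le> (1 - t) * f (x, y) + t * f (x', y) - \<mu>x / 2 * t * (1 - t) * (norm (x - x'))\<^sup>2"
    by simp
qed

text \<open>The maximizer in y at the intermediate point is a competitor at both end points.\<close>

lemma primal_convex: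
  assumes "x \<in> X" "x' \<in> X" "0 \<le> t" "t \<le> 1"
  shows "primal ((1 - t) *\<^sub>R x + t *\<^sub>R x')
    \<le> (1 - t) * primal x + t * primal x' - \<mu>x / 2 * t * (1 - t) * (norm (x - x'))\<^sup>2"
proof -
  obtain y where y: "y \<in> Y" "primal ((1 - t) *\<^sub>R x + t *\<^sub>R x') = f ((1 - t) *\<^sub>R x + t *\<^sub>R x', y)"
  proof -
    obtain y0 where "y0 \<in> Y" using Y by blast
    then show ?thesis using primal_attained[OF convex_x(1)[OF assms(1,2) _ assms(3,4)]] that by metis
  qed
  have "(1 - t) * f (x, y) + t * f (x', y) \<le> (1 - t) * primal x + t * primal x'"
    using assms y by (intro add_mono mult_left_mono primal_upper) auto
  with convex_x(2)[OF assms(1,2) y(1) assms(3,4)] y(2) show ?thesis by linarith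
qed

lemma primal_saddle: "primal (fst saddle) = f saddle"
proof (rule antisym)
  obtain y where y: "y \<in> Y" "primal (fst saddle) = f (fst saddle, y)"
    using primal_attained[OF saddle_components(1)] by metis
  have "0 \<le> \<mu>y / 2 * (norm (y - snd saddle))\<^sup>2" using \<mu> by simp
  then show "primal (fst saddle) \<le> f saddle" using saddle_max_y[OF y(1)] y(2) by linarith
  show "f saddle \<le> primal (fst saddle)" using primal_upper[OF saddle_components] by simp
qed

end

lemma gradient_on_avg:
  assumes "\<And>i. i \<in> {1..n} \<Longrightarrow> gradient_on Z (fi i) (fi' i)"
  shows "gradient_on Z (\<lambda>z. avg n (\<lambda>i. fi i z)) (\<lambda>z. avg n (\<lambda>i. fi' i z))"
  unfolding gradient_on_def
proof
  fix z assume "z \<in> Z"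
  then have "((\<lambda>z. (1 / real n) *\<^sub>R (\<Sum>i=1..n. fi i z)) has_derivative
      (\<lambda>h. (1 / real n) *\<^sub>R (\<Sum>i=1..n. fi' i z \<bullet> h))) (at z within Z)"
    using assms unfolding gradient_on_def
    by (intro has_derivative_scaleR_right has_derivative_sum) auto
  then show "((\<lambda>z. avg n (\<lambda>i. fi i z)) has_derivative (\<lambda>h. avg n (\<lambda>i. fi' i z) \<bullet> h)) (at z within Z)"
    unfolding avg_inner by (simp only: avg_def)
qed

lemma gradient_on_fst:
  assumes "gradient_on (X \<times> Y) f f'" "x \<in> X" "y \<in> Y"
  shows "((\<lambda>x. f (x, y)) has_derivative (\<lambda>h. fst (f' (x, y)) \<bullet> h)) (at x within X)"
proof -
  have "((\<lambda>x. f (x, y)) has_derivative (\<lambda>h. f' (x, y) \<bullet> (h, 0))) (at x within X)"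
    by (rule has_derivative_in_compose2[of "X \<times> Y" f "\<lambda>z h. f' z \<bullet> h"])
       (use assms in \<open>auto simp: gradient_on_def intro!: derivative_eq_intros\<close>)
  then show ?thesis by (simp add: inner_prod_def)
qed

lemma gradient_on_snd:
  assumes "gradient_on (X \<times> Y) f f'" "x \<in> X" "y \<in> Y"
  shows "((\<lambda>y. f (x, y)) has_derivative (\<lambda>h. snd (f' (x, y)) \<bullet> h)) (at y within Y)"
proof -
  have "((\<lambda>y. f (x, y)) has_derivative (\<lambda>h. f' (x, y) \<bullet> (0, h))) (at y within Y)"
    by (rule has_derivative_in_compose2[of "X \<times> Y" f "\<lambda>z h. f' z \<bullet> h"])
       (use assms in \<open>auto simp: gradient_on_def intro!: derivative_eq_intros\<close>)
  then show ?thesis by (simp add: inner_prod_def)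
qed

lemma saddle_problemI:
  assumes X: "closed X" "convex X" "X \<noteq> {}" and Y: "closed Y" "convex Y" "Y \<noteq> {}"
    and n: "n \<ge> 1" and L: "L > 0" and \<mu>: "\<mu>x > 0" "\<mu>y > 0"
    and smooth: "average_smooth n fi' (X \<times> Y) L"
    and grad: "gradient_on (X \<times> Y) f (\<lambda>z. avg n (\<lambda>i. fi' i z))"
    and cc: "convex_concave \<mu>x \<mu>y X Y f"
  shows "saddle_problem X Y n fi' f \<mu>x \<mu>y L"
proof
  fix x x' y assume x: "x \<in> X" "x' \<in> X" and y: "y \<in> Y"
  show "f (x, y) + fst (avg n (\<lambda>i. fi' i (x, y))) \<bullet> (x' - x) + \<mu>x / 2 * (norm (x' - x))\<^sup>2 \<le> f (x', y)"
    by (rule gradient_strongly_convex[OF _ x gradient_on_fst[OF grad x(1) y]])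
       (use cc y in \<open>simp add: convex_concave_def\<close>)
next
  fix x y y' assume x: "x \<in> X" and y: "y \<in> Y" "y' \<in> Y"
  have "((\<lambda>y. - f (x, y)) has_derivative (\<lambda>h. - snd (avg n (\<lambda>i. fi' i (x, y))) \<bullet> h)) (at y within Y)"
    using has_derivative_minus[OF gradient_on_snd[OF grad x y(1)]] by simp
  from gradient_strongly_convex[OF _ y this, of \<mu>y]
  show "f (x, y') \<le> f (x, y) + snd (avg n (\<lambda>i. fi' i (x, y))) \<bullet> (y' - y) - \<mu>y / 2 * (norm (y' - y))\<^sup>2"
    using cc x by (simp add: convex_concave_def strongly_concave_on_def)
qed (fact assms)+

section \<open>The accelerated outer loop\<close>

text \<open>\<open>a\<close>, \<open>b\<close> and \<open>d\<close> are the expectations of the Lyapunov function, of the squared distance of a stage's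
  starting point to the saddle point of its subproblem, and of that of the output of L-SVRE.\<close>

lemma linear_recursion_bound:
  fixes a b d :: "nat \<Rightarrow> real"
  defines "\<delta> \<equiv> \<lambda>s B \<Gamma> :: real. s\<^sup>2 * B / (16 * \<Gamma>)"
  assumes s: "0 < s" "s \<le> 1" and r: "r = 1 - s / 2" and pos: "B \<ge> 0" "\<Gamma> > 0" "R > 0" "Q \<ge> 0"
    and d: "\<And>k. d k \<le> 3 / R * b k"
    and a: "\<And>k. (1 - s / 4) * a (Suc k) \<le> (1 - s) * a k + 4 / s * (\<Gamma> * d k)"
    and b: "\<And>k. b (Suc k) \<le> 4 * d k + Q * (a (Suc k) + a k)"
    and a0: "a 0 \<le> B" and b0: "b 0 \<le> R * \<delta> s B \<Gamma> * r / 3"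
    and c: "4 * \<delta> s B \<Gamma> + 3 * Q * B \<le> R * \<delta> s B \<Gamma> * r / 3"
  shows "a k \<le> B * r ^ k" and "d k \<le> \<delta> s B \<Gamma> * r ^ Suc k"
proof -
  define D where "D = \<delta> s B \<Gamma>"
  have r0: "1 / 2 \<le> r" "r > 0" using r s by auto
  have D0: "D \<ge> 0" using pos by (simp add: D_def \<delta>_def)
  have dk: "d k \<le> D * r ^ Suc k" if "b k \<le> R * D * r / 3 * r ^ k" for k
  proof -
    have "d k \<le> 3 / R * (R * D * r / 3 * r ^ k)"
      using order_trans[OF d mult_left_mono[OF that]] pos by simp
    then show ?thesis using pos by simp
  qed
  \<comment> \<open>\<open>\<delta>\<close> is chosen so that the error 4/s times Gamma delta equals
    (s/4) B, and the bound on \<open>b\<close> so that the factor 3 / R turns it into the bound on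
    \<open>d\<close>.\<close>
  have "a k \<le> B * r ^ k \<and> b k \<le> R * D * r / 3 * r ^ k" for k
  proof (induction k)
    case 0
    show ?case using a0 b0 by (simp add: D_def)
  next
    case (Suc k)
    have dk': "d k \<le> D * r ^ Suc k" using dk Suc by simp
    have "(1 - s / 4) * a (Suc k) \<le> (1 - s) * (B * r ^ k) + 4 / s * (\<Gamma> * (D * r ^ Suc k))"
      using Suc dk' s pos by (intro order_trans[OF a] add_mono mult_left_mono) auto
    also have "4 / s * (\<Gamma> * (D * r ^ Suc k)) = s / 4 * B * r ^ Suc k"
      using s pos by (simp add: D_def \<delta>_def field_simps power2_eq_square)
    also have "(1 - s) * (B * r ^ k) + s / 4 * B * r ^ Suc k = (1 - s + s / 4 * r) * (B * r ^ k)"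
      by (simp add: algebra_simps)
    also have "\<dots> \<le> ((1 - s / 4) * r) * (B * r ^ k)"
    proof (rule mult_right_mono)
      have "0 \<le> s\<^sup>2" by simp
      then show "1 - s + s / 4 * r \<le> (1 - s / 4) * r"
        by (simp add: r field_simps power2_eq_square)
    qed (use pos r0 in simp)
    finally have "(1 - s / 4) * a (Suc k) \<le> (1 - s / 4) * (B * r ^ Suc k)" by (simp add: mult_ac)
    then have ak: "a (Suc k) \<le> B * r ^ Suc k" by (rule mult_left_le_imp_le) (use s in simp)
    have "b (Suc k) \<le> 4 * (D * r ^ Suc k) + Q * (B * r ^ Suc k + B * r ^ k)"
      using dk' ak Suc pos by (intro order_trans[OF b] add_mono mult_left_mono) auto
    \<comment> \<open>As r is at least 1/2, r^k is at most 2 r^(k+1); together with the term at k +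
      1 this makes the 3 in \<open>3 * Q * B\<close>.\<close>
    also have "\<dots> \<le> 4 * (D * r ^ Suc k) + Q * (B * r ^ Suc k + B * (2 * r ^ Suc k))"
    proof -
      have "1 * r ^ k \<le> (2 * r) * r ^ k" using r0 by (intro mult_right_mono) auto
      then show ?thesis using pos D0 by (intro add_mono mult_left_mono) auto
    qed
    also have "\<dots> = (4 * D + 3 * Q * B) * r ^ Suc k" by (simp add: algebra_simps)
    also have "\<dots> \<le> R * D * r / 3 * r ^ Suc k"
      using c r0 by (intro mult_right_mono) (auto simp: D_def)
    finally show ?case using ak by simp
  qed
  then show "a k \<le> B * r ^ k" "d k \<le> \<delta> s B \<Gamma> * r ^ Suc k" using dk[of k] by (auto simp: D_def)
qed

text \<open>\<open>\<beta>_le\<close> makes mux + beta the modulus of strong monotonicity of the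
  subproblem in both variables jointly.\<close>

locale prox_saddle = saddle_problem +
  fixes \<beta> :: real
  assumes \<beta>: "\<beta> \<ge> 0" and \<beta>_le: "\<mu>x + \<beta> \<le> \<mu>y"
begin

interpretation P: saddle_problem X Y n "\<lambda>i. prox_grad \<beta> u (fi' i)"
  "\<lambda>z. f z + \<beta> / 2 * (norm (fst z - u))\<^sup>2" "\<mu>x + \<beta>" \<mu>y "L + \<beta>" for u
  by (rule prox_saddle_problem[OF \<beta>])

definition "q = \<mu>x / (\<mu>x + \<beta>)"
definition "\<gamma> = (1 - sqrt q) / (1 + sqrt q)"
text \<open>Recovers the point \<open>x\<^sub>k\<^sub>-\<^sub>1 + (x\<^sub>k - x\<^sub>k\<^sub>-\<^sub>1) / sqrt q\<close> of Nesterov's method from the state \<open>(x\<^sub>k, u\<^sub>k)\<close>.\<close>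

definition "vel x u = (x :: 'a) + ((1 + sqrt q) / sqrt q) *\<^sub>R (u - x)"
definition "lyap x u = primal x - f saddle + \<mu>x / 2 * (norm (vel x u - fst saddle))\<^sup>2"
definition "psaddle u = P.saddle u"
definition "pstep u \<tau> z = P.proj_step u \<tau> z"

lemma P_primal:
  assumes "x \<in> X" shows "P.primal u x = primal x + \<beta> / 2 * (norm (x - u))\<^sup>2"
proof (rule antisym)
  obtain y where "y \<in> Y" "P.primal u x = f (x, y) + \<beta> / 2 * (norm (x - u))\<^sup>2"
    using P.primal_attained[OF assms, of u] by auto
  then show "P.primal u x \<le> primal x + \<beta> / 2 * (norm (x - u))\<^sup>2" using primal_upper[OF assms] by simp
  obtain y where "y \<in> Y" "primal x = f (x, y)" using primal_attained[OF assms] by auto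
  then show "primal x + \<beta> / 2 * (norm (x - u))\<^sup>2 \<le> P.primal u x"
    using P.primal_upper[OF assms, of y u] by simp
qed

lemma q: "0 < q" "q \<le> 1" "\<mu>x = q * (\<mu>x + \<beta>)" "\<beta> = \<mu>x * (1 - q) / q" "\<beta> / (\<mu>x + \<beta>) = 1 - q"
proof -
  have m: "\<mu>x + \<beta> > 0" using \<mu> \<beta> by simp
  show q0: "0 < q" "q \<le> 1" "\<mu>x = q * (\<mu>x + \<beta>)" using \<mu> \<beta> m by (auto simp: q_def)
  show 1: "\<beta> / (\<mu>x + \<beta>) = 1 - q" using m by (simp add: q_def field_simps)
  show "\<beta> = \<mu>x * (1 - q) / q" unfolding 1[symmetric] using m \<mu> by (simp add: q_def)
qed

lemma sqrt_q: "0 < sqrt q" "sqrt q \<le> 1" "sqrt q * sqrt q = q" "(sqrt q)\<^sup>2 = q" "0 < 1 + sqrt q"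
    "1 + sqrt q \<noteq> 0"
proof -
  show p: "0 < sqrt q" "sqrt q \<le> 1" "sqrt q * sqrt q = q" "(sqrt q)\<^sup>2 = q" using q by auto
  show "0 < 1 + sqrt q" "1 + sqrt q \<noteq> 0" using p(1) by linarith+
qed

lemma gamma: "0 \<le> \<gamma>" "\<gamma> \<le> 1"
proof -
  show "0 \<le> \<gamma>" unfolding \<gamma>_def using sqrt_q(1,2) by (intro divide_nonneg_nonneg) linarith+
  have "1 - sqrt q \<le> 1 * (1 + sqrt q)" using sqrt_q(1) by simp
  then show "\<gamma> \<le> 1" unfolding \<gamma>_def using sqrt_q(5) by (simp only: pos_divide_le_eq)
qed

lemma vel_update:
  "vel xn (xn + \<gamma> *\<^sub>R (xn - x)) = x + (1 / sqrt q) *\<^sub>R (xn - x)"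
proof -
  have "(1 + sqrt q) / sqrt q * \<gamma> = (1 - sqrt q) / sqrt q"
    using sqrt_q by (simp add: \<gamma>_def)
  also have "\<dots> = 1 / sqrt q - 1" using sqrt_q by (simp add: field_simps)
  finally have k: "(1 + sqrt q) / sqrt q * \<gamma> = 1 / sqrt q - 1" .
  have "vel xn (xn + \<gamma> *\<^sub>R (xn - x)) = xn + ((1 + sqrt q) / sqrt q * \<gamma>) *\<^sub>R (xn - x)"
    by (simp only: vel_def add_diff_cancel_left' scaleR_scaleR)
  then show ?thesis unfolding k by (simp add: algebra_simps)
qed

text \<open>The bound for \<open>u\<close> holds because \<open>u\<close> is the convex combination
  of \<open>x\<close> and \<open>vel x u\<close> with weight sqrt q / (1 + sqrt q) on the
  latter.\<close>

lemma lyap_bounds: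
  assumes "x \<in> X"
  shows "(norm (x - fst saddle))\<^sup>2 \<le> 2 / \<mu>x * lyap x u" "(norm (u - fst saddle))\<^sup>2 \<le> 2 / \<mu>x * lyap x u"
    "0 \<le> lyap x u"
proof -
  have s: "(norm (x - fst saddle))\<^sup>2 + (norm (vel x u - fst saddle))\<^sup>2 \<le> 2 / \<mu>x * lyap x u"
    using primal_ge_saddle[OF assms] \<mu> by (simp add: lyap_def field_simps)
  show a: "(norm (x - fst saddle))\<^sup>2 \<le> 2 / \<mu>x * lyap x u"
    by (rule order_trans[OF _ s]) simp
  then show nn: "0 \<le> lyap x u"
    using \<mu> order_trans[OF zero_le_power2 a] by (simp add: zero_le_divide_iff)
  have v: "(norm (vel x u - fst saddle))\<^sup>2 \<le> 2 / \<mu>x * lyap x u"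
    by (rule order_trans[OF _ s]) simp
  define t where "t = sqrt q / (1 + sqrt q)"
  have t: "0 \<le> t" "t \<le> 1" "t * ((1 + sqrt q) / sqrt q) = 1"
    using sqrt_q(1,5) by (simp_all add: t_def)
  have "u - fst saddle = (1 - t) *\<^sub>R (x - fst saddle) + t *\<^sub>R (vel x u - fst saddle)"
    using t(3) by (simp add: vel_def algebra_simps)
  moreover have "norm (x - fst saddle) \<le> sqrt (2 / \<mu>x * lyap x u)"
    "norm (vel x u - fst saddle) \<le> sqrt (2 / \<mu>x * lyap x u)"
    using a v by (auto intro: real_le_rsqrt)
  ultimately have "norm (u - fst saddle) \<le> sqrt (2 / \<mu>x * lyap x u)"
    using norm_convex_le[OF t(1,2)] by simp
  then have "(norm (u - fst saddle))\<^sup>2 \<le> (sqrt (2 / \<mu>x * lyap x u))\<^sup>2"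
    by (rule power_mono) simp
  then show "(norm (u - fst saddle))\<^sup>2 \<le> 2 / \<mu>x * lyap x u" using nn \<mu> by simp
qed

text \<open>The quadratic growth of the proximal objective is tested at \<open>w\<close>, placed
  between \<open>x\<close> and the solution so that w - xn is -sqrt q times the error of the new
  velocity point. Since mux = q (mux + beta), the growth term becomes the velocity term of the new
  potential.\<close>

lemma catalyst_step:
  assumes x: "x \<in> X" and xn: "xn \<in> X" and \<eta>: "0 < \<eta>" "\<eta> < 1"
    and e: "P.primal u xn - (f (P.saddle u) + \<beta> / 2 * (norm (fst (P.saddle u) - u))\<^sup>2) \<le> e"
  shows "(1 - \<eta>) * lyap xn (xn + \<gamma> *\<^sub>R (xn - x)) \<le> (1 - sqrt q) * lyap x u + e / \<eta>"
proof -
  let ?s = "sqrt q" and ?xs = "fst saddle" and ?xk = "fst (P.saddle u)"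
  let ?Fs = "f (P.saddle u) + \<beta> / 2 * (norm (?xk - u))\<^sup>2" and ?m = "\<mu>x + \<beta>"
  let ?vn = "x + (1 / ?s) *\<^sub>R (xn - x)"
  have m0: "?m > 0" using \<mu> \<beta> by simp
  define w where "w = (1 - ?s) *\<^sub>R x + ?s *\<^sub>R ?xs"
  have wX: "w \<in> X" unfolding w_def
    using convexD_alt[OF X(2) x saddle_components(1)] sqrt_q by auto
  have e1: "?m / 2 * (norm (xn - ?xk))\<^sup>2 \<le> e" using P.primal_ge_saddle[OF xn, of u] e by linarith
  have A: "?Fs + ?m / 2 * (norm (w - ?xk))\<^sup>2 \<le> primal w + \<beta> / 2 * (norm (w - u))\<^sup>2"
    using P.primal_ge_saddle[OF wX, of u] unfolding P_primal[OF wX] by simp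
  have B: "primal w \<le> (1 - ?s) * primal x + ?s * f saddle - \<mu>x / 2 * ?s * (1 - ?s) * (norm (x - ?xs))\<^sup>2"
    unfolding w_def primal_saddle[symmetric]
    by (rule primal_convex[OF x saddle_components(1)]) (use sqrt_q in auto)
  have C: "\<mu>x / 2 * (norm (?vn - ?xs))\<^sup>2 = ?m / 2 * (norm (w - xn))\<^sup>2"
  proof -
    have "w - xn = - ?s *\<^sub>R (?vn - ?xs)" using sqrt_q by (simp add: w_def algebra_simps)
    then have "(norm (w - xn))\<^sup>2 = q * (norm (?vn - ?xs))\<^sup>2"
      using sqrt_q by (simp add: power_mult_distrib norm_minus_commute)
    then show ?thesis using q(3) by (simp add: mult_ac)
  qed
  \<comment> \<open>Replaces the exact proximal point by \<open>xn\<close>, whose distance to it is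
    bounded by \<open>e1\<close>. The loss (1/eta - 1) e and the e of \<open>H\<close> add up to e /
    eta.\<close>
  have D: "(1 - \<eta>) * (?m / 2 * (norm (w - xn))\<^sup>2) - (1 / \<eta> - 1) * e \<le> ?m / 2 * (norm (w - ?xk))\<^sup>2"
  proof -
    have "(1 / \<eta> - 1) * (?m / 2 * (norm (xn - ?xk))\<^sup>2) \<le> (1 / \<eta> - 1) * e"
      using \<eta> e1 by (intro mult_left_mono) (auto simp: field_simps)
    moreover have "?m / 2 * ((1 - \<eta>) * (norm (w - xn))\<^sup>2 - (1 / \<eta> - 1) * (norm (xn - ?xk))\<^sup>2)
        \<le> ?m / 2 * (norm (w - ?xk))\<^sup>2"
      by (rule mult_left_mono[OF norm_diff_sq_weighted_ge]) (use \<eta> m0 in auto)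
    ultimately show ?thesis by (simp add: right_diff_distrib mult.left_commute)
  qed
  \<comment> \<open>Here the momentum enters: u - x is s / (1 + s) times the velocity, and beta q =
    mux (1 - s)(1 + s) cancels the denominator. The term in |x - xs|^2 is the one gained from strong
    convexity in \<open>B\<close>.\<close>
  have E: "\<beta> / 2 * (norm (w - u))\<^sup>2 \<le> \<mu>x / 2 * ?s * (1 - ?s) * (norm (x - ?xs))\<^sup>2
      + (1 - ?s) * (\<mu>x / 2 * (norm (vel x u - ?xs))\<^sup>2)"
  proof -
    define a where "a = ?xs - x"
    define b where "b = vel x u - x"
    have u: "u - x = (?s / (1 + ?s)) *\<^sub>R b"
    proof -
      have "(?s / (1 + ?s)) *\<^sub>R b = (?s / (1 + ?s) * ((1 + ?s) / ?s)) *\<^sub>R (u - x)"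
        by (simp only: b_def vel_def add_diff_cancel_left' scaleR_scaleR)
      also have "?s / (1 + ?s) * ((1 + ?s) / ?s) = 1" using sqrt_q(1,5) by simp
      finally show ?thesis by simp
    qed
    have "w - u = ?s *\<^sub>R (a - (1 / (1 + ?s)) *\<^sub>R b)"
    proof -
      have "w - u = ?s *\<^sub>R a - (u - x)" by (simp add: w_def a_def algebra_simps)
      then show ?thesis unfolding u by (simp add: algebra_simps)
    qed
    then have wu: "(norm (w - u))\<^sup>2 = q * (norm (a - (1 / (1 + ?s)) *\<^sub>R b))\<^sup>2"
      using sqrt_q by (simp add: power_mult_distrib)
    have \<beta>q: "\<beta> * q = \<mu>x * ((1 - ?s) * (1 + ?s))"
    proof -
      have "\<beta> * q = \<mu>x * (1 - q)" using q(4) q(1) by (simp only: eq_divide_eq)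
      then show ?thesis using q(1) by (simp add: algebra_simps)
    qed
    have "(1 + ?s) * (norm (a - (1 / (1 + ?s)) *\<^sub>R b))\<^sup>2 - ?s * (norm a)\<^sup>2
        = (norm a)\<^sup>2 - 2 * (a \<bullet> b) + (norm b)\<^sup>2 / (1 + ?s)"
    proof -
      have "c * (norm (a - (1 / c) *\<^sub>R b))\<^sup>2 = c * (norm a)\<^sup>2 - 2 * (a \<bullet> b) + (norm b)\<^sup>2 / c"
        if "c > 0" for c
        using that unfolding power2_norm_eq_inner
        by (simp add: inner_diff inner_commute field_simps)
      from this[OF sqrt_q(5)] show ?thesis by (simp add: distrib_right)
    qed
    also have "\<dots> \<le> (norm a)\<^sup>2 - 2 * (a \<bullet> b) + (norm b)\<^sup>2"
      using sqrt_q by (simp add: divide_le_eq mult_left_mono algebra_simps)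
    also have "\<dots> = (norm (b - a))\<^sup>2"
      unfolding power2_norm_eq_inner by (simp add: inner_diff inner_commute)
    finally have F: "(1 + ?s) * (norm (a - (1 / (1 + ?s)) *\<^sub>R b))\<^sup>2 - ?s * (norm a)\<^sup>2 \<le> (norm (b - a))\<^sup>2" .
    have "\<beta> / 2 * (norm (w - u))\<^sup>2 = \<mu>x / 2 * (1 - ?s) * ((1 + ?s) * (norm (a - (1 / (1 + ?s)) *\<^sub>R b))\<^sup>2)"
      unfolding wu using \<beta>q by simp
    also have "\<dots> \<le> \<mu>x / 2 * (1 - ?s) * (?s * (norm a)\<^sup>2 + (norm (b - a))\<^sup>2)"
      using F \<mu> sqrt_q by (intro mult_left_mono) auto
    also have "\<dots> = \<mu>x / 2 * ?s * (1 - ?s) * (norm a)\<^sup>2 + (1 - ?s) * (\<mu>x / 2 * (norm (b - a))\<^sup>2)"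
      by (simp only: distrib_left mult_ac)
    also have "b - a = vel x u - ?xs" by (simp add: a_def b_def)
    finally show ?thesis unfolding a_def norm_minus_commute[of ?xs] .
  qed
  have G: "0 \<le> \<beta> / 2 * (norm (xn - u))\<^sup>2" using \<beta> by simp
  have H: "primal xn + \<beta> / 2 * (norm (xn - u))\<^sup>2 - ?Fs \<le> e" using e unfolding P_primal[OF xn] by simp
  have I: "primal xn - f saddle + (1 - \<eta>) * (\<mu>x / 2 * (norm (?vn - ?xs))\<^sup>2)
      \<le> (1 - ?s) * lyap x u + e / \<eta>"
  proof -
    have "(1 / \<eta> - 1) * e = e / \<eta> - e" by (simp add: algebra_simps)
    moreover have "(1 - ?s) * lyap x u = (1 - ?s) * primal x + ?s * f saddle - f saddle
        + (1 - ?s) * (\<mu>x / 2 * (norm (vel x u - ?xs))\<^sup>2)"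
      by (simp add: lyap_def algebra_simps)
    ultimately show ?thesis using A B D E G H unfolding C by linarith
  qed
  \<comment> \<open>In \<open>I\<close> only the velocity term carries 1 - eta; the excess eta times
    the primal gap is nonnegative and may be dropped.\<close>
  have "0 \<le> \<eta> * (primal xn - f saddle)"
    using primal_ge_saddle[OF xn] \<mu> \<eta>
    by (intro mult_nonneg_nonneg) (auto intro: order_trans[rotated])
  moreover have "(1 - \<eta>) * (a + b) = a - \<eta> * a + (1 - \<eta>) * b" for a b :: real
    by (simp add: algebra_simps)
  ultimately show ?thesis using I unfolding lyap_def[of xn] vel_update by simp
qed

text \<open>The dual value of the subproblem is compared with \<open>f\<close> at a point between \<open>x\<close> and the minimizer \<open>xh\<close>
  of \<open>f (_, y)\<close>; its weight \<open>t = \<mu>x / (2 * \<beta> + \<mu>x)\<close> makes strong convexity absorb the terms in \<open>xh - x\<close>.\<close>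

lemma prox_gap_to_gap:
  assumes x: "x \<in> X" and y: "y \<in> Y" and g: "P.primal u x - P.dual u y \<le> g"
  shows "primal x - dual y \<le> (1 + 2 * \<beta> / \<mu>x) * g + \<beta> * (2 * \<beta> + \<mu>x) / (2 * \<mu>x) * (norm (x - u))\<^sup>2"
proof -
  define w where "w = 2 * \<beta> + \<mu>x"
  have w: "w > 0" using \<beta> \<mu> by (simp add: w_def)
  define t where "t = \<mu>x / w"
  have t: "0 < t" "t \<le> 1" "1 - t = 2 * \<beta> / w" using \<beta> \<mu> w by (auto simp: t_def w_def field_simps)
  obtain xh where xh: "xh \<in> X" "dual y = f (xh, y)" using dual_attained[OF y] by metis
  define a where "a = x - u"
  define b where "b = xh - x"
  let ?w = "(1 - t) *\<^sub>R x + t *\<^sub>R xh"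
  have wX: "?w \<in> X" by (rule convex_x(1)[OF x xh(1) y less_imp_le[OF t(1)] t(2)])
  have "P.dual u y \<le> f (?w, y) + \<beta> / 2 * (norm (?w - u))\<^sup>2" using P.dual_lower[OF wX y, of u] by simp
  also have "f (?w, y) \<le> (1 - t) * f (x, y) + t * f (xh, y) - \<mu>x / 2 * t * (1 - t) * (norm (x - xh))\<^sup>2"
    by (rule convex_x(2)[OF x xh(1) y less_imp_le[OF t(1)] t(2)])
  also have "(1 - t) * f (x, y) \<le> (1 - t) * primal x"
    using t primal_upper[OF x y] by (intro mult_left_mono) auto
  also have "(norm (?w - u))\<^sup>2 = (norm a)\<^sup>2 + 2 * t * (a \<bullet> b) + t\<^sup>2 * (norm b)\<^sup>2"
  proof -
    have "?w - u = a + t *\<^sub>R b" by (simp add: a_def b_def algebra_simps)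
    then show ?thesis unfolding power2_norm_eq_inner
      by (simp add: inner_add inner_commute power2_eq_square algebra_simps)
  qed
  finally have "P.dual u y \<le> (1 - t) * primal x + t * dual y - \<mu>x / 2 * t * (1 - t) * (norm b)\<^sup>2
      + \<beta> / 2 * ((norm a)\<^sup>2 + 2 * t * (a \<bullet> b) + t\<^sup>2 * (norm b)\<^sup>2)"
    by (simp add: xh(2) b_def norm_minus_commute)
  then have "t * (primal x - dual y) \<le> g - \<mu>x / 2 * t * (1 - t) * (norm b)\<^sup>2
      + \<beta> / 2 * (2 * t * (a \<bullet> b) + t\<^sup>2 * (norm b)\<^sup>2)"
    using g unfolding P_primal[OF x] by (simp add: a_def algebra_simps)
  also have "\<dots> = t * (g / t + \<beta> * (a \<bullet> b) + (\<beta> * t / 2 - \<mu>x / 2 * (1 - t)) * (norm b)\<^sup>2)"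
    using t(1) by (simp add: power2_eq_square algebra_simps)
  finally have "primal x - dual y \<le> g / t + \<beta> * (a \<bullet> b) + (\<beta> * t / 2 - \<mu>x / 2 * (1 - t)) * (norm b)\<^sup>2"
    using t(1) by simp
  \<comment> \<open>By the choice of t, mux (1 - t) = 2 beta t. The remaining negative term is
    exactly what Young's inequality below produces in |b|^2.\<close>
  also have "\<beta> * t / 2 - \<mu>x / 2 * (1 - t) = - (\<beta> * (t / 2))"
    unfolding t(3) by (simp add: t_def field_simps)
  also have "\<beta> * (a \<bullet> b) \<le> \<beta> * (t / 2 * (norm b)\<^sup>2 + 1 / (2 * t) * (norm a)\<^sup>2)"
  proof (rule mult_left_mono[OF _ \<beta>])
    have "0 \<le> (norm (t *\<^sub>R b - a))\<^sup>2 / (2 * t)" using t by simp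
    also have "\<dots> = t / 2 * (norm b)\<^sup>2 + 1 / (2 * t) * (norm a)\<^sup>2 - a \<bullet> b"
      unfolding power2_norm_eq_inner using t(1)
      by (simp add: inner_diff inner_commute field_simps)
    finally show "a \<bullet> b \<le> t / 2 * (norm b)\<^sup>2 + 1 / (2 * t) * (norm a)\<^sup>2" by simp
  qed
  finally have "primal x - dual y \<le> g / t + \<beta> / (2 * t) * (norm a)\<^sup>2" by (simp add: algebra_simps)
  also have "g / t = (1 + 2 * \<beta> / \<mu>x) * g" using \<mu> w by (simp add: t_def w_def field_simps)
  also have "\<beta> / (2 * t) = \<beta> * (2 * \<beta> + \<mu>x) / (2 * \<mu>x)" using \<mu> w by (simp add: t_def w_def)
  finally show ?thesis by (simp add: a_def)
qed

text \<open>The fields for the two centres differ by a constant, so testing each variational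
  inequality with the other solution leaves only beta (u - u') against the difference of the saddle
  points.\<close>

lemma psaddle_lipschitz: "norm (psaddle u - psaddle u') \<le> (1 - q) * norm (u - u')"
proof -
  let ?z = "P.saddle u" and ?z' = "P.saddle u'" and ?m = "\<mu>x + \<beta>"
  have m0: "?m > 0" using \<mu> \<beta> by simp
  have "P.field u ?z' = P.field u' ?z' + (\<beta> *\<^sub>R (u' - u), 0)"
    by (rule prod_eqI)
       (simp_all add: P.field_def P.grad_def saddle_field_def avg_prox_grad[OF n] algebra_simps)
  then have "?m * (norm (?z - ?z'))\<^sup>2 \<le> (P.field u ?z - (P.field u' ?z' + (\<beta> *\<^sub>R (u' - u), 0))) \<bullet> (?z - ?z')"
    using P.field_mono[where u = u and m = ?m, OF P.saddle(1)[of u] P.saddle(1)[of u']] \<beta>_le by simp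
  also have "\<dots> \<le> - ((\<beta> *\<^sub>R (u' - u), 0) \<bullet> (?z - ?z'))"
    using P.saddle(2)[where u = u and z = ?z', OF P.saddle(1)]
      P.saddle(2)[where u = u' and z = ?z, OF P.saddle(1)]
    by (simp add: inner_diff inner_add)
  also have "\<dots> = (\<beta> *\<^sub>R (u - u'), 0) \<bullet> (?z - ?z')"
    by (simp add: inner_prod_def inner_diff algebra_simps)
  also have "\<dots> \<le> norm (\<beta> *\<^sub>R (u - u'), 0::'b) * norm (?z - ?z')" by (rule norm_cauchy_schwarz)
  also have "\<dots> = (\<beta> * norm (u - u')) * norm (?z - ?z')" using \<beta> by (simp add: norm_Pair)
  finally have *: "(?m * norm (?z - ?z')) * norm (?z - ?z') \<le> (\<beta> * norm (u - u')) * norm (?z - ?z')"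
    by (simp add: power2_eq_square mult.assoc)
  have "?m * norm (?z - ?z') \<le> \<beta> * norm (u - u')"
  proof (cases "?z = ?z'")
    case True
    then show ?thesis using \<beta> by simp
  next
    case False
    with * show ?thesis by (simp only: mult_le_cancel_right) simp
  qed
  then have "norm (?z - ?z') \<le> \<beta> / ?m * norm (u - u')" using m0 by (simp add: field_simps)
  then show ?thesis by (simp add: psaddle_def q(5))
qed

text \<open>The factor of \<open>proj_step_gap\<close> for a subproblem, whose constants are L +
  beta and mux + beta.\<close>

definition "gap_factor = 32 * sqrt n * (L + \<beta>) + 4 * (L + \<beta>)\<^sup>2 / (\<mu>x + \<beta>)"

lemma gap_factor_pos: "gap_factor > 0"
  using L \<mu> \<beta> n unfolding gap_factor_def by (intro add_pos_nonneg mult_pos_pos) auto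

lemma pstep_in: "pstep u \<tau> z \<in> X \<times> Y"
  unfolding pstep_def by (rule P.proj_step_in)

text \<open>The deterministic half of a stage, for a given output \<open>z\<close> of the inner
  solver. All bounds are linear in \<open>D\<close> and the two Lyapunov values, so that
  expectations can be taken termwise.\<close>

lemma pstep_bounds:
  assumes x: "x \<in> X" and z: "z \<in> X \<times> Y" and \<tau>: "\<tau> = 1 / (4 * sqrt n * (L + \<beta>))"
    and pn: "pstep u \<tau> z = (xn, yn)"
  defines "D \<equiv> (norm (z - psaddle u))\<^sup>2" and "un \<equiv> xn + \<gamma> *\<^sub>R (xn - x)"
  shows "(1 - sqrt q / 4) * lyap xn un \<le> (1 - sqrt q) * lyap x u + 4 / sqrt q * (gap_factor * D)"
    and "(norm ((xn, yn) - psaddle un))\<^sup>2 \<le> 4 * D + 32 * (1 - q)\<^sup>2 / \<mu>x * (lyap xn un + lyap x u)"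
    and "primal xn - dual yn \<le> 2 / q * (gap_factor * D) + 4 * (1 - q) / q\<^sup>2 * (lyap xn un + lyap x u)"
proof -
  have m: "\<mu>x + \<beta> > 0" using \<mu> \<beta> by simp
  have in_XY: "xn \<in> X" "yn \<in> Y" using pstep_in[of u \<tau> z] pn by auto
  have gap: "P.primal u xn - P.dual u yn \<le> gap_factor * D"
    and dist: "norm ((xn, yn) - psaddle u) \<le> 5 / 4 * norm (z - psaddle u)"
    using P.proj_step_gap[where u = u and m = "\<mu>x + \<beta>", OF z m order_refl \<beta>_le \<tau>] pn
    by (simp_all only: pstep_def psaddle_def gap_factor_def D_def fst_conv snd_conv)
  have e: "P.primal u xn - (f (P.saddle u) + \<beta> / 2 * (norm (fst (P.saddle u) - u))\<^sup>2) \<le> gap_factor * D"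
  proof -
    have "0 \<le> \<mu>y / 2 * (norm (yn - snd (P.saddle u)))\<^sup>2" using \<mu> by simp
    then show ?thesis using gap P.dual_le_saddle[OF in_XY(2), of u] by linarith
  qed
  have "0 < sqrt q / 4" "sqrt q / 4 < 1" using sqrt_q(1,2) by linarith+
  from catalyst_step[OF x in_XY(1) this e]
  have "(1 - sqrt q / 4) * lyap xn un \<le> (1 - sqrt q) * lyap x u + (gap_factor * D) / (sqrt q / 4)"
    unfolding un_def .
  then show "(1 - sqrt q / 4) * lyap xn un \<le> (1 - sqrt q) * lyap x u + 4 / sqrt q * (gap_factor * D)"
    by (simp add: mult_ac)
  define A where "A = sqrt (2 / \<mu>x * lyap xn un)"
  define B where "B = sqrt (2 / \<mu>x * lyap x u)"
  have nn: "0 \<le> lyap xn un" "0 \<le> lyap x u" using lyap_bounds(3) in_XY x by auto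
  have AB: "A\<^sup>2 + B\<^sup>2 = 2 / \<mu>x * (lyap xn un + lyap x u)" "0 \<le> A" "0 \<le> B"
    using nn \<mu> by (simp_all add: A_def B_def distrib_left)
  have n1: "norm (xn - fst saddle) \<le> A" "norm (x - fst saddle) \<le> B" "norm (u - fst saddle) \<le> B"
    unfolding A_def B_def using lyap_bounds in_XY x by (auto intro: real_le_rsqrt)
  \<comment> \<open>Relative to the solution, xn contributes A, gamma (xn - x) contributes A + B as
    gamma is at most 1, and u contributes B.\<close>
  have uu: "norm (un - u) \<le> 2 * (A + B)"
  proof -
    have "un - u = (xn - fst saddle) + \<gamma> *\<^sub>R ((xn - fst saddle) - (x - fst saddle)) - (u - fst saddle)"
      by (simp add: un_def)
    then have "norm (un - u) \<le> norm (xn - fst saddle)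
        + \<gamma> * norm ((xn - fst saddle) - (x - fst saddle)) + norm (u - fst saddle)"
      using norm_triangle_ineq4[of "(xn - fst saddle) + \<gamma> *\<^sub>R ((xn - fst saddle) - (x - fst saddle))" "u - fst saddle"]
        norm_triangle_ineq[of "xn - fst saddle" "\<gamma> *\<^sub>R ((xn - fst saddle) - (x - fst saddle))"] gamma
      by simp
    also have "\<gamma> * norm ((xn - fst saddle) - (x - fst saddle)) \<le> 1 * (A + B)"
      using gamma n1 norm_triangle_ineq4[of "xn - fst saddle" "x - fst saddle"]
      by (intro mult_mono) auto
    finally show ?thesis using n1 by simp
  qed
  have "norm ((xn, yn) - psaddle un) \<le> norm ((xn, yn) - psaddle u) + norm (psaddle un - psaddle u)"
    using norm_triangle_ineq4[of "(xn, yn) - psaddle u" "psaddle un - psaddle u"] by simp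
  also have "\<dots> \<le> 5 / 4 * norm (z - psaddle u) + (1 - q) * (2 * (A + B))"
    using q uu by (intro add_mono dist order_trans[OF psaddle_lipschitz] mult_left_mono) auto
  finally have "(norm ((xn, yn) - psaddle un))\<^sup>2 \<le> (5 / 4 * norm (z - psaddle u) + (1 - q) * (2 * (A + B)))\<^sup>2"
    by (rule power_mono) simp
  also have "\<dots> \<le> 2 * ((5 / 4 * norm (z - psaddle u))\<^sup>2 + ((1 - q) * (2 * (A + B)))\<^sup>2)"
    by (rule sum_power2_le)
  also have "\<dots> = 25 / 8 * D + 8 * (1 - q)\<^sup>2 * (A + B)\<^sup>2"
  proof -
    have "2 * ((5 / 4 * a)\<^sup>2 + (b * (2 * c))\<^sup>2) = 25 / 8 * a\<^sup>2 + 8 * b\<^sup>2 * c\<^sup>2" for a b c :: real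
      by (simp add: power2_eq_square)
    then show ?thesis unfolding D_def .
  qed
  also have "\<dots> \<le> 4 * D + 8 * (1 - q)\<^sup>2 * (2 * (A\<^sup>2 + B\<^sup>2))"
    by (intro add_mono mult_left_mono sum_power2_le) (simp_all add: D_def)
  also have "\<dots> = 4 * D + 32 * (1 - q)\<^sup>2 / \<mu>x * (lyap xn un + lyap x u)"
    unfolding AB(1) by simp
  finally show "(norm ((xn, yn) - psaddle un))\<^sup>2 \<le> 4 * D + 32 * (1 - q)\<^sup>2 / \<mu>x * (lyap xn un + lyap x u)" .
  \<comment> \<open>\<open>\<beta>\<close> is a hidden argument of \<open>q\<close>, so \<open>q(4)\<close> would loop as a rewrite rule\<close>
  define Q where "Q = q"
  note Q = q[folded Q_def]
  \<comment> \<open>With beta = mux (1 - q) / q the left side is (2 - q) / q.\<close>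
  have c1: "1 + 2 * \<beta> / \<mu>x \<le> 2 / q"
    unfolding Q_def[symmetric] unfolding Q(4) using \<mu> Q(1,2) by (simp add: field_simps)
  have c2: "\<beta> * (2 * \<beta> + \<mu>x) / (2 * \<mu>x) \<le> \<mu>x * (1 - q) / q\<^sup>2"
  proof -
    have "(2 * \<beta> + \<mu>x) / (2 * \<mu>x) \<le> 1 / q"
      using c1 \<mu> by (simp add: add_divide_distrib)
    then have "\<beta> * ((2 * \<beta> + \<mu>x) / (2 * \<mu>x)) \<le> \<beta> * (1 / q)" using \<beta> by (intro mult_left_mono) auto
    also have "\<beta> * (1 / q) = \<mu>x * (1 - q) / q\<^sup>2" 
      unfolding Q_def[symmetric] unfolding Q(4) by (simp add: power2_eq_square)
    finally show ?thesis by simp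
  qed
  have "primal xn - dual yn \<le> (1 + 2 * \<beta> / \<mu>x) * (gap_factor * D)
      + \<beta> * (2 * \<beta> + \<mu>x) / (2 * \<mu>x) * (norm (xn - u))\<^sup>2"
    by (rule prox_gap_to_gap[OF in_XY gap])
  also have "\<dots> \<le> 2 / q * (gap_factor * D) + \<mu>x * (1 - q) / q\<^sup>2 * (2 * (A\<^sup>2 + B\<^sup>2))"
  proof (intro add_mono mult_mono c1 c2 order_refl)
    have "norm (xn - u) \<le> A + B"
      using norm_triangle_ineq4[of "xn - fst saddle" "u - fst saddle"] n1 by simp
    then have "(norm (xn - u))\<^sup>2 \<le> (A + B)\<^sup>2" by (rule power_mono) simp
    then show "(norm (xn - u))\<^sup>2 \<le> 2 * (A\<^sup>2 + B\<^sup>2)" using sum_power2_le[of A B] by linarith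
  qed (use gap_factor_pos q(1,2) \<mu> in \<open>auto simp: D_def\<close>)
  also have "\<dots> = 2 / q * (gap_factor * D) + 4 * (1 - q) / q\<^sup>2 * (lyap xn un + lyap x u)"
  proof -
    have "\<mu>x * (1 - q) / q\<^sup>2 * (2 * (2 / \<mu>x * v)) = 4 * (1 - q) / q\<^sup>2 * v" for v
      using \<mu> by simp
    then show ?thesis unfolding AB(1) by (simp only:)
  qed
  finally show "primal xn - dual yn
    \<le> 2 / q * (gap_factor * D) + 4 * (1 - q) / q\<^sup>2 * (lyap xn un + lyap x u)" .
qed

section \<open>Expectations along the outer loop\<close>

abbreviation "inner_run \<tau> p T x y u \<equiv> lsvre n (\<lambda>i. prox_grad \<beta> u (fi' i)) (X \<times> Y) (x, y) \<tau> p T"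

abbreviation "outer_step \<tau> p T \<equiv> al_svre_step n fi' X Y \<beta> q p \<tau> T"

text \<open>Separates the random inner run from a deterministic map, so that expectations over a
  stage are expectations over the inner run.\<close>

lemma outer_step_eq:
  "outer_step \<tau> p T (x, y, u, c) = map_pmf (\<lambda>(z, c'). (fst (pstep u \<tau> z), snd (pstep u \<tau> z),
     fst (pstep u \<tau> z) + \<gamma> *\<^sub>R (fst (pstep u \<tau> z) - x), c + c' + n)) (inner_run \<tau> p T x y u)"
  by (simp add: al_svre_step_def Let_def map_pmf_def case_prod_unfold pstep_def P.proj_step_def
      P.grad_def \<gamma>_def)

definition "lyap_state = (\<lambda>(x, y, u, c :: nat). lyap x u)"
definition "dist_state = (\<lambda>(x, y, u, c :: nat). (norm ((x, y) - psaddle u))\<^sup>2)"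
definition "gap_state = (\<lambda>(x, y, u :: 'a, c :: nat). primal x - dual y)"
text \<open>The conditional expectation of the squared inner error given the state; as a function of
  the state it can be averaged over the outer run.\<close>

definition "inner_error \<tau> p T = (\<lambda>(x, y, u, c :: nat).
  measure_pmf.expectation (inner_run \<tau> p T x y u) (\<lambda>(z, c). (norm (z - psaddle u))\<^sup>2))"

lemma finite_outer_step: "finite (set_pmf (outer_step \<tau> p T \<sigma>))"
  by (cases \<sigma>) (simp add: outer_step_eq finite_imageI finite_set_lsvre[OF n])

lemma inner_error_le:
  assumes xy: "fst \<sigma> \<in> X" "fst (snd \<sigma>) \<in> Y"
    and \<tau>: "\<tau> = 1 / (4 * sqrt n * (L + \<beta>))" and p: "p = 1 / (2 * n)"
    and T: "real T \<ge> 4 * (n + 2 * sqrt n * (L + \<beta>) / (\<mu>x + \<beta>)) * ln R" and R: "R > 0"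
  shows "inner_error \<tau> p T \<sigma> \<le> 3 / R * dist_state \<sigma>"
proof -
  have m: "\<mu>x + \<beta> > 0" using \<mu> \<beta> by simp
  obtain x y u c where s: "\<sigma> = (x, y, u, c)" by (cases \<sigma>)
  have "(x, y) \<in> X \<times> Y" using xy s by simp
  from P.lsvre_convergence[where u = u, OF this m order_refl \<beta>_le \<tau> p T R] s
  show ?thesis by (simp add: inner_error_def dist_state_def psaddle_def)
qed

lemma outer_step_expectations:
  fixes \<sigma> :: "'a \<times> 'b \<times> 'a \<times> nat" and \<tau> p :: real and T :: nat
  assumes xy: "fst \<sigma> \<in> X" "fst (snd \<sigma>) \<in> Y" and \<tau>: "\<tau> = 1 / (4 * sqrt n * (L + \<beta>))"
  defines "E \<equiv> measure_pmf.expectation (outer_step \<tau> p T \<sigma>)"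
  shows "(1 - sqrt q / 4) * E lyap_state
      \<le> (1 - sqrt q) * lyap_state \<sigma> + 4 / sqrt q * (gap_factor * inner_error \<tau> p T \<sigma>)"
    and "E dist_state \<le> 4 * inner_error \<tau> p T \<sigma> + 32 * (1 - q)\<^sup>2 / \<mu>x * (E lyap_state + lyap_state \<sigma>)"
    and "E gap_state \<le> 2 / q * (gap_factor * inner_error \<tau> p T \<sigma>)
      + 4 * (1 - q) / q\<^sup>2 * (E lyap_state + lyap_state \<sigma>)"
proof -
  obtain x y u c where s: "\<sigma> = (x, y, u, c)" by (cases \<sigma>)
  let ?M = "inner_run \<tau> p T x y u"
  let ?D = "\<lambda>(z, c :: nat). (norm (z - psaddle u))\<^sup>2"
  let ?N = "\<lambda>(z, c'). (fst (pstep u \<tau> z), snd (pstep u \<tau> z),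
     fst (pstep u \<tau> z) + \<gamma> *\<^sub>R (fst (pstep u \<tau> z) - x), c + c' + n)"
  have x: "x \<in> X" and y: "y \<in> Y" using xy s by auto
  have E: "E F = measure_pmf.expectation ?M (\<lambda>zc. F (?N zc))" for F :: "_ \<Rightarrow> real"
    unfolding E_def s outer_step_eq by simp
  have fin: "finite (set_pmf ?M)" by (rule finite_set_lsvre[OF n])
  have ie: "inner_error \<tau> p T \<sigma> = measure_pmf.expectation ?M ?D" by (simp add: inner_error_def s)
  have mem: "fst zc \<in> X \<times> Y" if "zc \<in> set_pmf ?M" for zc
    using lsvre_in[OF Z(1), of "(x, y)" "fst zc" "snd zc"] that x y by simp
  have lin: "measure_pmf.expectation ?M (\<lambda>zc. a * ?D zc + b * (lyap_state (?N zc) + lyap x u))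
      = a * inner_error \<tau> p T \<sigma> + b * (E lyap_state + lyap_state \<sigma>)" for a b
  proof -
    have "measure_pmf.expectation ?M (\<lambda>zc. a * ?D zc + b * (lyap_state (?N zc) + lyap x u))
      = a * measure_pmf.expectation ?M ?D
        + b * (measure_pmf.expectation ?M (\<lambda>zc. lyap_state (?N zc)) + lyap x u)"
      by (simp add: expectation_add_finite[OF fin])
    then show ?thesis unfolding E ie by (simp add: s lyap_state_def)
  qed
  have B: "(1 - sqrt q / 4) * lyap_state (?N zc) \<le> 4 / sqrt q * gap_factor * ?D zc + (1 - sqrt q) * lyap x u"
      "dist_state (?N zc) \<le> 4 * ?D zc + 32 * (1 - q)\<^sup>2 / \<mu>x * (lyap_state (?N zc) + lyap x u)"
      "gap_state (?N zc) \<le> 2 / q * gap_factor * ?D zc + 4 * (1 - q) / q\<^sup>2 * (lyap_state (?N zc) + lyap x u)"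
    if "zc \<in> set_pmf ?M" for zc
    using pstep_bounds[OF x mem[OF that] \<tau> prod.collapse[symmetric], of u]
    by (simp_all add: lyap_state_def dist_state_def gap_state_def case_prod_unfold mult.assoc)
  have "(1 - sqrt q / 4) * E lyap_state
      = measure_pmf.expectation ?M (\<lambda>zc. (1 - sqrt q / 4) * lyap_state (?N zc))"
    unfolding E by simp
  also have "\<dots> \<le> measure_pmf.expectation ?M (\<lambda>zc. 4 / sqrt q * gap_factor * ?D zc + (1 - sqrt q) * lyap x u)"
    by (rule expectation_mono_finite[OF fin]) (rule B(1))
  also have "\<dots> = 4 / sqrt q * gap_factor * measure_pmf.expectation ?M ?D + (1 - sqrt q) * lyap x u"
    by (simp add: expectation_add_finite[OF fin])
  finally show "(1 - sqrt q / 4) * E lyap_state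
      \<le> (1 - sqrt q) * lyap_state \<sigma> + 4 / sqrt q * (gap_factor * inner_error \<tau> p T \<sigma>)"
    unfolding ie by (simp add: s lyap_state_def mult.assoc)
  have "E dist_state \<le> measure_pmf.expectation ?M
      (\<lambda>zc. 4 * ?D zc + 32 * (1 - q)\<^sup>2 / \<mu>x * (lyap_state (?N zc) + lyap x u))"
    unfolding E by (rule expectation_mono_finite[OF fin]) (rule B(2))
  then show "E dist_state \<le> 4 * inner_error \<tau> p T \<sigma> + 32 * (1 - q)\<^sup>2 / \<mu>x * (E lyap_state + lyap_state \<sigma>)"
    unfolding lin .
  have "E gap_state \<le> measure_pmf.expectation ?M
      (\<lambda>zc. 2 / q * gap_factor * ?D zc + 4 * (1 - q) / q\<^sup>2 * (lyap_state (?N zc) + lyap x u))"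
    unfolding E by (rule expectation_mono_finite[OF fin]) (rule B(3))
  then show "E gap_state \<le> 2 / q * (gap_factor * inner_error \<tau> p T \<sigma>)
      + 4 * (1 - q) / q\<^sup>2 * (E lyap_state + lyap_state \<sigma>)"
    unfolding lin by (simp add: mult.assoc)
qed

abbreviation "outer_run z0 \<tau> p T \<equiv> al_svre_run n fi' X Y z0 \<beta> q p (\<lambda>_. \<tau>) (\<lambda>_. T)"

lemma finite_outer_run: "finite (set_pmf (outer_run z0 \<tau> p T k))"
  by (induction k) (simp_all add: finite_outer_step)

lemma outer_run_in:
  assumes "z0 \<in> X \<times> Y" "\<sigma> \<in> set_pmf (outer_run z0 \<tau> p T k)"
  shows "fst \<sigma> \<in> X" "fst (snd \<sigma>) \<in> Y"
proof -
  have "fst \<sigma> \<in> X \<and> fst (snd \<sigma>) \<in> Y"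
  proof (cases k)
    case 0
    then show ?thesis using assms by auto
  next
    case (Suc j)
    then obtain x y u c where "\<sigma> \<in> set_pmf (outer_step \<tau> p T (x, y, u, c))" using assms by auto
    then obtain z where "fst \<sigma> = fst (pstep u \<tau> z)" "fst (snd \<sigma>) = snd (pstep u \<tau> z)"
      by (auto simp: outer_step_eq)
    then show ?thesis using pstep_in[of u \<tau> z] by (auto simp: mem_Times_iff)
  qed
  then show "fst \<sigma> \<in> X" "fst (snd \<sigma>) \<in> Y" by auto
qed

lemma expectation_outer_run_Suc:
  fixes F :: "_ \<Rightarrow> real"
  shows "measure_pmf.expectation (outer_run z0 \<tau> p T (Suc k)) F =
    measure_pmf.expectation (outer_run z0 \<tau> p T k) (\<lambda>\<sigma>. measure_pmf.expectation (outer_step \<tau> p T \<sigma>) F)"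
  unfolding al_svre_run.simps by (rule expectation_bind_finite[OF finite_outer_run finite_outer_step])

text \<open>At the start the velocity point is x0 itself, and each of the two summands is at most
  the initial gap.\<close>

lemma lyap_start:
  assumes "x0 \<in> X" "y0 \<in> Y" shows "lyap x0 x0 \<le> 2 * (primal x0 - dual y0)"
proof -
  have "0 \<le> \<mu>y / 2 * (norm (y0 - snd saddle))\<^sup>2" using \<mu> by simp
  moreover have "vel x0 x0 = x0" by (simp add: vel_def)
  ultimately show ?thesis
    using primal_ge_saddle[OF assms(1)] dual_le_saddle[OF assms(2)] by (simp add: lyap_def)
qed

text \<open>Centred at x0, the proximal term vanishes in the primal value and can only raise the
  dual value, so the gap of the subproblem is at most the original one.\<close>

lemma dist_start:
  assumes "x0 \<in> X" "y0 \<in> Y"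
  shows "(norm ((x0, y0) - psaddle x0))\<^sup>2 \<le> 2 * (primal x0 - dual y0) / (\<mu>x + \<beta>)"
proof -
  have m: "\<mu>x + \<beta> > 0" using \<mu> \<beta> by simp
  obtain x where x: "x \<in> X" "P.dual x0 y0 = f (x, y0) + \<beta> / 2 * (norm (x - x0))\<^sup>2"
    using P.dual_attained[OF assms(2), of x0] by auto
  have "0 \<le> \<beta> / 2 * (norm (x - x0))\<^sup>2" using \<beta> by simp
  then have "P.primal x0 x0 - P.dual x0 y0 \<le> primal x0 - dual y0"
    using dual_lower[OF x(1) assms(2)] x(2) unfolding P_primal[OF assms(1)] by simp
  then have "(\<mu>x + \<beta>) / 2 * (norm ((x0, y0) - psaddle x0))\<^sup>2 \<le> primal x0 - dual y0"
    using P.dist_saddle_le_gap[where u = x0, OF assms order_refl \<beta>_le] unfolding psaddle_def by linarith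
  then show ?thesis using m by (simp add: field_simps)
qed

text \<open>Stated for \<open>Suc k\<close> because the final gap needs the inner error of a last
  stage. The 1/8 is (2/q) Gamma delta relative to B; the 12 is 4 times the 3 bounding the sum of two
  consecutive Lyapunov values.\<close>

lemma outer_convergence:
  fixes x0 :: 'a and y0 :: 'b and p \<tau> B R :: real and T k :: nat
  assumes start: "x0 \<in> X" "y0 \<in> Y"
    and \<tau>: "\<tau> = 1 / (4 * sqrt n * (L + \<beta>))" and p: "p = 1 / (2 * n)"
    and T: "real T \<ge> 4 * (n + 2 * sqrt n * (L + \<beta>) / (\<mu>x + \<beta>)) * ln R" and R: "R > 0"
  defines "\<delta> \<equiv> q * B / (16 * gap_factor)" and "r \<equiv> 1 - sqrt q / 2"
  assumes B: "2 * (primal x0 - dual y0) \<le> B"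
    and c1: "2 * (primal x0 - dual y0) / (\<mu>x + \<beta>) \<le> R * \<delta> * r / 3"
    and c2: "4 * \<delta> + 3 * (32 * (1 - q)\<^sup>2 / \<mu>x) * B \<le> R * \<delta> * r / 3"
  shows "measure_pmf.expectation (outer_run (x0, y0) \<tau> p T (Suc k)) gap_state
    \<le> (1 / 8 + 12 * (1 - q) / q\<^sup>2) * B * r ^ Suc k"
proof -
  let ?E = "\<lambda>k. measure_pmf.expectation (outer_run (x0, y0) \<tau> p T k)"
  let ?S = "\<lambda>\<sigma>. measure_pmf.expectation (outer_step \<tau> p T \<sigma>)"
  let ?ie = "inner_error \<tau> p T"
  define a where "a k = ?E k lyap_state" for k
  define b where "b k = ?E k dist_state" for k
  define d where "d k = ?E k ?ie" for k
  have z0: "(x0, y0) \<in> X \<times> Y" using start by simp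
  note fin = finite_outer_run[of "(x0, y0)" p \<tau> T]
  note inX = outer_run_in[OF z0]
  have lin: "?E k (\<lambda>\<sigma>. u * ?ie \<sigma> + v * (?S \<sigma> lyap_state + lyap_state \<sigma>))
      = u * d k + v * (a (Suc k) + a k)" for u v k
    by (simp add: expectation_add_finite[OF fin] a_def d_def expectation_outer_run_Suc del: al_svre_run.simps)
  have B0: "0 \<le> B"
    using order_trans[OF lyap_start[OF start] B] lyap_bounds(3)[OF start(1), of x0] by linarith
  have sq: "(sqrt q)\<^sup>2 = q" by (rule sqrt_q)
  have Q0: "0 \<le> 32 * (1 - q)\<^sup>2 / \<mu>x" using \<mu> by simp
  have "0 < 1 - s / 2 \<and> 1 \<le> 2 * (1 - s / 2)" if "s \<le> 1" for s :: real using that by simp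
  from this[OF sqrt_q(2)] have r0: "0 < r" "1 \<le> 2 * r" by (simp_all add: r_def)
  have "a k \<le> B * r ^ k \<and> d k \<le> \<delta> * r ^ Suc k" for k
  proof (rule conjI)
    have dk: "d k \<le> 3 / R * b k" for k
    proof -
      have "d k \<le> ?E k (\<lambda>\<sigma>. 3 / R * dist_state \<sigma>)" unfolding d_def
        by (intro expectation_mono_finite[OF fin] inner_error_le[OF inX \<tau> p T R])
      then show ?thesis by (simp add: b_def)
    qed
    have ak: "(1 - sqrt q / 4) * a (Suc k) \<le> (1 - sqrt q) * a k + 4 / sqrt q * (gap_factor * d k)" for k
    proof -
      have "(1 - sqrt q / 4) * a (Suc k) = ?E k (\<lambda>\<sigma>. (1 - sqrt q / 4) * ?S \<sigma> lyap_state)"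
        by (simp add: a_def expectation_outer_run_Suc del: al_svre_run.simps)
      also have "\<dots> \<le> ?E k (\<lambda>\<sigma>. (1 - sqrt q) * lyap_state \<sigma> + 4 / sqrt q * (gap_factor * ?ie \<sigma>))"
        by (intro expectation_mono_finite[OF fin] outer_step_expectations(1)[OF inX \<tau>])
      also have "\<dots> = (1 - sqrt q) * a k + 4 / sqrt q * (gap_factor * d k)"
        by (simp add: expectation_add_finite[OF fin] a_def d_def)
      finally show ?thesis .
    qed
    have bk: "b (Suc k) \<le> 4 * d k + 32 * (1 - q)\<^sup>2 / \<mu>x * (a (Suc k) + a k)" for k
    proof -
      have "b (Suc k) = ?E k (\<lambda>\<sigma>. ?S \<sigma> dist_state)" by (simp only: b_def expectation_outer_run_Suc)
      also have "\<dots> \<le> ?E k (\<lambda>\<sigma>. 4 * ?ie \<sigma> + 32 * (1 - q)\<^sup>2 / \<mu>x * (?S \<sigma> lyap_state + lyap_state \<sigma>))"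
        by (intro expectation_mono_finite[OF fin] outer_step_expectations(2)[OF inX \<tau>])
      finally show ?thesis unfolding lin .
    qed
    have a0: "a 0 \<le> B" using lyap_start[OF start] B by (simp add: a_def lyap_state_def)
    have b0: "b 0 \<le> R * \<delta> * r / 3"
      using order_trans[OF dist_start[OF start] c1] by (simp add: b_def dist_state_def)
    note rec = linear_recursion_bound[OF sqrt_q(1,2) meta_eq_to_obj_eq[OF r_def] B0 gap_factor_pos R Q0, of d b a,
      unfolded sq, folded \<delta>_def, OF dk ak bk a0 b0 c2]
    show "a k \<le> B * r ^ k" "d k \<le> \<delta> * r ^ Suc k" by (rule rec)+
  qed
  then have ad: "a k \<le> B * r ^ k" "d k \<le> \<delta> * r ^ Suc k" for k by auto
  have "?E (Suc k) gap_state = ?E k (\<lambda>\<sigma>. ?S \<sigma> gap_state)" by (rule expectation_outer_run_Suc)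
  also have "\<dots> \<le> ?E k (\<lambda>\<sigma>. 2 / q * gap_factor * ?ie \<sigma>
      + 4 * (1 - q) / q\<^sup>2 * (?S \<sigma> lyap_state + lyap_state \<sigma>))"
    using outer_step_expectations(3)[OF inX \<tau>]
    by (intro expectation_mono_finite[OF fin]) (simp only: mult.assoc)
  also have "\<dots> = 2 / q * gap_factor * d k + 4 * (1 - q) / q\<^sup>2 * (a (Suc k) + a k)" by (rule lin)
  also have "\<dots> \<le> 2 / q * gap_factor * (\<delta> * r ^ Suc k) + 4 * (1 - q) / q\<^sup>2 * (3 * (B * r ^ Suc k))"
  proof (intro add_mono mult_left_mono ad(2))
    have "B * (1 * r ^ k) \<le> B * ((2 * r) * r ^ k)"
      using r0 B0 by (intro mult_left_mono mult_right_mono) auto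
    then show "a (Suc k) + a k \<le> 3 * (B * r ^ Suc k)" using ad(1)[of "Suc k"] ad(1)[of k] by simp
  qed (use q(1,2) gap_factor_pos in auto)
  also have "2 / q * gap_factor * (\<delta> * r ^ Suc k) = 1 / 8 * B * r ^ Suc k"
    using q(1) gap_factor_pos by (simp add: \<delta>_def)
  finally show ?thesis by (simp add: algebra_simps)
qed

text \<open>The \<open>2 * n\<close> consists of the full gradient that starts L-SVRE and the one
  for the final projections of the stage.\<close>

lemma outer_cost:
  fixes p :: real
  assumes p: "0 \<le> p" "p \<le> 1"
  shows "measure_pmf.expectation (outer_run z0 \<tau> p T k) (\<lambda>(x, y, u, c). real c)
    = k * (2 * n + T * (2 + p * n))"
proof (induction k)
  case (Suc k)
  have "measure_pmf.expectation (outer_step \<tau> p T \<sigma>) (\<lambda>(x, y, u, c). real c)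
      = (case \<sigma> of (x, y, u, c) \<Rightarrow> real c) + (2 * n + T * (2 + p * n))" for \<sigma>
  proof -
    obtain x y u c where s: "\<sigma> = (x, y, u, c)" by (cases \<sigma>)
    have "measure_pmf.expectation (outer_step \<tau> p T \<sigma>) (\<lambda>(x, y, u, c). real c)
        = measure_pmf.expectation (inner_run \<tau> p T x y u) (\<lambda>zc. (case zc of (z, c') \<Rightarrow> real c') + (real c + n))"
      unfolding s outer_step_eq by (simp add: case_prod_unfold algebra_simps)
    also have "\<dots> = (n + T * (2 + p * n)) + (real c + n)"
      by (simp add: expectation_add_finite[OF finite_set_lsvre[OF n]] expectation_lsvre_cost[OF n p])
    finally show ?thesis by (simp add: s)
  qed
  then have "measure_pmf.expectation (outer_run z0 \<tau> p T (Suc k)) (\<lambda>(x, y, u, c). real c) =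
    measure_pmf.expectation (outer_run z0 \<tau> p T k) (\<lambda>(x, y, u, c). real c) + (2 * n + T * (2 + p * n))"
    by (simp add: expectation_outer_run_Suc expectation_add_finite[OF finite_outer_run] del: al_svre_run.simps)
  then show ?case by (simp add: Suc algebra_simps)
qed simp

end

section \<open>The choice of the parameters\<close>

lemma ln_le_two_power:
  fixes c k :: nat and x y :: real
  assumes "x > 0" "y > 0" "x \<le> 2 ^ c * y ^ k"
  shows "ln x \<le> c + k * ln y"
proof -
  have "ln x \<le> ln (2 ^ c * y ^ k)" using assms by simp
  also have "\<dots> = c * ln 2 + k * ln y" using assms by (simp add: ln_mult ln_realpow)
  also have "\<dots> \<le> c * 1 + k * ln y"
    using mult_left_mono[OF less_imp_le[OF ln_2_less_1], of "real c"] by simp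
  finally show ?thesis by simp
qed

locale parameters =
  fixes n :: nat and L \<mu>x \<mu>y \<beta> q :: real
  assumes n: "n \<ge> 1" and \<mu>: "0 < \<mu>x" "\<mu>x < \<mu>y" "\<mu>y \<le> L"
    and \<beta>_def: "\<beta> = (if L / \<mu>y \<ge> sqrt n then \<mu>y - \<mu>x
                 else if L / \<mu>x > sqrt n then L / sqrt n - \<mu>x
                 else 0)"
    and q_def: "q = \<mu>x / (\<mu>x + \<beta>)"
begin

text \<open>\<open>\<Gamma>\<close> is the factor between the gap of a subproblem and the squared distance \<open>d\<^sup>2\<close>; \<open>S\<close> is the
  corresponding expression in the definition of the number of inner iterations.\<close>

definition "S = 7 * (L + \<beta>)\<^sup>2 / \<mu>y + 2 * sqrt n * (L + \<beta>)"
definition "\<Gamma> = 32 * sqrt n * (L + \<beta>) + 4 * (L + \<beta>)\<^sup>2 / (\<mu>x + \<beta>)"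
definition "r = 1 - sqrt q / 2"

lemma L: "L > 0" "\<mu>x < L" using \<mu> by auto

lemma sqrt_n: "sqrt n \<ge> 1" "sqrt n > 0" "sqrt n * sqrt n = n" "real n \<ge> 1" "sqrt n \<le> n"
proof -
  show "real n \<ge> 1" using n by simp
  then show 1: "sqrt n \<ge> 1" by simp
  then show "sqrt n > 0" using \<open>real n \<ge> 1\<close> by simp
  show 2: "sqrt n * sqrt n = n" by simp
  show "sqrt n \<le> n" using mult_left_mono[OF 1, of "sqrt n"] 1 2 by (simp del: real_sqrt_mult_self)
qed

definition "kx = L / \<mu>x"
definition "ky = L / \<mu>y"

lemma kappa: "kx \<ge> 1" "ky \<ge> 1" "0 \<le> kx" "0 \<le> ky"
  using \<mu> L by (auto simp: kx_def ky_def field_simps)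

lemma beta_cases:
  obtains (large) "ky \<ge> sqrt n" "\<beta> = \<mu>y - \<mu>x" "\<mu>x + \<beta> = \<mu>y"
  | (mid) "ky < sqrt n" "kx > sqrt n" "\<mu>x + \<beta> = L / sqrt n" "\<beta> = L / sqrt n - \<mu>x"
  | (small) "kx \<le> sqrt n" "\<beta> = 0"
proof (cases "ky \<ge> sqrt n")
  case True
  then show ?thesis using large \<beta>_def by (simp add: ky_def)
next
  case False
  then show ?thesis using mid small \<beta>_def
    by (cases "kx > sqrt n") (simp_all add: kx_def ky_def)
qed

lemma beta: "0 \<le> \<beta>" "\<mu>x + \<beta> \<le> \<mu>y" "\<mu>x + \<beta> \<le> L" "\<beta> \<le> L"
proof -
  have "0 \<le> \<beta> \<and> \<mu>x + \<beta> \<le> \<mu>y \<and> \<mu>x + \<beta> \<le> L"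
  proof (cases rule: beta_cases)
    case mid
    have "\<mu>x * sqrt n < L" "L < \<mu>y * sqrt n" using mid \<mu> by (simp_all add: kx_def ky_def field_simps)
    then have "\<mu>x < L / sqrt n" "L / sqrt n < \<mu>y" using sqrt_n(2) by (simp_all add: field_simps)
    with mid(3,4) \<mu> show ?thesis by auto
  qed (use \<mu> in auto)
  then show "0 \<le> \<beta>" "\<mu>x + \<beta> \<le> \<mu>y" "\<mu>x + \<beta> \<le> L" "\<beta> \<le> L" using \<mu> by auto
qed

lemma m: "\<mu>x + \<beta> > 0" "\<mu>x \<le> \<mu>x + \<beta>" using \<mu> beta by auto

lemma q: "0 < q" "q \<le> 1" "q * (\<mu>x + \<beta>) = \<mu>x" "1 / q \<le> kx"
  using \<mu> beta m by (auto simp: q_def kx_def divide_right_mono)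

lemma beta_q: "\<beta> / \<mu>x = (1 - q) / q"
proof -
  have "1 - q = \<beta> / (\<mu>x + \<beta>)" using m by (simp add: q_def field_simps)
  then show ?thesis using m \<mu> by (simp add: q_def)
qed

lemma r: "1 / 2 \<le> r" "r < 1" "0 < sqrt q" "sqrt q \<le> 1"
proof -
  show s: "0 < sqrt q" "sqrt q \<le> 1" using q by auto
  have "1 / 2 \<le> 1 - s / 2 \<and> 1 - s / 2 < 1" if "s \<le> 1" "0 < s" for s :: real using that by auto
  from this[OF s(2,1)] show "1 / 2 \<le> r" "r < 1" by (auto simp: r_def)
qed

lemma S_pos: "S > 0" "\<Gamma> > 0"
  using \<mu> L beta sqrt_n m unfolding S_def \<Gamma>_def
  by (auto intro!: add_nonneg_pos add_pos_nonneg)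

lemma S_ge: "S / \<mu>x \<ge> 7"
proof -
  have "\<mu>x * \<mu>y \<le> (L + \<beta>) * (L + \<beta>)" using \<mu> beta L by (intro mult_mono) auto
  then have "7 * \<mu>x \<le> 7 * (L + \<beta>)\<^sup>2 / \<mu>y" using \<mu> by (simp add: field_simps power2_eq_square)
  also have "\<dots> \<le> S" using beta L sqrt_n unfolding S_def by simp
  finally show ?thesis using \<mu> by (simp add: field_simps)
qed

text \<open>The quotient in \<open>\<Gamma>\<close> has denominator mux + beta, that in
  \<open>S\<close> has muy. In the \<open>large\<close> regime the two agree; in \<open>mid\<close>,
  L = sqrt(n) (mux + beta) turns the quotient into a multiple of sqrt(n) (L + beta). In
  \<open>small\<close>, q = 1 and the drift term, for which the comparison is made,
  vanishes.\<close>

lemma Gamma_le_S: "q = 1 \<or> \<Gamma> \<le> 20 * S"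
proof (cases rule: beta_cases)
  case large
  have "0 \<le> sqrt n * (L + \<beta>)" "0 \<le> (L + \<beta>)\<^sup>2 / \<mu>y" using \<mu> beta L sqrt_n by auto
  moreover have "32 * a + 4 * b \<le> 20 * (7 * b + 2 * a)" if "0 \<le> a" "0 \<le> b" for a b :: real
    using that by simp
  ultimately show ?thesis
    unfolding \<Gamma>_def S_def large(3) times_divide_eq_right[symmetric] mult.assoc by blast
next
  case mid
  have Lm: "L = sqrt n * (\<mu>x + \<beta>)" using mid(3) sqrt_n(2) by simp
  have "L + \<beta> \<le> 2 * L" using beta by simp
  also have "\<dots> = 2 * sqrt n * (\<mu>x + \<beta>)" by (subst Lm) simp
  finally have "L + \<beta> \<le> 2 * sqrt n * (\<mu>x + \<beta>)" .
  then have "(L + \<beta>) * (L + \<beta>) \<le> (2 * sqrt n * (\<mu>x + \<beta>)) * (L + \<beta>)"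
    using L beta by (intro mult_right_mono) auto
  then have "(L + \<beta>)\<^sup>2 / (\<mu>x + \<beta>) \<le> 2 * sqrt n * (L + \<beta>)"
    using m(1) by (simp add: pos_divide_le_eq power2_eq_square mult_ac)
  then have "4 * ((L + \<beta>)\<^sup>2 / (\<mu>x + \<beta>)) \<le> 8 * (sqrt n * (L + \<beta>))" by simp
  then have "\<Gamma> \<le> 32 * (sqrt n * (L + \<beta>)) + 8 * (sqrt n * (L + \<beta>))"
    unfolding \<Gamma>_def times_divide_eq_right[symmetric] mult.assoc by (rule add_left_mono)
  also have "\<dots> \<le> 20 * S" using \<mu> beta L by (simp add: S_def)
  finally show ?thesis by simp
qed (use \<mu> in \<open>simp add: q_def\<close>)

lemma Gamma_le: "\<Gamma> / \<mu>x \<le> 80 * (sqrt n * ky * kx ^ 3)"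
proof -
  have l: "L + \<beta> \<le> 2 * L" "0 \<le> L + \<beta>" using beta L by auto
  have "(L + \<beta>)\<^sup>2 \<le> (2 * L)\<^sup>2" using l by (intro power_mono) auto
  then have "(L + \<beta>)\<^sup>2 / (\<mu>x + \<beta>) \<le> (2 * L)\<^sup>2 / \<mu>x" using m \<mu> by (intro frac_le) auto
  moreover have "sqrt n * (L + \<beta>) \<le> sqrt n * (2 * L)" using l sqrt_n by (intro mult_left_mono) auto
  ultimately have "\<Gamma> \<le> 64 * (sqrt n * L) + 16 * (L\<^sup>2 / \<mu>x)"
    by (simp add: \<Gamma>_def power_mult_distrib)
  then have "\<Gamma> / \<mu>x \<le> (64 * (sqrt n * L) + 16 * (L\<^sup>2 / \<mu>x)) / \<mu>x"
    using \<mu> by (intro divide_right_mono) auto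
  also have "\<dots> = 64 * (sqrt n * kx) + 16 * kx ^ 2"
    by (simp add: kx_def add_divide_distrib power2_eq_square)
  also have "\<dots> \<le> 64 * (sqrt n * ky * kx ^ 3) + 16 * (sqrt n * ky * kx ^ 3)"
  proof (intro add_mono mult_left_mono)
    have "sqrt n * 1 * kx ^ 1 \<le> sqrt n * ky * kx ^ 3"
      using kappa sqrt_n by (intro mult_mono power_increasing order_refl) auto
    then show "sqrt n * kx \<le> sqrt n * ky * kx ^ 3" by simp
    have "1 * 1 * kx ^ 2 \<le> sqrt n * ky * kx ^ 3"
      using kappa sqrt_n by (intro mult_mono power_increasing order_refl) auto
    then show "kx ^ 2 \<le> sqrt n * ky * kx ^ 3" by simp
  qed auto
  finally show ?thesis by simp
qed

text \<open>The argument of the logarithm in T, rewritten with beta / mux = (1 - q) / q. Here 24 =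
  12 * 2 and 82944 = 12 * 1728 * 4, the 4 coming from (sqrt q - rho)^2 = q / 4.\<close>

definition "R = 24 / r + 82944 * ((1 - q) / q\<^sup>2 * (S / \<mu>x)) / r\<^sup>2"

lemma R_eq:
  assumes \<rho>: "\<rho> = 0.5 * sqrt q"
  shows "12 * (2 / (1 - \<rho>) + 1728 * \<beta> * (L + \<beta>) * (7 * (L + \<beta>) + 2 * sqrt n * \<mu>y) /
      (\<mu>x * \<mu>y * min \<mu>x \<mu>y * (1 - \<rho>)\<^sup>2 * (sqrt q - \<rho>)\<^sup>2)) = R"
proof -
  have 1: "1 - \<rho> = r" by (simp add: \<rho> r_def)
  have 2: "(sqrt q - \<rho>)\<^sup>2 = q / 4" using q by (simp add: \<rho> power_divide)
  have 3: "min \<mu>x \<mu>y = \<mu>x" using \<mu> by simp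
  have S: "(L + \<beta>) * (7 * (L + \<beta>) + 2 * sqrt n * \<mu>y) / \<mu>y = S"
    using \<mu> by (simp add: S_def field_simps power2_eq_square)
  have "1728 * \<beta> * (L + \<beta>) * (7 * (L + \<beta>) + 2 * sqrt n * \<mu>y) / (\<mu>x * \<mu>y * \<mu>x * r\<^sup>2 * (q / 4))
      = 6912 * (\<beta> / \<mu>x) * ((L + \<beta>) * (7 * (L + \<beta>) + 2 * sqrt n * \<mu>y) / \<mu>y) / (\<mu>x * q * r\<^sup>2)"
    using \<mu> q r by (simp add: field_simps)
  also have "\<dots> = 6912 * ((1 - q) / q\<^sup>2 * (S / \<mu>x)) / r\<^sup>2"
    unfolding S beta_q using \<mu> q r by (simp add: field_simps power2_eq_square)
  finally show ?thesis unfolding 1 2 3 by (simp add: R_def)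
qed

lemma weight: "0 \<le> (1 - q) / q\<^sup>2" "(1 - q) / q\<^sup>2 \<le> kx\<^sup>2"
  "0 \<le> (1 - q) / q\<^sup>2 * (S / \<mu>x)"
proof -
  show w: "0 \<le> (1 - q) / q\<^sup>2" using q by simp
  show "0 \<le> (1 - q) / q\<^sup>2 * (S / \<mu>x)"
    using S_pos \<mu> by (intro mult_nonneg_nonneg w) simp
  have "(1 - q) / q\<^sup>2 \<le> (1 / q)\<^sup>2" using q by (simp add: power_divide divide_right_mono)
  also have "\<dots> \<le> kx\<^sup>2" using q by (intro power_mono) auto
  finally show "(1 - q) / q\<^sup>2 \<le> kx\<^sup>2" .
qed

text \<open>The summands have separate duties in the recursion: the second absorbs the drift of the
  saddle point, the first the 12 that stems from \<open>4 * \<delta>\<close>.\<close>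

lemma R_ge: "24 + 82944 * ((1 - q) / q\<^sup>2 * (S / \<mu>x)) \<le> R * r" "24 \<le> R"
proof -
  let ?w = "(1 - q) / q\<^sup>2 * (S / \<mu>x)"
  have w: "0 \<le> ?w" by (rule weight)
  have "(a / r + b / r\<^sup>2) * r = a + b / r" for a b
    using r by (simp add: field_simps power2_eq_square)
  then have "R * r = 24 + 82944 * ?w / r" by (simp only: R_def)
  moreover have "82944 * ?w / 1 \<le> 82944 * ?w / r"
    using w r by (intro divide_left_mono) auto
  ultimately show A: "24 + 82944 * ?w \<le> R * r" by simp
  then have "24 \<le> R * r" using w by linarith
  also have "\<dots> \<le> R * 1"
  proof (rule mult_left_mono)
    have "0 \<le> R * r" using \<open>24 \<le> R * r\<close> by simp
    then show "0 \<le> R" using r(1) by (simp add: zero_le_mult_iff)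
  qed (use r in simp)
  finally show "24 \<le> R" by simp
qed

definition "W = 1 / 8 + 12 * (1 - q) / q\<^sup>2"

lemma W: "0 < W" "2 * W \<le> 10992 * (sqrt n * ky * kx ^ 3)" "192 * W \<le> R * r"
proof -
  let ?w = "(1 - q) / q\<^sup>2"
  have Ww: "W = 1 / 8 + 12 * ?w" by (simp add: W_def)
  show "0 < W" using weight(1) Ww by linarith
  have "1 * 1 * kx ^ 2 \<le> sqrt n * ky * kx ^ 3"
    using kappa sqrt_n by (intro mult_mono power_increasing order_refl) auto
  moreover have "1 \<le> kx ^ 2" using kappa by simp
  moreover have "2 * (1 / 8 + 12 * w) \<le> 10992 * k" if "w \<le> v" "1 * 1 * v \<le> k" "1 \<le> v" for w v k :: real
    using that by simp
  ultimately show "2 * W \<le> 10992 * (sqrt n * ky * kx ^ 3)"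
    unfolding Ww using weight(2) by blast
  have "?w * 7 \<le> ?w * (S / \<mu>x)" using S_ge weight by (intro mult_left_mono) auto
  then show "192 * W \<le> R * r" using R_ge(1) Ww weight(1) by linarith
qed

text \<open>With this \<open>B\<close> the final gap is at most \<open>W * B * r ^ K\<close>, in which \<open>W\<close> cancels and the constant
  in the logarithm of \<open>K\<close> remains.\<close>

lemma recursion_constants:
  fixes \<Delta> :: real
  assumes \<Delta>: "\<Delta> \<ge> 0"
  defines "B \<equiv> 10992 * (sqrt n * ky * kx ^ 3) * \<Delta> / W"
  defines "\<delta> \<equiv> q * B / (16 * \<Gamma>)"
  shows "2 * \<Delta> \<le> B" and "2 * \<Delta> / (\<mu>x + \<beta>) \<le> R * \<delta> * r / 3"
    and "4 * \<delta> + 3 * (32 * (1 - q)\<^sup>2 / \<mu>x) * B \<le> R * \<delta> * r / 3"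
proof -
  let ?k = "sqrt n * ky * kx ^ 3"
  have k0: "?k \<ge> 0" by (intro mult_nonneg_nonneg zero_le_power kappa) simp
  have "(2 * W) * \<Delta> \<le> (10992 * ?k) * \<Delta>" using W(2) \<Delta> by (intro mult_right_mono)
  then show B2: "2 * \<Delta> \<le> B" using W(1) unfolding B_def by (simp add: pos_le_divide_eq mult_ac)
  have B0: "B \<ge> 0" using B2 \<Delta> by linarith
  have BW: "W * B = 10992 * ?k * \<Delta>" using W(1) unfolding B_def by simp
  have Rd: "R * \<delta> * r / 3 = (R * r) * (q * B) / (48 * \<Gamma>)" by (simp add: \<delta>_def)
  show "2 * \<Delta> / (\<mu>x + \<beta>) \<le> R * \<delta> * r / 3"
  proof -
    \<comment> \<open>Cleared of denominators, the claim bounds 96 Gamma Delta by R r mux B; W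
      cancels against B through 192 W <= R r.\<close>
    have "96 * \<Gamma> * \<Delta> \<le> 96 * (\<mu>x * (80 * ?k)) * \<Delta>"
      using Gamma_le \<mu> \<Delta> by (intro mult_right_mono mult_left_mono) (auto simp: field_simps)
    also have "\<dots> = \<mu>x * (7680 * (?k * \<Delta>))" by simp
    also have "\<dots> \<le> \<mu>x * (192 * (10992 * (?k * \<Delta>)))"
      using k0 \<Delta> \<mu> by (intro mult_left_mono) auto
    also have "\<dots> = \<mu>x * (192 * (W * B))" unfolding BW by simp
    also have "\<dots> = \<mu>x * ((192 * W) * B)" by simp
    also have "\<dots> \<le> \<mu>x * ((R * r) * B)" using W(3) B0 \<mu> by (intro mult_left_mono mult_right_mono) auto
    also have "\<dots> = (q * (\<mu>x + \<beta>)) * ((R * r) * B)" unfolding q(3) ..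
    finally have "96 * \<Gamma> * \<Delta> \<le> ((R * r) * (q * B)) * (\<mu>x + \<beta>)" by (simp add: mult_ac)
    then show ?thesis unfolding Rd using m(1) S_pos(2) by (simp add: field_simps)
  qed
  show "4 * \<delta> + 3 * (32 * (1 - q)\<^sup>2 / \<mu>x) * B \<le> R * \<delta> * r / 3"
  proof -
    let ?w = "(1 - q) / q\<^sup>2 * (S / \<mu>x)"
    \<comment> \<open>4608 = 3 * 32 * 48, after division by q B / (48 Gamma). The bounds Gamma <= 20
      S and q (1 - q) <= 1/4 reduce the coefficient to 23040.\<close>
    have key: "4608 * \<Gamma> * (1 - q)\<^sup>2 / (\<mu>x * q) \<le> 82944 * ?w"
    proof (cases "q = 1")
      case False
      then have "4608 * \<Gamma> * (1 - q)\<^sup>2 / (\<mu>x * q) \<le> 4608 * (20 * S) * (1 - q)\<^sup>2 / (\<mu>x * q)"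
        using Gamma_le_S \<mu> q by (intro divide_right_mono mult_right_mono mult_left_mono) auto
      also have "\<dots> = 92160 * ((1 - q) * q) * ?w"
        using q(1) \<mu> by (simp add: field_simps power2_eq_square)
      also have "\<dots> \<le> 92160 * (1 / 4) * ?w"
      proof (intro mult_right_mono mult_left_mono)
        have "0 \<le> (2 * q - 1)\<^sup>2" by simp
        then show "(1 - q) * q \<le> 1 / 4" by (simp add: power2_eq_square algebra_simps)
        show "0 \<le> ?w" by (rule weight)
      qed simp
      also have "\<dots> \<le> 82944 * ?w" by (intro mult_right_mono weight) simp
      finally show ?thesis .
    qed simp
    have "4 * \<delta> + 3 * (32 * (1 - q)\<^sup>2 / \<mu>x) * B
        = (12 + 4608 * \<Gamma> * (1 - q)\<^sup>2 / (\<mu>x * q)) * ((q * B) / (48 * \<Gamma>))"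
      using S_pos(2) q(1) \<mu> by (simp add: \<delta>_def field_simps)
    also have "\<dots> \<le> (R * r) * ((q * B) / (48 * \<Gamma>))"
      using key R_ge(1) q B0 S_pos by (intro mult_right_mono) auto
    finally show ?thesis unfolding Rd by simp
  qed
qed

text \<open>A polynomial bound suffices under the logarithm: R is at most 2^24 (n kx)^4, and 28 = 24
  + 4.\<close>

lemma ln_R_le: "ln R \<le> 28 * max 1 (ln (n * kx))"
proof -
  have nk: "1 \<le> n * kx" using mult_mono[OF sqrt_n(4) kappa(1)] by simp
  have l: "L + \<beta> \<le> 2 * L" "0 \<le> L + \<beta>" using beta L by auto
  have kyx: "ky \<le> kx" using \<mu> L unfolding kx_def ky_def by (intro divide_left_mono) auto
  have "(L + \<beta>)\<^sup>2 \<le> (2 * L)\<^sup>2" using l by (intro power_mono) auto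
  then have "7 * (L + \<beta>)\<^sup>2 / \<mu>y \<le> 7 * (2 * L)\<^sup>2 / \<mu>y" using \<mu> by (intro divide_right_mono) auto
  also have "\<dots> = 28 * (L * ky)" by (simp add: ky_def power2_eq_square)
  finally have 1: "7 * (L + \<beta>)\<^sup>2 / \<mu>y \<le> 28 * (L * ky)" .
  have "2 * sqrt n * (L + \<beta>) \<le> 2 * n * (2 * L)" using l sqrt_n by (intro mult_mono) auto
  then have 2: "2 * sqrt n * (L + \<beta>) \<le> 4 * (n * L)" by simp
  from 1 2 have "S \<le> 28 * (L * ky) + 4 * (n * L)" unfolding S_def by (rule add_mono)
  also have "\<dots> \<le> 28 * (n * (L * kx)) + 4 * (n * (L * kx))"
  proof (intro add_mono mult_left_mono)
    have "1 * (L * ky) \<le> n * (L * kx)" using kyx sqrt_n L kappa by (intro mult_mono) auto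
    then show "L * ky \<le> n * (L * kx)" by simp
    show "L \<le> L * kx" using kappa L mult_left_mono[of 1 kx L] by simp
  qed auto
  finally have "S / \<mu>x \<le> (28 * (n * (L * kx)) + 4 * (n * (L * kx))) / \<mu>x"
    using \<mu> by (intro divide_right_mono) auto
  also have "\<dots> = 32 * (n * kx\<^sup>2)" by (simp add: kx_def power2_eq_square)
  finally have S: "S / \<mu>x \<le> 32 * (n * kx\<^sup>2)" .
  have "(1 - q) / q\<^sup>2 * (S / \<mu>x) \<le> kx\<^sup>2 * (32 * (n * kx\<^sup>2))"
    using weight S S_pos \<mu> by (intro mult_mono) auto
  also have "\<dots> = 32 * (real n ^ 1 * kx ^ 4)" by (simp add: power2_eq_square power4_eq_xxxx)
  also have "\<dots> \<le> 32 * (real n ^ 4 * kx ^ 4)"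
    using sqrt_n kappa by (intro mult_left_mono mult_right_mono power_increasing) auto
  also have "\<dots> = 32 * (n * kx) ^ 4" by (simp add: power_mult_distrib)
  finally have w: "(1 - q) / q\<^sup>2 * (S / \<mu>x) \<le> 32 * (n * kx) ^ 4" .
  note w0 = weight(3)
  have "1 / 4 \<le> r\<^sup>2" using power_mono[OF r(1), of 2] by (simp add: power_divide)
  then have "82944 * ((1 - q) / q\<^sup>2 * (S / \<mu>x)) / r\<^sup>2 \<le> 82944 * ((1 - q) / q\<^sup>2 * (S / \<mu>x)) / (1 / 4)"
    using w0 by (intro divide_left_mono) auto
  moreover have "24 / r \<le> 24 / (1 / 2)" using r by (intro divide_left_mono) auto
  ultimately have "R \<le> 48 + 331776 * (32 * (n * kx) ^ 4)" using w by (simp add: R_def)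
  also have "\<dots> \<le> 2 ^ 24 * (n * kx) ^ 4"
    using one_le_power[OF nk, of 4] by simp
  finally have "ln R \<le> real 24 + real 4 * ln (n * kx)"
    using R_ge(2) nk by (intro ln_le_two_power) auto
  then show ?thesis by (simp add: max_def)
qed

text \<open>Bounds the factor of 4 ln R in T, with L + beta replaced by 2 L.\<close>

definition "G = n + 4 * sqrt n * L / (\<mu>x + \<beta>)"

text \<open>Inner cost times number of stages, and the place where the choice of beta yields the
  rate. In \<open>large\<close>, G <= 5 sqrt(n) ky and 1/q = kx / ky; in \<open>mid\<close>, G = 5 n
  and 1/q = kx / sqrt(n); in \<open>small\<close>, G <= 5 n and q = 1.\<close>

lemma G_bound: "G / sqrt q \<le> 5 * sqrt (n * (sqrt n + kx) * (sqrt n + ky))"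
proof -
  have "G\<^sup>2 / q \<le> 25 * (n * (sqrt n + kx) * (sqrt n + ky))"
  proof (cases rule: beta_cases)
    case large
    have "n \<le> sqrt n * ky" using mult_left_mono[OF large(1), of "sqrt n"] sqrt_n(3) by simp
    then have G: "0 \<le> G" "G \<le> 5 * (sqrt n * ky)"
    proof -
      have "G = n + 4 * (sqrt n * ky)" by (simp add: G_def large(3) ky_def)
      then show "0 \<le> G" "G \<le> 5 * (sqrt n * ky)"
        using \<open>n \<le> sqrt n * ky\<close> kappa by simp_all
    qed
    have "G\<^sup>2 \<le> (5 * (sqrt n * ky))\<^sup>2" by (intro power_mono G)
    then have "G\<^sup>2 / q \<le> (5 * (sqrt n * ky))\<^sup>2 / q" using q by (intro divide_right_mono) auto
    also have "\<dots> = 25 * (n * ky * (ky / q))" by (simp add: power_mult_distrib power2_eq_square)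
    also have "ky / q = kx" using \<mu> unfolding q_def large(3) by (simp add: kx_def ky_def)
    also have "n * ky * kx = n * kx * ky" by simp
    also have "25 * \<dots> \<le> 25 * (n * (sqrt n + kx) * (sqrt n + ky))"
      using kappa sqrt_n by (intro mult_left_mono mult_mono) auto
    finally show ?thesis .
  next
    case mid
    have "sqrt n * L / (\<mu>x + \<beta>) = n" unfolding mid(3) using L sqrt_n by simp
    then have G: "G = 5 * n" by (simp add: G_def)
    have "1 / q = kx / sqrt n" unfolding q_def mid(3) by (simp add: kx_def)
    then have "G\<^sup>2 / q = (5 * n)\<^sup>2 * (kx / sqrt n)" unfolding G by (simp add: divide_inverse)
    also have "\<dots> = 25 * (n * kx * (n / sqrt n))" by (simp add: power2_eq_square)
    also have "n / sqrt n = sqrt n" by (rule real_div_sqrt) simp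
    also have "25 * (n * kx * sqrt n) \<le> 25 * (n * (sqrt n + kx) * (sqrt n + ky))"
      using kappa sqrt_n by (intro mult_left_mono mult_mono) auto
    finally show ?thesis .
  next
    case small
    have "sqrt n * kx \<le> n" using mult_left_mono[OF small(1), of "sqrt n"] sqrt_n(3) by simp
    then have G: "0 \<le> G" "G \<le> 5 * n"
    proof -
      have "G = n + 4 * (sqrt n * kx)" unfolding G_def kx_def using small(2) by simp
      then show "0 \<le> G" "G \<le> 5 * n" using \<open>sqrt n * kx \<le> n\<close> kappa by simp_all
    qed
    have q1: "q = 1" using small \<mu> by (simp add: q_def)
    have "G\<^sup>2 / q \<le> (5 * n)\<^sup>2" unfolding q1 using power_mono[OF G(2,1), of 2] by simp
    also have "\<dots> = 25 * (n * sqrt n * sqrt n)" by (simp add: power2_eq_square)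
    also have "\<dots> \<le> 25 * (n * (sqrt n + kx) * (sqrt n + ky))"
      using kappa sqrt_n by (intro mult_left_mono mult_mono) auto
    finally show ?thesis .
  qed
  then have "(G / sqrt q)\<^sup>2 \<le> (5 * sqrt (n * (sqrt n + kx) * (sqrt n + ky)))\<^sup>2"
    using q kappa sqrt_n by (simp add: power_divide power_mult_distrib)
  then show ?thesis by (rule power2_le_imp_le) (use kappa sqrt_n in auto)
qed

text \<open>5/2 is 2 + p n, the expected cost of an inner iteration; 285 rounds up 2 + 5/2 * 113,
  where 113 is 4 * 28 plus 1 for the ceiling.\<close>

lemma T_bound:
  assumes T: "T = nat \<lceil>4 * (n + 2 * sqrt n * (L + \<beta>) / (\<mu>x + \<beta>)) * ln R\<rceil>"
  shows "real T \<ge> 4 * (n + 2 * sqrt n * (L + \<beta>) / (\<mu>x + \<beta>)) * ln R"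
    and "2 * n + 5 / 2 * real T \<le> 285 * (G * max 1 (ln (n * kx)))"
proof -
  let ?M = "max 1 (ln (n * kx))" and ?c = "n + 2 * sqrt n * (L + \<beta>) / (\<mu>x + \<beta>)"
  have M: "1 \<le> ?M" by simp
  have lR: "0 \<le> ln R" using R_ge by simp
  have c0: "0 \<le> 2 * sqrt n * (L + \<beta>) / (\<mu>x + \<beta>)" using m L beta by simp
  then have c: "0 \<le> ?c" by linarith
  then have x0: "0 \<le> 4 * ?c * ln R" using lR by simp
  show "4 * ?c * ln R \<le> real T" unfolding T by (rule real_nat_ceiling_ge)
  have cG: "?c \<le> G"
  proof -
    have "2 * sqrt n * (L + \<beta>) \<le> 2 * sqrt n * (2 * L)" using beta by (intro mult_left_mono) auto
    then have "2 * sqrt n * (L + \<beta>) / (\<mu>x + \<beta>) \<le> 2 * sqrt n * (2 * L) / (\<mu>x + \<beta>)"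
      using m by (intro divide_right_mono) auto
    then show ?thesis by (simp add: G_def)
  qed
  have nG: "real n \<le> G" using m L by (simp add: G_def)
  then have G1: "1 \<le> G" using sqrt_n by linarith
  have GM: "1 \<le> G * ?M" "G \<le> G * ?M"
    using mult_mono[OF G1 M] G1 mult_left_mono[OF M, of G] by auto
  have "real T \<le> 4 * ?c * ln R + 1" unfolding T using x0 by linarith
  also have "4 * ?c * ln R \<le> 4 * G * (28 * ?M)"
    using cG c lR ln_R_le by (intro mult_mono) auto
  finally have "real T \<le> 112 * (G * ?M) + 1" by simp
  then show "2 * n + 5 / 2 * real T \<le> 285 * (G * ?M)" using GM nG by linarith
qed

text \<open>\<open>\<epsilon> \<le> \<Delta>\<close> puts all factors under the logarithm at 1 or
  above, so the argument in K is at most 2^14 times the cube of the target's, and its logarithm is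
  nonnegative. Then 17 = 14 + 3, and 35 = 2 * 17 + 1 with 1 for the ceiling.\<close>

lemma K_bound:
  fixes \<Delta> \<epsilon> :: real
  assumes e: "0 < \<epsilon>" "\<epsilon> \<le> \<Delta>"
    and K: "K = nat \<lceil>2 / sqrt q * ln (10992 * sqrt n * \<Delta> * ky * kx ^ 3 / \<epsilon>)\<rceil>"
  shows "real K \<le> 35 * max 1 (ln (n * \<Delta> * ky * kx / \<epsilon>)) / sqrt q"
proof -
  define d where "d = \<Delta> / \<epsilon>"
  let ?N = "max 1 (ln (n * \<Delta> * ky * kx / \<epsilon>))" and ?A = "10992 * sqrt n * \<Delta> * ky * kx ^ 3 / \<epsilon>"
  have d: "1 \<le> d" using e by (simp add: d_def)
  have A: "?A = 10992 * (sqrt n * d * ky * kx ^ 3)" by (simp add: d_def)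
  have "sqrt n * d * ky * kx ^ 3 \<le> real n ^ 3 * d ^ 3 * ky ^ 3 * kx ^ 3"
  proof -
    have "sqrt n \<le> real n ^ 3" using order_trans[OF sqrt_n(5) self_le_power[of "real n" 3]] sqrt_n by simp
    then show ?thesis using sqrt_n d kappa
      by (intro mult_mono self_le_power) auto
  qed
  also have "\<dots> = (n * d * ky * kx) ^ 3" by (simp only: power_mult_distrib)
  finally have A0: "sqrt n * d * ky * kx ^ 3 \<le> (n * d * ky * kx) ^ 3" .
  have A2: "?A \<le> 2 ^ 14 * (n * d * ky * kx) ^ 3" unfolding A
  proof (rule mult_mono)
    have "0 \<le> d" using d by linarith
    then show "0 \<le> sqrt n * d * ky * kx ^ 3" by (intro mult_nonneg_nonneg zero_le_power kappa) simp_all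
  qed (use A0 in simp_all)
  have A1: "1 \<le> ?A"
  proof -
    have "1 * 1 * 1 * 1 ^ 3 \<le> sqrt n * d * ky * kx ^ 3"
      using sqrt_n d kappa by (intro mult_mono power_mono) auto
    then show ?thesis unfolding A by simp
  qed
  have "0 < n * d * ky * kx" using sqrt_n d kappa e by (intro mult_pos_pos) auto
  then have "ln ?A \<le> real 14 + real 3 * ln (n * d * ky * kx)"
    using A1 A2 by (intro ln_le_two_power) auto
  then have lA: "ln ?A \<le> 17 * ?N" by (simp add: d_def max_def mult_ac)
  have x0: "0 \<le> 2 / sqrt q * ln ?A" using A1 r q by simp
  have "real K \<le> 2 / sqrt q * ln ?A + 1" unfolding K using x0 by linarith
  also have "2 / sqrt q * ln ?A \<le> 2 / sqrt q * (17 * ?N)" using lA q by (intro mult_left_mono) auto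
  finally have 1: "real K \<le> 2 / sqrt q * (17 * ?N) + 1" by simp
  have 2: "1 \<le> ?N / sqrt q"
    using order_trans[OF r(4) max.cobounded1] r(3) by (simp add: pos_le_divide_eq del: max.bounded_iff)
  have "2 / s * (17 * N) + 1 \<le> 35 * N / s" if "1 \<le> N / s" for N s :: real using that by simp
  from order_trans[OF 1 this[OF 2]] show ?thesis .
qed

end

theorem corollary1:
  fixes X :: "'a::euclidean_space set" and Y :: "'b::euclidean_space set"
    and n K :: nat
    and fi :: "nat \<Rightarrow> 'a \<times> 'b \<Rightarrow> real" and fi' :: "nat \<Rightarrow> 'a \<times> 'b \<Rightarrow> 'a \<times> 'b"
    and f :: "'a \<times> 'b \<Rightarrow> real"
    and x0 :: 'a and y0 :: 'b
    and L \<mu>x \<mu>y \<kappa>x \<kappa>y \<Delta>f \<epsilon> \<beta> q \<rho> p :: real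
    and \<tau> :: "nat \<Rightarrow> real" and T :: "nat \<Rightarrow> nat"
  assumes X: "closed X" "convex X" and Y: "closed Y" "convex Y"
    and start: "x0 \<in> X" "y0 \<in> Y"
    and n: "n \<ge> 1"
    and grad: "\<And>i. i \<in> {1..n} \<Longrightarrow> gradient_on (X \<times> Y) (fi i) (fi' i)"
    and convex_x: "\<And>i y. i \<in> {1..n} \<Longrightarrow> y \<in> Y \<Longrightarrow> convex_on X (\<lambda>x. fi i (x, y))"
    and concave_y: "\<And>i x. i \<in> {1..n} \<Longrightarrow> x \<in> X \<Longrightarrow> concave_on Y (\<lambda>y. fi i (x, y))"
    and L: "L > 0"
    and smooth: "average_smooth n fi' (X \<times> Y) L"
    and f: "f = (\<lambda>z. avg n (\<lambda>i. fi i z))"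
    and \<mu>: "0 < \<mu>x" "\<mu>x < \<mu>y"
    and f_cc: "convex_concave \<mu>x \<mu>y X Y f"
    \<comment> \<open>\<open>\<mu>y \<le> L\<close> follows from the other assumptions unless \<open>Y\<close> is a single point\<close>
    and degenerate: "Y = {y0} \<Longrightarrow> \<mu>y \<le> L"
    and \<kappa>x: "\<kappa>x = L / \<mu>x" and \<kappa>y: "\<kappa>y = L / \<mu>y"
    and \<Delta>f: "\<Delta>f = duality_gap f X Y x0 y0"
    and \<epsilon>: "\<epsilon> > 0"
    and \<beta>: "\<beta> = (if \<kappa>y \<ge> sqrt n then \<mu>y - \<mu>x
                 else if \<kappa>x > sqrt n then L / sqrt n - \<mu>x
                 else 0)"
    and q: "q = \<mu>x / (\<mu>x + \<beta>)"
    and \<rho>: "\<rho> = 0.5 * sqrt q"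
    and p: "p = 1 / (2 * n)"
    and \<tau>: "\<And>k. \<tau> k = 1 / (4 * sqrt n * (L + \<beta>))"
    and T: "\<And>k. T k = nat \<lceil>4 * (n + 2 * sqrt n * (L + \<beta>) / min (\<mu>x + \<beta>) \<mu>y) *
              ln (12 * (2 / (1 - \<rho>) +
                1728 * \<beta> * (L + \<beta>) * (7 * (L + \<beta>) + 2 * sqrt n * \<mu>y) /
                (\<mu>x * \<mu>y * min \<mu>x \<mu>y * (1 - \<rho>)\<^sup>2 * (sqrt q - \<rho>)\<^sup>2)))\<rceil>"
    and K: "K = nat \<lceil>2 / sqrt q * ln (10992 * sqrt n * \<Delta>f * \<kappa>y * \<kappa>x ^ 3 / \<epsilon>)\<rceil>"
    \<comment> \<open>the big-O bound is stated with a constant independent of all data and of the dimensions\<close>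
  shows "measure_pmf.expectation (al_svre n fi' X Y (x0, y0) \<beta> q K p \<tau> T)
           (\<lambda>((x, y), c). duality_gap f X Y x y) \<le> \<epsilon>
    \<and> (\<epsilon> \<le> \<Delta>f \<longrightarrow>
         measure_pmf.expectation (al_svre n fi' X Y (x0, y0) \<beta> q K p \<tau> T) (\<lambda>((x, y), c). real c)
           \<le> 10 ^ 6 * (sqrt (n * (sqrt n + \<kappa>x) * (sqrt n + \<kappa>y)) *
               max 1 (ln (n * \<kappa>x)) * max 1 (ln (n * \<Delta>f * \<kappa>y * \<kappa>x / \<epsilon>))))"
proof -
  note mu = \<mu>
  have "gradient_on (X \<times> Y) f (\<lambda>z. avg n (\<lambda>i. fi' i z))" unfolding f by (rule gradient_on_avg[OF grad])
  then interpret saddle_problem X Y n fi' f \<mu>x \<mu>y L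
    using X Y start n L \<mu> smooth f_cc by (intro saddle_problemI) auto
  have "\<mu>y \<le> L"
  proof (cases "Y = {y0}")
    case False
    then obtain y where "y \<in> Y" "y \<noteq> y0" using start by blast
    then show ?thesis using mu_y_le_L start by blast
  qed (rule degenerate)
  then interpret C: parameters n L \<mu>x \<mu>y \<beta> q
    by unfold_locales (use n mu \<beta> q \<kappa>x \<kappa>y in simp_all)
  interpret A: prox_saddle X Y n fi' f \<mu>x \<mu>y L \<beta>
    by unfold_locales (rule C.beta(1), rule C.beta(2))
  have Aq: "A.q = q" by (simp add: A.q_def q)
  have AG: "A.gap_factor = C.\<Gamma>" by (simp add: A.gap_factor_def C.\<Gamma>_def)
  define t where "t = 1 / (4 * sqrt n * (L + \<beta>))"
  define N where "N = nat \<lceil>4 * (n + 2 * sqrt n * (L + \<beta>) / (\<mu>x + \<beta>)) * ln C.R\<rceil>"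
  have \<tau>_eq: "\<tau> = (\<lambda>_. t)" unfolding t_def by (rule ext) (rule \<tau>)
  have T_eq: "T = (\<lambda>_. N)"
    unfolding N_def using T C.R_eq[OF \<rho>] C.beta(2) by (intro ext) (simp add: min_absorb1)
  define k where "k = sqrt n * C.ky * C.kx ^ 3"
  have kk: "\<kappa>x = C.kx" "\<kappa>y = C.ky" by (simp_all add: \<kappa>x \<kappa>y C.kx_def C.ky_def)
  have p': "0 \<le> p" "p \<le> 1" "p * n = 1 / 2" using n by (simp_all add: p field_simps)
  have N: "real N \<ge> 4 * (n + 2 * sqrt n * (L + \<beta>) / (\<mu>x + \<beta>)) * ln C.R"
    "2 * n + 5 / 2 * real N \<le> 285 * (C.G * max 1 (ln (n * C.kx)))"
    using C.T_bound[OF N_def] by simp_all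
  let ?run = "al_svre_run n fi' X Y (x0, y0) \<beta> q p (\<lambda>_. t) (\<lambda>_. N) K"
  have gap: "measure_pmf.expectation (al_svre n fi' X Y (x0, y0) \<beta> q K p \<tau> T)
      (\<lambda>((x, y), c). duality_gap f X Y x y) = measure_pmf.expectation ?run A.gap_state"
    by (simp add: al_svre_def \<tau>_eq T_eq A.gap_state_def duality_gap_eq case_prod_unfold)
  have cost: "measure_pmf.expectation (al_svre n fi' X Y (x0, y0) \<beta> q K p \<tau> T)
      (\<lambda>((x, y), c). real c) = K * (2 * n + 5 / 2 * real N)"
    using A.outer_cost[OF p'(1,2), of "(x0, y0)" t N K] unfolding Aq
    by (simp add: al_svre_def \<tau>_eq T_eq case_prod_unfold p'(3))
  have \<Delta>: "\<Delta>f = primal x0 - dual y0" unfolding \<Delta>f by (rule duality_gap_eq)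
  have \<Delta>0: "0 \<le> \<Delta>f"
    using primal_upper[OF start] dual_lower[OF start] unfolding \<Delta> by linarith
  have k1: "1 \<le> k"
    using mult_mono[OF mult_mono[OF C.sqrt_n(1) C.kappa(2)] one_le_power[OF C.kappa(1), of 3]] C.kappa by (simp add: k_def)
  define D where "D = 10992 * sqrt n * \<Delta>f * C.ky * C.kx ^ 3 / \<epsilon>"
  have D: "D = 10992 * k * \<Delta>f / \<epsilon>" by (simp add: D_def k_def)
  have K': "K = nat \<lceil>2 / sqrt q * ln D\<rceil>" unfolding K D_def kk ..
  have KD: "2 / sqrt q * ln D \<le> K" unfolding K' by (rule real_nat_ceiling_ge)
  have "measure_pmf.expectation ?run A.gap_state \<le> \<epsilon>"
  \<comment> \<open>For K = 0 the starting point is returned. A positive initial gap then forces D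
    <= 1, hence a gap below eps.\<close>
  proof (cases K)
    case 0
    have "\<Delta>f \<le> \<epsilon>"
    proof (cases "\<Delta>f = 0")
      case False
      then have D0: "D > 0" using \<Delta>0 \<epsilon> k1 unfolding D by (intro divide_pos_pos mult_pos_pos) auto
      have "2 / sqrt q * ln D \<le> 0" using KD 0 by simp
      then have "ln D \<le> 0" using C.r(3) by (simp add: mult_le_0_iff divide_le_0_iff)
      then have "D \<le> 1" using D0 by simp
      then have "10992 * k * \<Delta>f \<le> \<epsilon>" unfolding D using \<epsilon> by simp
      moreover have "1 * \<Delta>f \<le> (10992 * k) * \<Delta>f" using k1 \<Delta>0 by (intro mult_right_mono) auto
      ultimately show ?thesis by linarith
    qed (use \<epsilon> in simp)
    then show ?thesis by (simp add: 0 A.gap_state_def \<Delta>)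
  next
    case (Suc j)
    have \<Delta>pos: "\<Delta>f > 0"
    proof (rule ccontr)
      assume "\<not> \<Delta>f > 0"
      \<comment> \<open>In HOL \<open>ln 0 = 0\<close>, so a vanishing initial gap makes K
        zero.\<close>
      then have "D = 0" using \<Delta>0 by (simp add: D)
      then show False using K' Suc by simp
    qed
    then have D0: "D > 0" using \<epsilon> k1 unfolding D by (intro divide_pos_pos mult_pos_pos) auto
    define B where "B = 10992 * k * \<Delta>f / C.W"
    have R0: "C.R > 0" using C.R_ge(2) by linarith
    have "measure_pmf.expectation ?run A.gap_state \<le> (1 / 8 + 12 * (1 - q) / q\<^sup>2) * B * C.r ^ Suc j"
      unfolding Suc
      by (rule A.outer_convergence[OF start t_def p N(1) R0, of B, unfolded Aq AG, folded C.r_def \<Delta>])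
         (use C.recursion_constants[OF \<Delta>0] in \<open>simp_all only: B_def k_def\<close>)
    also have "\<dots> = 10992 * k * \<Delta>f * C.r ^ K"
      unfolding C.W_def[symmetric] B_def Suc using C.W(1) by simp
    \<comment> \<open>K is the number of stages after which r^K is at most 1 / D, and D carries the
      same prefactor divided by eps.\<close>
    also have "\<dots> \<le> 10992 * k * \<Delta>f * (1 / D)" unfolding C.r_def
    proof (intro mult_left_mono, rule one_minus_power_le)
      show "0 \<le> sqrt q / 2" using C.r(3) by linarith
      show "sqrt q / 2 \<le> 1" using C.r(1) unfolding C.r_def by linarith
      have "sqrt q / 2 * (2 / sqrt q * ln D) \<le> sqrt q / 2 * K"
        using KD C.r(3) by (intro mult_left_mono) auto
      then show "ln D \<le> sqrt q / 2 * K" using C.r(3) by simp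
    qed (use D0 k1 \<Delta>0 in auto)
    also have "10992 * k * \<Delta>f * (1 / D) = \<epsilon>" unfolding D using \<Delta>pos \<epsilon> k1 by simp
    finally show ?thesis .
  qed
  moreover have "K * (2 * n + 5 / 2 * real N) \<le> 10 ^ 6 * (sqrt (n * (sqrt n + \<kappa>x) * (sqrt n + \<kappa>y)) *
      max 1 (ln (n * \<kappa>x)) * max 1 (ln (n * \<Delta>f * \<kappa>y * \<kappa>x / \<epsilon>)))" if "\<epsilon> \<le> \<Delta>f"
  proof -
    define M1 where "M1 = max 1 (ln (n * \<kappa>x))"
    define M2 where "M2 = max 1 (ln (n * \<Delta>f * \<kappa>y * \<kappa>x / \<epsilon>))"
    define E where "E = sqrt (n * (sqrt n + \<kappa>x) * (sqrt n + \<kappa>y))"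
    have M: "0 \<le> M1" "0 \<le> M2" by (simp_all add: M1_def M2_def)
    have "real K \<le> 35 * M2 / sqrt q"
      using C.K_bound[OF \<epsilon> that K'[unfolded D_def]] by (simp only: M2_def kk)
    moreover have "2 * n + 5 / 2 * real N \<le> 285 * (C.G * M1)" using N(2) by (simp only: M1_def kk)
    ultimately have "K * (2 * n + 5 / 2 * real N) \<le> (35 * M2 / sqrt q) * (285 * (C.G * M1))"
      using M C.r(3) by (intro mult_mono) auto
    also have "\<dots> = 9975 * ((C.G / sqrt q) * (M1 * M2))" by simp
    also have "\<dots> \<le> 9975 * ((5 * E) * (M1 * M2))"
      using C.G_bound M unfolding E_def kk by (intro mult_left_mono mult_right_mono) auto
    also have "\<dots> = 49875 * (E * M1 * M2)" by simp
    also have "\<dots> \<le> 10 ^ 6 * (E * M1 * M2)"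
    proof (rule mult_right_mono)
      have "0 \<le> E" unfolding E_def using C.kappa by (simp add: kk)
      then show "0 \<le> E * M1 * M2" using M by simp
    qed simp
    finally show ?thesis unfolding E_def M1_def M2_def .
  qed
  ultimately show ?thesis unfolding gap cost by simp
qed

end
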